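(* The topological isomorphism relation $\cong$ on the space $\mathcal{R}$ of non-degenerate rank-1 words (coding non-degenerate rank-1 systems) is Borel bi-reducible with $E_0$; that is, each of $\cong$ and $E_0$ is Borel reducible to the other. Also, $\cong$ is $F_\sigma$ as a subset of $\mathcal{R}\times\mathcal{R}$.
   Context: $\mathbb{N}$ includes $0$. $\mathcal{F}$ is the set of nonempty finite words over $\{0,1\}$ that begin and end with $0$. Juxtaposition denotes concatenation and $1^a$ is the word consisting of $a$ ones. An infinite word $V\in\{0,1\}^{\mathbb{N}}$ is built from $v\in\mathcal{F}$ if there is a sequence $(a_i)_{i\ge 1}$ of natural numbers with $V=v1^{a_1}v1^{a_2}v\cdots$. $V$ is rank-1 if it is built from infinitely many $v\in\mathcal{F}$. A rank-1 word $V$ is degenerate if $V=vvv\cdots$ for some finite word $v$, and non-degenerate otherwise. The rank-1 system associated to a rank-1 word $V$ is $(X,\sigma)$, where $X=\{x\in\{0,1\}^{\mathbb{Z}} : \text{every finite subword of } x \text{ is a subword of } V\}$ (with the subspace topology of the product topology) and $\sigma(x)(i)=x(i+1)$. $\mathcal{R}$ is the set of non-degenerate rank-1 words, with the (Polish) topology generated by the sets $\{V\in\mathcal{R} : V \text{ is built from } v\}$, $v\in\mathcal{F}$. For $V,W\in\mathcal{R}$ with associated rank-1 systems $(X,\sigma)$ and $(Y,\sigma)$, $V\cong W$ means that there is a homeomorphism $\phi:X\to Y$ with $\phi\circ\sigma=\sigma\circ\phi$. $E_0$ is the equivalence relation on $\{0,1\}^{\mathbb{N}}$ given by $xE_0y\iff\exists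 n\,\forall m>n\; x(m)=y(m)$. An equivalence relation $E$ on a standard Borel space $A$ is Borel reducible to an equivalence relation $F$ on a standard Borel space $B$ if there is a Borel map $f:A\to B$ with $a\,E\,a'\iff f(a)\,F\,f(a')$. *)

theory Defs
  imports "HOL-Analysis.Analysis" "HOL-Library.Omega_Words_Fun"
begin

text \<open>The letters 0 and 1 are represented by the Booleans \<open>False\<close> and \<open>True\<close>, whose
  type-class topology is discrete.  Hence the type-class topologies of
  \<open>nat \<Rightarrow> bool\<close> and \<open>int \<Rightarrow> bool\<close> are the product topologies.\<close>

definition \<F> :: "bool list set"
  where "\<F> = {v. v \<noteq> [] \<and> hd v = False \<and> last v = False}"

text \<open>The infinite word v 1^(a 0) v 1^(a 1) v ... is specified by its initial pieces
  v 1^(a 0) ... v 1^(a (n - 1)).  For nonempty v their lengths are unbounded, so they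
  determine the infinite word.  The exponents are indexed from 0.\<close>

definition built_from :: "bool word \<Rightarrow> bool list \<Rightarrow> bool"
  where "built_from V v \<longleftrightarrow>
    (\<exists>a :: nat \<Rightarrow> nat. \<forall>n. \<exists>U. V = concat (map (\<lambda>i. v @ replicate (a i) True) [0..<n]) \<frown> U)"

definition rank1 :: "bool word \<Rightarrow> bool"
  where "rank1 V \<longleftrightarrow> infinite {v \<in> \<F>. built_from V v}"

definition degenerate :: "bool word \<Rightarrow> bool"
  where "degenerate V \<longleftrightarrow> (\<exists>v. v \<noteq> [] \<and> V = v\<^sup>\<omega>)"

definition \<R> :: "bool word set"
  where "\<R> = {V. rank1 V \<and> \<not> degenerate V}"

definition \<R>_topology :: "bool word topology"
  where "\<R>_topology = topology_generated_by {{V \<in> \<R>. built_from V v} | v. v \<in> \<F>}"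

lemma topspace_\<R>_topology: "topspace \<R>_topology = \<R>"
proof -
  have "\<exists>v\<in>\<F>. built_from V v" if "V \<in> \<R>" for V
  proof -
    have "infinite {v \<in> \<F>. built_from V v}"
      using that by (simp add: \<R>_def rank1_def)
    then have "{v \<in> \<F>. built_from V v} \<noteq> {}"
      using finite.emptyI by metis
    then show ?thesis by blast
  qed
  then show ?thesis
    unfolding \<R>_topology_def topology_generated_by_topspace by blast
qed

definition rank1_system :: "bool word \<Rightarrow> (int \<Rightarrow> bool) set"
  where "rank1_system V =
    {x. \<forall>i n. \<exists>j. map (\<lambda>k. x (i + int k)) [0..<n] = V [j \<rightarrow> j + n]}"

definition shift :: "(int \<Rightarrow> bool) \<Rightarrow> (int \<Rightarrow> bool)"
  where "shift x = (\<lambda>i. x (i + 1))"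

definition isomorphic :: "bool word \<Rightarrow> bool word \<Rightarrow> bool"
  where "isomorphic V W \<longleftrightarrow>
    (\<exists>\<phi>. homeomorphic_map (top_of_set (rank1_system V)) (top_of_set (rank1_system W)) \<phi> \<and>
         (\<forall>x \<in> rank1_system V. \<phi> (shift x) = shift (\<phi> x)))"

definition E\<^sub>0 :: "(nat \<Rightarrow> bool) \<Rightarrow> (nat \<Rightarrow> bool) \<Rightarrow> bool"
  where "E\<^sub>0 x y \<longleftrightarrow> (\<exists>n. \<forall>m>n. x m = y m)"

definition borel_of :: "'a topology \<Rightarrow> 'a measure"
  where "borel_of X = sigma (topspace X) {U. openin X U}"

text \<open>Standard Borel spaces are given here by topologies inducing their Borel structure.\<close>

definition borel_reducible ::
  "'a topology \<Rightarrow> ('a \<Rightarrow> 'a \<Rightarrow> bool) \<Rightarrow> 'b topology \<Rightarrow> ('b \<Rightarrow> 'b \<Rightarrow> bool) \<Rightarrow> bool"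
  where "borel_reducible A E B F \<longleftrightarrow>
    (\<exists>f \<in> borel_of A \<rightarrow>\<^sub>M borel_of B.
       \<forall>a \<in> topspace A. \<forall>a' \<in> topspace A. E a a' \<longleftrightarrow> F (f a) (f a'))"

end

theory Submission
  imports Defs "HOL-Library.Nat_Bijection"
begin

text \<open>
  If \<open>V\<close> is built from \<open>v\<close>, let \<open>D\<close> be the set of positions of the copies of \<open>v\<close>, called a parse of
  \<open>V\<close>.  An occurrence of a pattern of copies of \<open>v\<close> at a position outside of \<open>D\<close> forces all gaps of
  the pattern to be equal.  Since the gaps of a non-degenerate word are not constant, all but finitely
  many parses of \<open>V\<close> are subsets of \<open>D\<close>, and these are determined by \<open>D\<close> alone.  Hence two
  words with a common parse have the same parses up to finitely many exceptions, which reduces the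
  relation of having a common parse to \<open>E\<^sub>0\<close> and shows that it is a countable union of closed
  relations.  Conversely the choice between \<open>v v 1 v\<close> and \<open>v 1 v v\<close> at each level of the
  construction of a word reduces \<open>E\<^sub>0\<close> to it.

  Words with a common parse are isomorphic since both systems are conjugate to the one generated by
  the parse.  Given an isomorphism, one finds a point which equals \<open>V\<close> to the right of some
  place and whose image equals \<open>W\<close> to the right of some place: either \<open>V\<close> preceded by infinitely many
  ones, or a member of a pair of points which agree exactly to the right of some place.  As the
  isomorphism is a block code, the parses of \<open>V\<close> and of \<open>W\<close> are then subsets of each other
  alternately, and this makes one of them common.
\<close>

section \<open>Parses of a word\<close>

text \<open>The obstacle is that the words from which \<open>V\<close> is built need not form a
  chain: \<open>01010101010\<close> is built from \<open>010\<close> and from \<open>01010\<close>,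
  neither of which is built from the other. Recognizability confines such clashes to finitely many,
  and this finite error is why the invariant is one modulo \<open>E\<^sub>0\<close> and not up to
  equality. Parses keep the positions and forget \<open>v\<close>, because isomorphic words share
  position sets while the words standing there may differ. A parse is an infinite set, however, and
  cannot be a single coordinate of a point of Cantor space; only finite traces can, and these have
  to be long enough for almost equal families of traces to glue to one common infinite parse. On the
  converse side, changing one choice alters every coarser block but moves none of the coarser
  copies, since both options have the same length. In the isomorphism argument a block code is blind
  near the ends of a copy, within its radius; blocks longer than the radius restore what is lost
  there.\<close>

definition parse :: "bool word \<Rightarrow> bool list \<Rightarrow> nat set \<Rightarrow> bool"
  where "parse V v D \<longleftrightarrow> v \<in> \<F> \<and> infinite D \<and> 0 \<in> D \<and>
    (\<forall>d\<in>D. \<forall>i<length v. V (d + i) = v ! i) \<and>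
    (\<forall>d\<in>D. \<forall>e\<in>D. d < e \<longrightarrow> d + length v \<le> e) \<and>
    (\<forall>n. \<not> V n \<longrightarrow> (\<exists>d\<in>D. d \<le> n \<and> n < d + length v))"

definition nxt :: "nat set \<Rightarrow> nat \<Rightarrow> nat"
  where "nxt D d = (LEAST e. e \<in> D \<and> d < e)"

lemma nxt:
  assumes "infinite D"
  shows nxt_mem: "nxt D d \<in> D" and nxt_gt: "d < nxt D d"
proof -
  have "\<exists>e. e \<in> D \<and> d < e"
    using assms by (metis infinite_nat_iff_unbounded)
  from LeastI_ex[OF this] show "nxt D d \<in> D" "d < nxt D d"
    by (simp_all add: nxt_def)
qed

lemma nxt_le: "e \<in> D \<Longrightarrow> d < e \<Longrightarrow> nxt D d \<le> e"
  by (simp add: nxt_def Least_le)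

lemma nxt_eqI: "e \<in> D \<Longrightarrow> d < e \<Longrightarrow> (\<And>x. x \<in> D \<Longrightarrow> d < x \<Longrightarrow> e \<le> x) \<Longrightarrow> nxt D d = e"
  unfolding nxt_def by (rule Least_equality) auto

lemma predecessor:
  fixes D :: "nat set"
  assumes "p \<in> D" "q \<in> D" "p < q"
  obtains d where "d \<in> D" "p \<le> d" "d < q" "nxt D d = q"
proof -
  define d where "d = Max {d \<in> D. d < q}"
  have fin: "finite {d \<in> D. d < q}" by simp
  have "d \<in> {d \<in> D. d < q}"
    unfolding d_def by (rule Max_in[OF fin]) (use assms in auto)
  moreover have "x \<le> d" if "x \<in> D" "x < q" for x
    unfolding d_def using that by (intro Max_ge[OF fin]) simp
  ultimately show thesis
    using assms that[of d] by (metis (mono_tags, lifting) leD leI mem_Collect_eq nxt_eqI)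
qed

lemma block_containing:
  assumes "infinite D" "0 \<in> D"
  obtains d where "d \<in> D" "d \<le> n" "n < nxt D d"
proof -
  obtain d where "d \<in> D" "0 \<le> d" "d < nxt D n" "nxt D d = nxt D n"
    using predecessor[of 0 D "nxt D n"] assms nxt[OF assms(1), of n] by (metis gr_implies_not0 neq0_conv)
  moreover have "d \<le> n"
    using calculation nxt_le[of d D n] by (metis leD leI)
  ultimately show thesis
    using that nxt_gt[OF assms(1), of n] by metis
qed

lemma \<F>D:
  assumes "v \<in> \<F>"
  shows "0 < length v" "\<not> v ! 0" "\<not> v ! (length v - 1)"
  using assms by (auto simp: \<F>_def hd_conv_nth last_conv_nth)

lemma \<F>I: "0 < length v \<Longrightarrow> \<not> v ! 0 \<Longrightarrow> \<not> v ! (length v - 1) \<Longrightarrow> v \<in> \<F>"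
  by (auto simp: \<F>_def hd_conv_nth last_conv_nth)

lemma parseD:
  assumes "parse V v D"
  shows "v \<in> \<F>" "infinite D" "0 \<in> D"
    "\<And>d i. d \<in> D \<Longrightarrow> i < length v \<Longrightarrow> V (d + i) = v ! i"
    "\<And>d e. d \<in> D \<Longrightarrow> e \<in> D \<Longrightarrow> d < e \<Longrightarrow> d + length v \<le> e"
    "\<And>n. \<not> V n \<Longrightarrow> \<exists>d\<in>D. d \<le> n \<and> n < d + length v"
  using assms unfolding parse_def by blast+

lemma parse_prefix: "parse V v D \<Longrightarrow> i < length v \<Longrightarrow> V i = v ! i"
  using parseD(3,4)[of V v D] by (metis add_0)

lemma parse_first: "parse V v D \<Longrightarrow> d \<in> D \<Longrightarrow> \<not> V d"
  using parseD(1,4)[of V v D] \<F>D by (metis add.right_neutral)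

lemma parse_last: "parse V v D \<Longrightarrow> d \<in> D \<Longrightarrow> \<not> V (d + length v - 1)"
  using parseD(1,4)[of V v D] \<F>D[of v]
  by (metis (no_types, lifting) Nat.add_diff_assoc One_nat_def Suc_leI diff_less zero_less_one)

lemma parse_nxt: "parse V v D \<Longrightarrow> d \<in> D \<Longrightarrow> d + length v \<le> nxt D d"
  using parseD(2,5) nxt by metis

lemma parse_ones:
  assumes "parse V v D" "d \<in> D" "d + length v \<le> n" "n < nxt D d"
  shows "V n"
proof (rule ccontr)
  assume "\<not> V n"
  then obtain e where e: "e \<in> D" "e \<le> n" "n < e + length v"
    using parseD(6)[OF assms(1)] by blast
  have "e \<le> d" using nxt_le[of e D d] e assms by (meson leD leI order.strict_trans1)
  then have "e + length v \<le> d + length v" by simp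
  with e assms show False by linarith
qed

lemma parse_zero_in:
  assumes "parse V v D" "d \<in> D" "\<not> V n" "d \<le> n" "n < nxt D d"
  shows "n < d + length v"
  using parse_ones assms by (meson leI)

section \<open>Correspondence with \<open>built_from\<close>, and uniqueness of parses\<close>

lemma built_from_imp_parse:
  assumes v: "v \<in> \<F>" and V: "built_from V v"
  shows "\<exists>D. parse V v D"
proof -
  obtain a :: "nat \<Rightarrow> nat" where a: "\<And>n. \<exists>U. V = concat (map (\<lambda>i. v @ replicate (a i) True) [0..<n]) \<frown> U"
    using V unfolding built_from_def by blast
  let ?C = "\<lambda>n. concat (map (\<lambda>i. v @ replicate (a i) True) [0..<n])"
  define pos where "pos n = length (?C n)" for n
  have pos0: "pos 0 = 0" by (simp add: pos_def)
  have posS: "pos (Suc n) = pos n + length v + a n" for n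
    by (simp add: pos_def)
  have cell: "V (pos n + i) = (v @ replicate (a n) True) ! i" if "i < length v + a n" for n i
  proof -
    obtain U where "V = ?C (Suc n) \<frown> U" using a by blast
    then have "V (pos n + i) = (?C n @ (v @ replicate (a n) True)) ! (pos n + i)"
      using that by (simp add: pos_def)
    then show ?thesis by (simp add: pos_def)
  qed
  have vpos: "0 < length v" using \<F>D[OF v] by blast
  have smono: "strict_mono pos"
    unfolding strict_mono_Suc_iff using posS vpos by simp
  have sep: "pos m + length v \<le> pos n" if "m < n" for m n
  proof -
    have "pos (Suc m) \<le> pos n" using smono that by (simp add: strict_mono_less_eq)
    then show ?thesis using posS[of m] by simp
  qed
  have loc: "\<exists>k. pos k \<le> n \<and> n < pos (Suc k)" for n
  proof (induction n)
    case 0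
    show ?case using pos0 posS[of 0] vpos by (intro exI[of _ 0]) simp
  next
    case (Suc n)
    then obtain k where k: "pos k \<le> n" "n < pos (Suc k)" by blast
    show ?case
    proof (cases "Suc n < pos (Suc k)")
      case True then show ?thesis using k by (intro exI[of _ k]) simp
    next
      case False
      then have "Suc n = pos (Suc k)" using k by simp
      then show ?thesis using posS[of "Suc k"] vpos by (intro exI[of _ "Suc k"]) simp
    qed
  qed
  have "parse V v (range pos)"
    unfolding parse_def
  proof (intro conjI ballI allI impI)
    show "v \<in> \<F>" by (rule v)
    show "infinite (range pos)" using smono by (simp add: range_inj_infinite strict_mono_imp_inj_on)
    show "0 \<in> range pos" using pos0 by (metis rangeI)
    show "V (d + i) = v ! i" if "d \<in> range pos" "i < length v" for d i
      using that cell by (auto simp: nth_append)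
    show "d + length v \<le> e" if "d \<in> range pos" "e \<in> range pos" "d < e" for d e
      using that sep smono by (auto simp: strict_mono_less)
    show "\<exists>d\<in>range pos. d \<le> n \<and> n < d + length v" if "\<not> V n" for n
    proof -
      obtain k where k: "pos k \<le> n" "n < pos (Suc k)" using loc by blast
      have "n < pos k + length v"
      proof (rule ccontr)
        assume c: "\<not> n < pos k + length v"
        then have "V (pos k + (n - pos k)) = (v @ replicate (a k) True) ! (n - pos k)"
          using k posS by (intro cell) simp
        also have "\<dots> = True" using c k posS[of k] by (auto simp: nth_append)
        finally show False using that k by simp
      qed
      then show ?thesis using k by blast
    qed
  qed
  then show ?thesis by blast
qed

lemma parse_imp_built_from:
  assumes "parse V v D"
  shows "built_from V v"
proof -
  note inf = parseD(2)[OF assms]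
  define e where "e = enumerate D"
  define a where "a i = e (Suc i) - e i - length v" for i
  have eD: "e i \<in> D" for i using inf by (simp add: e_def enumerate_in_set)
  have enext: "e (Suc i) = nxt D (e i)" for i
    using inf by (simp add: e_def enumerate_Suc'' nxt_def)
  have step: "e i + length v + a i = e (Suc i)" for i
    using parse_nxt[OF assms eD, of i] by (simp add: a_def enext)
  have e0: "e 0 = 0" using parseD(3)[OF assms] by (simp add: e_def enumerate_0 Least_eq_0)
  have "concat (map (\<lambda>i. v @ replicate (a i) True) [0..<n]) = prefix (e n) V" for n
  proof (induction n)
    case 0
    then show ?case by (simp add: e0)
  next
    case (Suc n)
    have "V [e n \<rightarrow> e n + (length v + a n)] = v @ replicate (a n) True"
    proof (rule nth_equalityI, simp_all)
      fix i assume i: "i < length v + a n"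
      show "V (e n + i) = (v @ replicate (a n) True) ! i"
      proof (cases "i < length v")
        case True
        then show ?thesis using parseD(4)[OF assms eD] by (simp add: nth_append)
      next
        case False
        then have "V (e n + i)"
          using i step[of n] by (intro parse_ones[OF assms eD[of n]]) (auto simp: enext[symmetric])
        then show ?thesis using False i by (simp add: nth_append)
      qed
    qed
    then show ?case
      using Suc step[of n] subsequence_append[where i = "e n" and j = "length v + a n" and w = V]
      by (simp add: add.assoc)
  qed
  then show ?thesis
    unfolding built_from_def by (metis prefix_suffix)
qed

text \<open>A parse is read from left to right: after the end of a copy the next one begins at the
  first zero. Hence two parses that are aligned at one place stay aligned for as long as the letters
  agree.\<close>

lemma parse_deterministic:
  assumes D: "parse V v D" and E: "parse W v E" and "p \<in> D" "q \<in> E"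
    and agree: "\<And>i. i < n \<Longrightarrow> V (p + i) = W (q + i)" and "i < n"
  shows "p + i \<in> D \<longleftrightarrow> q + i \<in> E"
proof -
  have one_way: "q + i \<in> E"
    if D: "parse V v D" and E: "parse W v E" and p: "p \<in> D" and q: "q \<in> E"
      and agree: "\<And>i. i < n \<Longrightarrow> V (p + i) = W (q + i)" and i: "i < n" "p + i \<in> D"
    for V W :: "bool word" and D E p q i
    using i
  proof (induction i rule: less_induct)
    case (less i)
    show ?case
    proof (cases "i = 0")
      case True then show ?thesis using q by simp
    next
      case False
      then obtain d where d: "d \<in> D" "p \<le> d" "d < p + i" "nxt D d = p + i"
        using predecessor[OF p less.prems(2)] by auto
      define j where "j = d - p"
      have j: "d = p + j" "j < i" using d by (auto simp: j_def)
      then have jE: "q + j \<in> E" using less d by auto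
      have len: "j + length v \<le> i" using parse_nxt[OF D d(1)] j d by simp
      \<comment> \<open>This zero lies in some copy of \<open>v\<close> in \<open>W\<close>. A copy
        starting before \<open>q + i\<close> would start with a zero where \<open>V\<close> has only
        ones between two consecutive copies.\<close>
      have z: "\<not> W (q + i)" using parse_first[OF D less.prems(2)] agree[OF less.prems(1)] by simp
      then obtain e where e: "e \<in> E" "e \<le> q + i" "q + i < e + length v"
        using parseD(6)[OF E] by blast
      have "q + j < e" using e len by linarith
      then have le: "q + j + length v \<le> e" using parseD(5)[OF E jE e(1)] by simp
      have "e = q + i"
      proof (rule ccontr)
        assume "e \<noteq> q + i"
        define k where "k = e - q"
        have k: "e = q + k" "k < i" "j + length v \<le> k"
          using e le \<open>e \<noteq> q + i\<close> by (auto simp: k_def)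
        have "V (p + k)" using k j d by (intro parse_ones[OF D d(1)]) auto
        moreover have "\<not> W (q + k)" using parse_first[OF E] e k by simp
        ultimately show False using agree[of k] k less.prems by simp
      qed
      then show ?thesis using e by simp
    qed
  qed
  show ?thesis
    using one_way[OF D E assms(3,4) agree] one_way[OF E D assms(4,3) agree[symmetric]] assms(6)
    by blast
qed

lemma parse_unique:
  assumes "parse V v D" "parse V v E"
  shows "D = E"
proof -
  have "i \<in> D \<longleftrightarrow> i \<in> E" for i
    using parse_deterministic[OF assms, of 0 0 "Suc i" i] parseD(3)[OF assms(1)] parseD(3)[OF assms(2)]
    by simp
  then show ?thesis by blast
qed

section \<open>Misaligned occurrences\<close>

text \<open>The gap that a misalignment by \<open>t\<close> forces: if the last zero of
  \<open>v\<close> before index \<open>t\<close> has index \<open>s - 1\<close>, a copy with this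
  offset ends after \<open>s\<close> letters of the next block, and the zero at index
  \<open>t\<close> of that block starts the following copy.\<close>

definition gap_at :: "bool list \<Rightarrow> nat \<Rightarrow> nat"
  where "gap_at v t = length v + t - Suc (Max {i. i < t \<and> \<not> v ! i})"

text \<open>A misaligned copy of \<open>v\<close> consists of the end of one block and the start of the next.
  As the zeros of these two parts add up to the zeros of \<open>v\<close>, the start of the next block which
  is covered contains the same zeros as the first \<open>t\<close> letters of \<open>v\<close>.\<close>

lemma misaligned_step:
  assumes D: "parse V v D" and p: "p \<in> D" and e: "e \<in> D" and t: "0 < t" "t < length v"
    and agree: "\<And>i. i \<le> nxt D p - p \<Longrightarrow> V (e + t + i) = V (p + i)"
  shows "e + t + (nxt D p - p) = nxt D e + t" "nxt D p - p = gap_at v t"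
proof -
  define q E g where "q = e + t" and "E = nxt D e" and "g = nxt D p - p"
  note inf = parseD(2)[OF D]
  have glen: "length v \<le> g" and pg: "p + g = nxt D p"
    using parse_nxt[OF D p] by (auto simp: g_def)
  have Elen: "e + length v \<le> E" using parse_nxt[OF D e] by (simp add: E_def)
  have ED: "E \<in> D" using nxt_mem[OF inf] by (simp add: E_def)
  have agr: "V (q + i) = V (p + i)" if "i \<le> g" for i
    using agree that by (simp add: q_def g_def)
  have copy: "V (q + i) = v ! i" if "i < length v" for i
    using agr[of i] parseD(4)[OF D p that] that glen by simp
  have ones: "V (q + i)" if "length v \<le> i" "i < g" for i
    using agr[of i] parse_ones[OF D p, of "p + i"] that pg by simp
  have zero: "\<not> V (q + g)"
    using agr[of g] parse_first[OF D nxt_mem[OF inf], of p] pg by simp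
  have lenpos: "0 < length v" using t by linarith
  have "V (q + (length v - 1)) = v ! (length v - 1)"
    using lenpos by (intro copy) linarith
  then have lastz: "\<not> V (q + (length v - 1))"
    using \<F>D[OF parseD(1)[OF D]] by metis
  have Eq: "E \<le> q + (length v - 1)"
  proof (rule ccontr)
    assume "\<not> ?thesis"
    then have "q + (length v - 1) < e + length v"
      using parse_zero_in[OF D e lastz] by (auto simp: E_def q_def)
    then show False using t by (simp add: q_def)
  qed
  \<comment> \<open>The copy at \<open>q\<close> covers exactly the first \<open>s\<close> letters
    of the block at \<open>E\<close>.\<close>
  define s where "s = q + length v - E"
  have s: "q + length v = E + s" "1 \<le> s" "s \<le> t" "q \<le> E"
    using Eq Elen lenpos t by (auto simp: s_def q_def)
  define Z where "Z = {i. i < length v \<and> \<not> v ! i}"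
  have finZ: "finite Z" by (simp add: Z_def)
  have low: "v ! i \<longleftrightarrow> t + i < length v \<longrightarrow> v ! (t + i)" if "i < length v" "q + i < E" for i
  proof (cases "t + i < length v")
    case True
    then show ?thesis using copy[OF that(1)] parseD(4)[OF D e True] by (simp add: q_def add.assoc)
  next
    case False
    then have "V (q + i)" using that by (intro parse_ones[OF D e]) (auto simp: q_def E_def)
    then show ?thesis using False copy that by simp
  qed
  have high: "v ! i = v ! (q + i - E)" if "i < length v" "E \<le> q + i" for i
  proof -
    have "q + i - E < length v" using that s t by linarith
    then have "V (E + (q + i - E)) = v ! (q + i - E)" using parseD(4)[OF D ED] by blast
    then show ?thesis using copy[OF that(1)] that by simp
  qed
  have Zeq: "Z = (\<lambda>z. z - t) ` {z \<in> Z. t \<le> z} \<union> (\<lambda>z. z + (E - q)) ` {z \<in> Z. z < s}" (is "_ = ?A \<union> ?B")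
  proof (intro equalityI subsetI)
    fix i assume i: "i \<in> Z"
    show "i \<in> ?A \<union> ?B"
    proof (cases "q + i < E")
      case True
      then have "t + i < length v" "\<not> v ! (t + i)" using low i by (auto simp: Z_def)
      then have "i \<in> ?A" by (intro image_eqI[of _ _ "t + i"]) (auto simp: Z_def)
      then show ?thesis by simp
    next
      case False
      then have "\<not> v ! (q + i - E)" "q + i - E < s" using high i s by (auto simp: Z_def)
      then have "i \<in> ?B" using False s t by (intro image_eqI[of _ _ "q + i - E"]) (auto simp: Z_def)
      then show ?thesis by simp
    qed
  next
    fix i assume "i \<in> ?A \<union> ?B"
    then show "i \<in> Z"
    proof
      assume "i \<in> ?A"
      then obtain z where z: "z \<in> Z" "t \<le> z" "i = z - t" by blast
      then have "q + i < E" "i < length v" using Elen by (auto simp: q_def Z_def)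
      then show ?thesis using low[of i] z by (auto simp: Z_def)
    next
      assume "i \<in> ?B"
      then obtain z where z: "z \<in> Z" "z < s" "i = z + (E - q)" by blast
      then have "i < length v" "E \<le> q + i" "q + i - E = z" using s by auto
      then show ?thesis using high[of i] z by (auto simp: Z_def)
    qed
  qed
  have "card Z = card ?A + card ?B"
  proof (subst Zeq, rule card_Un_disjoint)
    show "?A \<inter> ?B = {}"
    proof (rule ccontr)
      assume "?A \<inter> ?B \<noteq> {}"
      then obtain x y where "x \<in> Z" "t \<le> x" "x - t = y + (E - q)" by auto
      then show False using Elen by (auto simp: Z_def q_def)
    qed
  qed (use finZ in auto)
  also have "card ?A = card {z \<in> Z. t \<le> z}" by (intro card_image inj_onI) auto
  also have "card ?B = card {z \<in> Z. z < s}" by (intro card_image inj_onI) auto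
  finally have c1: "card Z = card {z \<in> Z. t \<le> z} + card {z \<in> Z. z < s}" .
  have c2: "card Z = card {z \<in> Z. t \<le> z} + card {z \<in> Z. z < t}"
    by (subst card_Un_disjoint[symmetric]) (use finZ in \<open>auto intro!: arg_cong[where f = card]\<close>)
  have "{z \<in> Z. z < s} = {z \<in> Z. z < t}"
    by (rule card_subset_eq) (use finZ s c1 c2 in auto)
  then have eqs: "\<And>i. i \<in> Z \<Longrightarrow> i < t \<Longrightarrow> i < s" by blast
  have between: "v ! i" if "s \<le> i" "i < t" for i
    using eqs[of i] that t by (auto simp: Z_def)
  have Et0: "\<not> V (E + t)"
    using parseD(4)[OF D ED t(2)] parseD(4)[OF D e t(2)] agr[of 0] parse_first[OF D p]
    by (simp add: q_def)
  have Eones: "V (E + i)" if "s \<le> i" "i < t" for i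
    using parseD(4)[OF D ED, of i] between that t by simp
  \<comment> \<open>Both sides are the first zero from \<open>q + length v\<close> on: the block at
    \<open>E\<close> has ones from index \<open>s\<close> up to \<open>t\<close> and a zero at
    \<open>t\<close>, while the copy at \<open>q\<close> is followed by ones until the gap
    \<open>g\<close> ends.\<close>
  have main: "q + g = E + t"
  proof (rule linorder_cases)
    assume "q + g < E + t"
    moreover have "E + s \<le> q + g" using s glen by simp
    ultimately have "V (E + (q + g - E))" by (intro Eones) auto
    then show ?thesis using zero \<open>E + s \<le> q + g\<close> by simp
  next
    assume a: "E + t < q + g"
    have "V (q + (E + t - q))" using a s by (intro ones) auto
    then show ?thesis using Et0 s by simp
  qed simp
  then show "e + t + (nxt D p - p) = nxt D e + t" by (simp add: q_def E_def g_def)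
  have "V (E + (s - 1)) = v ! (s - 1)" using s t by (intro parseD(4)[OF D ED]) simp
  moreover have "E + (s - 1) = q + (length v - 1)" using s lenpos by linarith
  ultimately have "\<not> v ! (s - 1)" using lastz by simp
  then have "Max {i. i < t \<and> \<not> v ! i} = s - 1"
  proof (intro Max_eqI)
    show "y \<le> s - 1" if "y \<in> {i. i < t \<and> \<not> v ! i}" for y
      using between[of y] that s by (cases "s \<le> y") auto
  qed (use s in auto)
  then have "gap_at v t = length v + t - s" using s by (simp add: gap_at_def)
  also have "\<dots> = g" using main s by linarith
  finally show "nxt D p - p = gap_at v t" by (simp add: g_def)
qed

text \<open>The misaligned blocks all have the same offset to the parse, which determines their gaps.\<close>

lemma misaligned_gaps_constant:
  assumes D: "parse V v D" and p: "p \<in> D" and r: "r \<in> D" and q: "q \<notin> D"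
    and agree: "\<And>i. i \<le> r - p \<Longrightarrow> V (q + i) = V (p + i)"
  obtains g where "\<And>d. d \<in> D \<Longrightarrow> p \<le> d \<Longrightarrow> nxt D d \<le> r \<Longrightarrow> nxt D d - d = g"
proof -
  note inf = parseD(2)[OF D]
  have "\<not> V q" using agree[of 0] parse_first[OF D p] by simp
  then obtain e0 where e0: "e0 \<in> D" "e0 \<le> q" "q < e0 + length v"
    using parseD(6)[OF D] by blast
  define t where "t = q - e0"
  have t: "0 < t" "t < length v" "q = e0 + t"
    using e0 q by (auto simp: t_def) (metis le_neq_implies_less)
  have step: "e + t + (nxt D d - d) = nxt D e + t \<and> nxt D d - d = gap_at v t"
    if "d \<in> D" "p \<le> d" "nxt D d \<le> r" "e \<in> D" "q + (d - p) = e + t" for d e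
  proof -
    have "V (e + t + i) = V (d + i)" if "i \<le> nxt D d - d" for i
    proof -
      have "d - p + i \<le> r - p" "p + (d - p + i) = d + i" "q + (d - p + i) = e + t + i"
        using that \<open>q + (d - p) = e + t\<close> \<open>p \<le> d\<close> \<open>nxt D d \<le> r\<close> nxt_gt[OF inf, of d] by linarith+
      then show ?thesis using agree[of "d - p + i"] by simp
    qed
    then show ?thesis using misaligned_step[OF D that(1,4) t(1,2)] by blast
  qed
  have off: "\<exists>e\<in>D. q + (d - p) = e + t" if "d \<in> D" "p \<le> d" "d \<le> r" for d
    using that
  proof (induction d rule: less_induct)
    case (less d)
    show ?case
    proof (cases "d = p")
      case True then show ?thesis using e0 t by auto
    next
      case False
      then obtain d0 where d0: "d0 \<in> D" "p \<le> d0" "d0 < d" "nxt D d0 = d"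
        using predecessor[OF p less.prems(1)] less.prems by auto
      then obtain e where e: "e \<in> D" "q + (d0 - p) = e + t" using less by (meson order.trans less_imp_le)
      have "q + (d - p) = q + (d0 - p) + (d - d0)" using d0 by linarith
      also have "\<dots> = nxt D e + t"
        using step[OF d0(1,2) _ e] d0 less.prems e by metis
      finally show ?thesis using nxt_mem[OF inf] by blast
    qed
  qed
  have "nxt D d - d = gap_at v t" if d: "d \<in> D" "p \<le> d" "nxt D d \<le> r" for d
    using off[of d] step[OF d] that nxt_gt[OF inf, of d] by (meson less_imp_le order.trans)
  then show thesis using that by blast
qed

text \<open>A misaligned occurrence forces all gaps of the pattern to be equal, so a window of
  \<open>V\<close> with two different gaps occurs only at positions of the parse. The later
  recognition arguments all reduce to this one.\<close>

lemma parse_recognition: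
  assumes D: "parse V v D" and p: "p \<in> D"
    and d: "d \<in> D" "p \<le> d" "nxt D d \<le> r" and d': "d' \<in> D" "p \<le> d'" "nxt D d' \<le> r"
    and gaps: "nxt D d - d \<noteq> nxt D d' - d'"
    and agree: "\<And>i. i \<le> r - p \<Longrightarrow> V (q + i) = V (p + i)"
  shows "q \<in> D"
proof (rule ccontr)
  assume q: "q \<notin> D"
  define r' where "r' = max (nxt D d) (nxt D d')"
  have r': "r' \<in> D" "r' \<le> r"
    using d d' nxt_mem[OF parseD(2)[OF D]] by (auto simp: r'_def max_def)
  obtain g where "\<And>d. d \<in> D \<Longrightarrow> p \<le> d \<Longrightarrow> nxt D d \<le> r' \<Longrightarrow> nxt D d - d = g"
    using misaligned_gaps_constant[OF D p r'(1) q] agree r'(2) by (metis diff_le_mono order.trans)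
  then show False using d d' gaps by (metis max.cobounded1 max.cobounded2 r'_def)
qed

text \<open>If every gap were equal to the first one, \<open>V\<close> would be the infinite
  repetition of its prefix of that length.\<close>

lemma parse_gaps_differ:
  assumes "\<not> degenerate V" and D: "parse V v D"
  obtains d where "d \<in> D" "nxt D d - d \<noteq> nxt D 0"
proof (rule ccontr)
  assume "\<not> thesis"
  note * = that
  define g where "g = nxt D 0"
  have gap: "nxt D d = d + g" if "d \<in> D" for d
    using \<open>\<not> thesis\<close> *[of d] nxt_gt[OF parseD(2)[OF D], of d]
    by (metis g_def le_add_diff_inverse less_imp_le that)
  have mult: "k * g \<in> D" for k
  proof (induction k)
    case (Suc k)
    then show ?case using gap[OF Suc] nxt_mem[OF parseD(2)[OF D], of "k * g"] by (simp add: add.commute)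
  qed (simp add: parseD(3)[OF D])
  have glen: "length v \<le> g" using parse_nxt[OF D parseD(3)[OF D]] by (simp add: g_def)
  have gpos: "0 < g" using glen \<F>D(1)[OF parseD(1)[OF D]] by linarith
  define u where "u = prefix g V"
  have "V n = V (n mod g)" for n
  proof -
    have "n = n div g * g + n mod g" by simp
    moreover have "n mod g < g" using gpos by simp
    moreover have "V (k * g + i) = V i" if "i < g" for k i
    proof (cases "i < length v")
      case True
      then show ?thesis using parseD(4)[OF D mult] parse_prefix[OF D] by simp
    next
      case False
      then have "V (k * g + i)"
        using that gap[OF mult, of k] by (intro parse_ones[OF D mult[of k]]) auto
      moreover have "V i"
        using False that by (intro parse_ones[OF D parseD(3)[OF D]]) (auto simp: g_def)
      ultimately show ?thesis by simp
    qed
    ultimately show ?thesis by metis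
  qed
  then have "V = u\<^sup>\<omega>" using gpos by (auto simp: u_def)
  then show False using assms(1) gpos unfolding degenerate_def by (metis subsequence_empty u_def not_le)
qed

lemma long_parse_exists:
  assumes "rank1 V"
  obtains v D where "parse V v D" "n \<le> length v"
proof -
  have "finite {v :: bool list. length v < n}"
    using finite_lists_length_le[of "UNIV :: bool set" n] by (rule finite_subset[rotated]) auto
  then obtain v where "v \<in> \<F>" "built_from V v" "\<not> length v < n"
    using assms unfolding rank1_def by (metis (mono_tags, lifting) finite_subset mem_Collect_eq subsetI)
  then show thesis using that built_from_imp_parse by (meson leI)
qed

definition parses :: "bool word \<Rightarrow> nat set set"
  where "parses V = {D. \<exists>v. parse V v D}"

lemma parsesI: "parse V v D \<Longrightarrow> D \<in> parses V"
  by (auto simp: parses_def)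

text \<open>The prefix of \<open>V\<close> up to \<open>r\<close> shows two different gaps of
  \<open>D\<close>, and every copy of a word longer than \<open>r\<close> starts with this
  prefix.\<close>

lemma long_parse_refines:
  assumes "\<not> degenerate V" and D: "parse V v D"
  obtains n where "\<And>v' D'. parse V v' D' \<Longrightarrow> n \<le> length v' \<Longrightarrow> D' \<subseteq> D"
proof -
  obtain d where d: "d \<in> D" "nxt D d - d \<noteq> nxt D 0" using parse_gaps_differ[OF assms] .
  define r where "r = max (nxt D d) (nxt D 0)"
  have "D' \<subseteq> D" if D': "parse V v' D'" and len: "Suc r \<le> length v'" for v' D'
  proof
    fix q assume q: "q \<in> D'"
    show "q \<in> D"
    proof (rule parse_recognition[OF D, of 0 d r 0])
      fix i assume "i \<le> r - 0"
      then show "V (q + i) = V (0 + i)"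
        using parseD(4)[OF D' q, of i] parse_prefix[OF D', of i] len by simp
    qed (use d parseD(3)[OF D] in \<open>auto simp: r_def\<close>)
  qed
  then show thesis using that by blast
qed

section \<open>Refinement and coarsening of parses\<close>

lemma subparse_deterministic:
  assumes D: "parse V v D" and D': "parse V v' D'" and sub: "D' \<subseteq> D" and d: "d \<in> D'" and i: "i < length v'"
  shows "d + i \<in> D \<longleftrightarrow> i \<in> D"
  using parse_deterministic[OF D D, of d 0 "length v'" i] parseD(3)[OF D] parseD(4)[OF D' d] parse_prefix[OF D'] sub d i
  by auto

text \<open>The copy of \<open>v\<close> at \<open>i\<close> ends before the next member of
  \<open>D'\<close>, which also starts a copy of \<open>v\<close>. It ends with a zero, and zeros of
  \<open>V\<close> below \<open>nxt D' 0\<close> lie inside the copy of \<open>v'\<close>.\<close>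

lemma subparse_length:
  assumes D: "parse V v D" and D': "parse V v' D'" and sub: "D' \<subseteq> D" and i: "i \<in> D" "i < length v'"
  shows "i + length v \<le> length v'"
proof -
  have n: "nxt D' 0 \<in> D" using nxt_mem[OF parseD(2)[OF D']] sub by blast
  have "i < nxt D' 0" using i parse_nxt[OF D' parseD(3)[OF D']] by simp
  then have "i + length v \<le> nxt D' 0" using parseD(5)[OF D i(1) n] by simp
  moreover have "0 < length v" using \<F>D[OF parseD(1)[OF D]] by simp
  ultimately have "i + length v - 1 < nxt D' 0" by linarith
  then have "i + length v - 1 < length v'"
    using parse_zero_in[OF D' parseD(3)[OF D'] parse_last[OF D i(1)]] by simp
  then show ?thesis by linarith
qed

lemma subparse_decompose:
  assumes D: "parse V v D" and D': "parse V v' D'" and sub: "D' \<subseteq> D"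
  shows "D = {d + i | d i. d \<in> D' \<and> i \<in> D \<and> i < length v'}"
proof (intro equalityI subsetI)
  fix n assume n: "n \<in> D"
  then obtain d where d: "d \<in> D'" "d \<le> n" "n < d + length v'"
    using parseD(6)[OF D' parse_first[OF D n]] by blast
  then show "n \<in> {d + i | d i. d \<in> D' \<and> i \<in> D \<and> i < length v'}"
    using subparse_deterministic[OF assms d(1), of "n - d"] n
    by (intro CollectI exI[of _ d] exI[of _ "n - d"]) auto
next
  fix n assume "n \<in> {d + i | d i. d \<in> D' \<and> i \<in> D \<and> i < length v'}"
  then show "n \<in> D" using subparse_deterministic[OF assms] by blast
qed

text \<open>The finite word \<open>u\<close> is itself built from \<open>v\<close>, with the
  positions made explicit; this is what is passed on to every infinite word built from
  \<open>u\<close>.\<close>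

definition fparse :: "bool list \<Rightarrow> bool list \<Rightarrow> nat set \<Rightarrow> bool"
  where "fparse u v Q \<longleftrightarrow> v \<in> \<F> \<and> 0 \<in> Q \<and>
    (\<forall>q\<in>Q. q + length v \<le> length u \<and> (\<forall>i<length v. u ! (q + i) = v ! i)) \<and>
    (\<forall>p\<in>Q. \<forall>q\<in>Q. p < q \<longrightarrow> p + length v \<le> q) \<and>
    (\<forall>n<length u. \<not> u ! n \<longrightarrow> (\<exists>q\<in>Q. q \<le> n \<and> n < q + length v))"

lemma fparse_subparse:
  assumes D: "parse V v D" and D': "parse V v' D'" and sub: "D' \<subseteq> D"
  shows "fparse v' v {i \<in> D. i < length v'}"
  unfolding fparse_def
proof (intro conjI ballI allI impI)
  show "v \<in> \<F>" by (rule parseD(1)[OF D])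
  show "0 \<in> {i \<in> D. i < length v'}" using parseD(3)[OF D] \<F>D[OF parseD(1)[OF D']] by simp
  fix q assume q: "q \<in> {i \<in> D. i < length v'}"
  then show l: "q + length v \<le> length v'" using subparse_length[OF assms] by simp
  show "v' ! (q + i) = v ! i" if "i < length v" for i
    using parse_prefix[OF D', of "q + i"] parseD(4)[OF D, of q i] l that q by simp
  show "q + length v \<le> p" if "p \<in> {i \<in> D. i < length v'}" "q < p" for p
    using parseD(5)[OF D] that q by simp
next
  fix n assume n: "n < length v'" "\<not> v' ! n"
  then have "\<not> V n" using parse_prefix[OF D'] by simp
  then obtain d where "d \<in> D" "d \<le> n" "n < d + length v" using parseD(6)[OF D] by blast
  then show "\<exists>q\<in>{i \<in> D. i < length v'}. q \<le> n \<and> n < q + length v" using n by auto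
qed

lemma parse_refine:
  assumes D: "parse V u D" and Q: "fparse u v Q"
  shows "parse V v {d + i | d i. d \<in> D \<and> i \<in> Q}" (is "parse V v ?E")
proof -
  have v: "v \<in> \<F>" and Q0: "0 \<in> Q"
    and Qlen: "\<And>q. q \<in> Q \<Longrightarrow> q + length v \<le> length u"
    and Qcopy: "\<And>q i. q \<in> Q \<Longrightarrow> i < length v \<Longrightarrow> u ! (q + i) = v ! i"
    and Qsep: "\<And>p q. p \<in> Q \<Longrightarrow> q \<in> Q \<Longrightarrow> p < q \<Longrightarrow> p + length v \<le> q"
    and Qcover: "\<And>n. n < length u \<Longrightarrow> \<not> u ! n \<Longrightarrow> \<exists>q\<in>Q. q \<le> n \<and> n < q + length v"
    using Q unfolding fparse_def by blast+
  show ?thesis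
    unfolding parse_def
  proof (intro conjI ballI allI impI)
    show "v \<in> \<F>" by (rule v)
    have "D \<subseteq> ?E" using Q0 by force
    then show "infinite ?E" "0 \<in> ?E" using parseD(2,3)[OF D] finite_subset by blast+
    fix x assume "x \<in> ?E"
    then obtain d q where x: "x = d + q" "d \<in> D" "q \<in> Q" by blast
    show "V (x + i) = v ! i" if "i < length v" for i
      using parseD(4)[OF D x(2), of "q + i"] Qlen[OF x(3)] Qcopy[OF x(3) that] that x(1)
      by (simp add: add.assoc)
    fix y assume "y \<in> ?E" "x < y"
    then obtain e p where y: "y = e + p" "e \<in> D" "p \<in> Q" by blast
    have ed: "\<not> e < d"
    proof
      assume "e < d"
      then have "e + length u \<le> d" using parseD(5)[OF D y(2) x(2)] by simp
      then show False using Qlen[OF y(3)] \<open>x < y\<close> x y by simp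
    qed
    show "x + length v \<le> y"
    proof (cases "d = e")
      case True
      then show ?thesis using Qsep[OF x(3) y(3)] \<open>x < y\<close> x y by simp
    next
      case False
      then have "d + length u \<le> e" using ed parseD(5)[OF D x(2) y(2)] by simp
      then show ?thesis using Qlen[OF x(3)] x y by simp
    qed
  next
    fix n assume "\<not> V n"
    then obtain d where d: "d \<in> D" "d \<le> n" "n < d + length u" using parseD(6)[OF D] by blast
    then have "\<not> u ! (n - d)" using parseD(4)[OF D d(1), of "n - d"] \<open>\<not> V n\<close> by simp
    then obtain q where "q \<in> Q" "q \<le> n - d" "n - d < q + length v" using Qcover[of "n - d"] d by (metis less_diff_conv2 add.commute)
    then show "\<exists>x\<in>?E. x \<le> n \<and> n < x + length v" using d by (intro bexI[of _ "d + q"]) auto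
  qed
qed

text \<open>The blocks of \<open>D0\<close> stand in one and the same pattern \<open>Q\<close> after
  each member of \<open>D\<close>. The piece up to the end of the last block of the pattern is then
  the same word everywhere, and only ones follow it. The condition on \<open>Q\<close> involves
  positions only, so it can be carried from one word to another.\<close>

lemma parse_coarsen:
  assumes D0: "parse V v D0" and sub: "D \<subseteq> D0" and inf: "infinite D" and zero: "0 \<in> D"
    and Q: "\<And>d i. d \<in> D \<Longrightarrow> d + i \<in> D0 \<and> d + i < nxt D d \<longleftrightarrow> i \<in> Q"
  shows "D \<in> parses V"
proof -
  have "Q \<subseteq> {..<nxt D 0}" using Q[OF zero] by auto
  then have finQ: "finite Q" using finite_subset by blast
  have Q0: "0 \<in> Q" using Q[OF zero, of 0] sub zero nxt_gt[OF inf, of 0] by auto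
  define m where "m = Max Q"
  have m: "m \<in> Q" "\<And>i. i \<in> Q \<Longrightarrow> i \<le> m" using finQ Q0 by (auto simp: m_def intro: Max_in)
  \<comment> \<open>The word stops with the last block of the pattern rather than at
    \<open>nxt D 0\<close>, since members of \<open>\<F>\<close> end with a zero.\<close>
  define w where "w = prefix (m + length v) V"
  have len: "length w = m + length v" by (simp add: w_def)
  have lenv: "0 < length v" using \<F>D[OF parseD(1)[OF D0]] by simp
  have last_block: "d + m \<in> D0" "d + m + length v \<le> nxt D d" if "d \<in> D" for d
  proof -
    show *: "d + m \<in> D0" using Q[OF that, of m] m by simp
    have "nxt D d \<in> D0" using nxt_mem[OF inf] sub by blast
    then show "d + m + length v \<le> nxt D d" using Q[OF that, of m] m parseD(5)[OF D0 *] by simp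
  qed
  have "parse V w D"
    unfolding parse_def
  proof (intro conjI ballI allI impI)
    show "infinite D" "0 \<in> D" by fact+
    show "w \<in> \<F>"
    proof (rule \<F>I)
      show "0 < length w" using lenv by (simp add: len)
      show "\<not> w ! 0" using lenv parse_first[OF D0 parseD(3)[OF D0]] by (simp add: w_def)
      show "\<not> w ! (length w - 1)" using lenv parse_last[OF D0 last_block(1)[OF zero]] by (simp add: w_def)
    qed
    fix d assume d: "d \<in> D"
    show "V (d + i) = w ! i" if i: "i < length w" for i
    proof -
      have dD: "d \<in> D0" and zD: "0 \<in> D0" using d sub zero by auto
      have "V (d + i) = V (0 + i)"
      proof (rule ccontr)
        assume "V (d + i) \<noteq> V (0 + i)"
        \<comment> \<open>A zero after \<open>x\<close> lies in a block of the pattern, which has a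
          translate after \<open>y\<close>. The unordered pair covers both ways in which the letters
          can differ.\<close>
        then consider x y where "{x, y} = {d, 0}" "\<not> V (x + i)" "V (y + i)" by blast
        then show False
        proof cases
          case 1
          have xy: "x \<in> D" "y \<in> D" using 1(1) d zero by (metis insert_iff singletonD)+
          obtain z where z: "z \<in> D0" "z \<le> x + i" "x + i < z + length v"
            using parseD(6)[OF D0 1(2)] by blast
          have "x \<le> z"
          proof (rule ccontr)
            assume "\<not> x \<le> z"
            then have "z + length v \<le> x" using parseD(5)[OF D0 z(1)] xy sub by auto
            then show False using z by simp
          qed
          moreover have "x + i < nxt D x" using i len last_block(2)[OF xy(1)] by simp
          ultimately have "z - x \<in> Q" using Q[OF xy(1), of "z - x"] z by simp
          then have "y + (z - x) \<in> D0" using Q[OF xy(2)] by blast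
          then have "V (y + (z - x) + (x + i - z)) = v ! (x + i - z)"
            using z \<open>x \<le> z\<close> by (intro parseD(4)[OF D0]) auto
          moreover have "V (z + (x + i - z)) = v ! (x + i - z)"
            using z by (intro parseD(4)[OF D0]) auto
          ultimately show False using 1 z \<open>x \<le> z\<close> by simp
        qed
      qed
      then show ?thesis using i by (simp add: w_def)
    qed
    show "d + length w \<le> e" if "e \<in> D" "d < e" for e
      using last_block(2)[OF d] nxt_le[OF that] len by simp
  next
    fix n assume "\<not> V n"
    then obtain z where z: "z \<in> D0" "z \<le> n" "n < z + length v" using parseD(6)[OF D0] by blast
    obtain d where d: "d \<in> D" "d \<le> z" "z < nxt D d" using block_containing[OF inf zero] .
    then have "z - d \<in> Q" using Q[OF d(1), of "z - d"] z by simp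
    then have "z - d \<le> m" using m by blast
    then show "\<exists>d\<in>D. d \<le> n \<and> n < d + length w" using d z len by (intro bexI[of _ d]) auto
  qed
  then show ?thesis by (rule parsesI)
qed

section \<open>Coding the parses of a word\<close>

lemma subparse_pattern:
  assumes D: "parse V v D" and D': "parse V v' D'" and sub: "D' \<subseteq> D" and d: "d \<in> D'"
  shows "d + i \<in> D \<and> d + i < nxt D' d \<longleftrightarrow> i \<in> D \<and> i < length v'"
proof (cases "i < length v'")
  case True
  then show ?thesis
    using subparse_deterministic[OF assms True] parse_nxt[OF D' d] by auto
next
  case False
  then show ?thesis
    using parse_zero_in[OF D' d, of "d + i"] parse_first[OF D, of "d + i"] by auto
qed

lemma subparse_decompose_nxt:
  assumes "D \<in> parses V" "D' \<in> parses V" "D' \<subseteq> D"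
  shows "D = {d + i | d i. d \<in> D' \<and> i \<in> D \<and> i < nxt D' 0}"
proof -
  obtain v v' where p: "parse V v D" "parse V v' D'" using assms by (auto simp: parses_def)
  have "i \<in> D \<and> i < length v' \<longleftrightarrow> i \<in> D \<and> i < nxt D' 0" for i
    using subparse_pattern[OF p assms(3) parseD(3)[OF p(2)], of i] by auto
  then show ?thesis using subparse_decompose[OF p assms(3)] by presburger
qed

text \<open>Parses by long words are subsets of \<open>D\<close>, and each of the finitely many
  shorter words has at most one parse.\<close>

lemma finite_non_refining:
  assumes "\<not> degenerate V" "D \<in> parses V"
  shows "finite {D' \<in> parses V. \<not> D' \<subseteq> D}"
proof -
  obtain v where "parse V v D" using assms by (auto simp: parses_def)
  then obtain n where n: "\<And>v' D'. parse V v' D' \<Longrightarrow> n \<le> length v' \<Longrightarrow> D' \<subseteq> D"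
    using long_parse_refines[OF assms(1)] by metis
  have "finite {v :: bool list. length v < n}"
    using finite_lists_length_le[of "UNIV :: bool set" n] by (rule finite_subset[rotated]) auto
  moreover have "{D' \<in> parses V. \<not> D' \<subseteq> D} \<subseteq> (\<lambda>v. THE D. parse V v D) ` {v. length v < n}"
  proof
    fix D' assume D': "D' \<in> {D' \<in> parses V. \<not> D' \<subseteq> D}"
    then obtain v' where v': "parse V v' D'" by (auto simp: parses_def)
    then have "(THE D. parse V v' D) = D'" by (metis parse_unique the_equality)
    moreover have "length v' < n" using n[OF v'] D' by (metis (mono_tags, lifting) leI mem_Collect_eq)
    ultimately show "D' \<in> (\<lambda>v. THE D. parse V v D) ` {v. length v < n}" by blast
  qed
  ultimately show ?thesis using finite_surj by blast
qed

text \<open>That \<open>D'\<close> arises from \<open>D\<close> by a constant pattern is a property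
  of the two position sets alone, so it holds in \<open>W\<close> as well, with other letters in the
  blocks.\<close>

lemma parses_transfer:
  assumes V: "D \<in> parses V" "D' \<in> parses V" and W: "D \<in> parses W" and sub: "D' \<subseteq> D"
  shows "D' \<in> parses W"
proof -
  obtain v v' w where p: "parse V v D" "parse V v' D'" "parse W w D"
    using V W by (auto simp: parses_def)
  show ?thesis
    by (rule parse_coarsen[OF p(3) sub parseD(2,3)[OF p(2)], where Q = "{i \<in> D. i < length v'}"])
      (use subparse_pattern[OF p(1,2) sub] in simp)
qed

definition common_parse :: "bool word \<Rightarrow> bool word \<Rightarrow> bool"
  where "common_parse V W \<longleftrightarrow> parses V \<inter> parses W \<noteq> {}"

lemma common_parse_sym: "common_parse V W \<Longrightarrow> common_parse W V"
  by (auto simp: common_parse_def)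

lemma finite_parses_diff:
  assumes "\<not> degenerate V" "common_parse V W"
  shows "finite (parses V - parses W)"
proof -
  obtain D where D: "D \<in> parses V" "D \<in> parses W" using assms(2) by (auto simp: common_parse_def)
  have "parses V - parses W \<subseteq> {D' \<in> parses V. \<not> D' \<subseteq> D}"
    using parses_transfer[OF D(1) _ D(2)] by blast
  then show ?thesis using finite_non_refining[OF assms(1) D(1)] finite_subset by blast
qed

text \<open>If two words have the same first return, the longer one would have its final zero among
  the ones that follow the first copy of the shorter one. So the first return to 0 names a parse of
  \<open>V\<close>.\<close>

lemma parses_eqI:
  assumes D: "D \<in> parses V" and E: "E \<in> parses V" and eq: "nxt D 0 = nxt E 0"
  shows "D = E"
proof -
  obtain v w where p: "parse V v D" "parse V w E" using D E by (auto simp: parses_def)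
  have le: "length w \<le> length v"
    if "parse V v D" "parse V w E" "nxt D 0 = nxt E 0" for v w D E
  proof (rule ccontr)
    assume less: "\<not> length w \<le> length v"
    have w: "length w \<le> nxt D 0" using parse_nxt[OF that(2) parseD(3)[OF that(2)]] that(3) by simp
    have "V (length w - 1)"
      using less w by (intro parse_ones[OF that(1) parseD(3)[OF that(1)]]) auto
    then show False using parse_last[OF that(2) parseD(3)[OF that(2)]] by simp
  qed
  have "length v = length w" using le[OF p eq] le[OF p(2,1) eq[symmetric]] by simp
  then have "v = w"
    using parse_prefix[OF p(1)] parse_prefix[OF p(2)] by (auto intro!: nth_equalityI)
  then show ?thesis using p parse_unique by auto
qed

lemma parsesD: "D \<in> parses V \<Longrightarrow> infinite D" "D \<in> parses V \<Longrightarrow> 0 \<in> D"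
  using parseD(2,3) by (auto simp: parses_def)

lemma psubset_nxt_less:
  assumes "D \<in> parses V" "D' \<in> parses V" "D' \<subset> D"
  shows "nxt D 0 < nxt D' 0"
proof -
  have "nxt D 0 \<le> nxt D' 0"
    using assms nxt_mem[OF parsesD(1)[OF assms(2)], of 0] nxt_gt[OF parsesD(1)[OF assms(2)], of 0]
    by (auto intro: nxt_le)
  moreover have "nxt D 0 \<noteq> nxt D' 0" using parses_eqI assms by blast
  ultimately show ?thesis by simp
qed

lemma parses_unbounded:
  assumes "rank1 V"
  obtains D where "D \<in> parses V" "n \<le> nxt D 0"
  using long_parse_exists[OF assms, of n] parse_nxt[OF _ parseD(3)] parsesI
  by (metis add_0 order.trans)

text \<open>A word is coded by the traces of its parses \<open>D\<close> on the initial segment which ends at the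
  first gap of the next coarser parse.  These traces overlap enough for all but finitely many of
  them to determine a parse.\<close>

definition next_return :: "bool word \<Rightarrow> nat set \<Rightarrow> nat"
  where "next_return V D = (LEAST k. \<exists>D'\<in>parses V. D' \<subset> D \<and> nxt D' 0 = k)"

definition ptrace :: "bool word \<Rightarrow> nat set \<Rightarrow> nat set"
  where "ptrace V D = {d \<in> D. d \<le> next_return V D}"

definition ptraces :: "bool word \<Rightarrow> nat set set"
  where "ptraces V = ptrace V ` parses V"

lemma next_parse:
  assumes V: "rank1 V" "\<not> degenerate V" and D: "D \<in> parses V"
  obtains D' where "D' \<in> parses V" "D' \<subset> D" "nxt D' 0 = next_return V D"
proof -
  obtain v where p: "parse V v D" using D by (auto simp: parses_def)
  obtain n where n: "\<And>v' D'. parse V v' D' \<Longrightarrow> n \<le> length v' \<Longrightarrow> D' \<subseteq> D"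
    using long_parse_refines[OF V(2) p] by metis
  obtain v' D' where p': "parse V v' D'" "max n (Suc (nxt D 0)) \<le> length v'"
    using long_parse_exists[OF V(1)] .
  have "D' \<noteq> D" using parse_nxt[OF p'(1) parseD(3)[OF p'(1)]] p'(2) by auto
  then have "D' \<subset> D" using n[OF p'(1)] p'(2) by auto
  then have "\<exists>k. \<exists>D'\<in>parses V. D' \<subset> D \<and> nxt D' 0 = k" using parsesI[OF p'(1)] by blast
  from LeastI_ex[OF this] show thesis
    using that unfolding next_return_def by blast
qed

lemma next_return_mem:
  assumes V: "rank1 V" "\<not> degenerate V" and D: "D \<in> parses V"
  shows "next_return V D \<in> D" "nxt D 0 < next_return V D"
proof -
  obtain D' where D': "D' \<in> parses V" "D' \<subset> D" "nxt D' 0 = next_return V D"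
    using next_parse[OF assms] .
  then show "next_return V D \<in> D" using nxt_mem[OF parsesD(1)[OF D'(1)], of 0] by auto
  show "nxt D 0 < next_return V D" using psubset_nxt_less[OF D D'(1,2)] D'(3) by simp
qed

lemma Max_ptrace:
  assumes "rank1 V" "\<not> degenerate V" "D \<in> parses V"
  shows "Max (ptrace V D) = next_return V D"
  using next_return_mem[OF assms] by (intro Max_eqI) (auto simp: ptrace_def)

lemma nxt_ptrace:
  assumes "rank1 V" "\<not> degenerate V" "D \<in> parses V"
  shows "nxt (ptrace V D) 0 = nxt D 0"
  using next_return_mem(2)[OF assms] nxt[OF parsesD(1)[OF assms(3)], of 0]
  by (intro nxt_eqI) (auto simp: ptrace_def intro: nxt_le)

lemma finite_ptrace: "finite (ptrace V D)"
  by (auto simp: ptrace_def)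

text \<open>The trace of \<open>D\<close> depends on \<open>D\<close> and on the parses properly
  inside it. It can differ in \<open>W\<close> only if \<open>D\<close> is exceptional or properly
  contains an exceptional parse, and an exceptional parse has only finitely many proper supersets
  because it contains almost all other parses.\<close>

lemma finite_ptraces_diff:
  assumes V: "\<not> degenerate V" and W: "\<not> degenerate W" and c: "common_parse V W"
  shows "finite (ptraces V - ptraces W)"
proof -
  define F where "F = (parses V - parses W) \<union> (parses W - parses V)"
  define B where "B = F \<union> (\<Union>D'\<in>F. {D \<in> parses V \<inter> parses W. D' \<subset> D})"
  have finF: "finite F"
    unfolding F_def using finite_parses_diff[OF V c] finite_parses_diff[OF W common_parse_sym[OF c]] by blast
  have "finite {D \<in> parses V \<inter> parses W. D' \<subset> D}" if "D' \<in> F" for D'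
  proof -
    have "D' \<in> parses V \<or> D' \<in> parses W" using that by (auto simp: F_def)
    then have "finite {D \<in> parses V. \<not> D \<subseteq> D'} \<or> finite {D \<in> parses W. \<not> D \<subseteq> D'}"
      using finite_non_refining V W by blast
    then show ?thesis by (rule disjE) (erule finite_subset[rotated], blast)+
  qed
  then have finB: "finite B" using finF by (simp add: B_def)
  have "ptraces V - ptraces W \<subseteq> ptrace V ` B"
  proof
    fix A assume A: "A \<in> ptraces V - ptraces W"
    then obtain D where D: "D \<in> parses V" "A = ptrace V D" by (auto simp: ptraces_def)
    have "D \<in> B"
    proof (rule ccontr)
      assume nB: "D \<notin> B"
      then have DW: "D \<in> parses W" using D by (auto simp: B_def F_def)
      have "(\<exists>D'\<in>parses V. D' \<subset> D \<and> nxt D' 0 = k) \<longleftrightarrow> (\<exists>D'\<in>parses W. D' \<subset> D \<and> nxt D' 0 = k)" for k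
        using nB D(1) DW unfolding B_def F_def by blast
      then have "ptrace V D = ptrace W D" by (simp add: ptrace_def next_return_def)
      then show False using A D DW by (auto simp: ptraces_def)
    qed
    then show "A \<in> ptrace V ` B" using D by blast
  qed
  then show ?thesis using finB finite_surj by blast
qed

text \<open>Along a chain of successive parses beyond the exceptional traces, each trace reaches
  exactly to the first return of the next level. This overlap identifies consecutive levels in
  \<open>W\<close>, and the finest levels \<open>D0\<close> and \<open>Es 0\<close> are rebuilt from
  the traces on ever longer initial segments.\<close>

lemma common_parse_if_ptraces:
  assumes V: "rank1 V" "\<not> degenerate V" and W: "rank1 W" "\<not> degenerate W"
    and fin: "finite (ptraces V - ptraces W)"
  shows "common_parse V W"
proof -
  have "finite (\<Union>(ptraces V - ptraces W))"
    using fin finite_ptrace by (auto simp: ptraces_def)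
  then obtain b where b: "\<And>x. x \<in> \<Union>(ptraces V - ptraces W) \<Longrightarrow> x \<le> b"
    using finite_nat_set_iff_bounded_le by (metis (no_types, lifting))
  \<comment> \<open>Every trace in the chain starting here contains a number above \<open>b\<close>,
    so none of them is exceptional.\<close>
  obtain D0 where D0: "D0 \<in> parses V" "Suc b \<le> nxt D0 0" using parses_unbounded[OF V(1)] .
  define S where "S D = (SOME D'. D' \<in> parses V \<and> D' \<subset> D \<and> nxt D' 0 = next_return V D)" for D
  have S: "S D \<in> parses V" "S D \<subset> D" "nxt (S D) 0 = next_return V D" if D: "D \<in> parses V" for D
    using someI_ex[of "\<lambda>D'. D' \<in> parses V \<and> D' \<subset> D \<and> nxt D' 0 = next_return V D"] next_parse[OF V D]
    unfolding S_def by metis+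
  define Ds where "Ds n = (S ^^ n) D0" for n
  define k where "k n = nxt (Ds n) 0" for n
  have Ds: "Ds n \<in> parses V" for n
    by (induction n) (auto simp: Ds_def D0 S)
  have Ds0: "Ds 0 = D0" by (simp add: Ds_def)
  have DsSuc: "Ds (Suc n) \<subset> Ds n" "k (Suc n) = next_return V (Ds n)" for n
    using S[OF Ds, of n] by (auto simp: Ds_def k_def)
  have k: "k n < k (Suc n)" for n
    using psubset_nxt_less[OF Ds Ds DsSuc(1)] by (simp add: k_def)
  then have smk: "strict_mono k" by (simp add: strict_mono_Suc_iff)
  have Ds_sub: "Ds n \<subseteq> D0" for n
    by (induction n) (use Ds0 DsSuc(1) in auto)
  have "ptrace V (Ds n) \<in> ptraces W" for n
  proof (rule ccontr)
    assume c: "ptrace V (Ds n) \<notin> ptraces W"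
    have "k n \<in> ptrace V (Ds n)"
      using next_return_mem(2)[OF V Ds, of n] nxt_mem[OF parsesD(1)[OF Ds], of n 0]
      by (auto simp: ptrace_def k_def)
    moreover have "ptrace V (Ds n) \<in> ptraces V - ptraces W" using c Ds by (auto simp: ptraces_def)
    ultimately have "k n \<le> b" using b by blast
    moreover have "k 0 \<le> k n" using smk by (simp add: strict_mono_less_eq)
    ultimately show False using D0 by (simp add: k_def Ds0)
  qed
  then have "\<exists>E. E \<in> parses W \<and> ptrace W E = ptrace V (Ds n)" for n
    unfolding ptraces_def by (metis imageE)
  then obtain Es where Es: "\<And>n. Es n \<in> parses W" and tr: "\<And>n. ptrace W (Es n) = ptrace V (Ds n)"
    by metis
  \<comment> \<open>The maximum of a trace is the first return of the next level, so that return is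
    recovered from the trace alone; this makes \<open>Es (Suc n)\<close> the next parse after
    \<open>Es n\<close>.\<close>
  have ret: "next_return W (Es n) = k (Suc n)" for n
    using Max_ptrace[OF W Es, of n] Max_ptrace[OF V Ds, of n] tr[of n] DsSuc(2)[of n] by simp
  have kE: "nxt (Es n) 0 = k n" for n
    using nxt_ptrace[OF W Es, of n] nxt_ptrace[OF V Ds, of n] tr[of n] by (simp add: k_def)
  have EsSuc: "Es (Suc n) \<subset> Es n" for n
  proof -
    obtain E' where E': "E' \<in> parses W" "E' \<subset> Es n" "nxt E' 0 = next_return W (Es n)"
      using next_parse[OF W Es] .
    then have "E' = Es (Suc n)" using parses_eqI[OF E'(1) Es] ret kE by simp
    then show ?thesis using E' by simp
  qed
  have Es_sub: "Es n \<subseteq> Es 0" for n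
    by (induction n) (use EsSuc in auto)
  have level: "x \<in> Ds n \<longleftrightarrow> x \<in> Es n" if "x \<le> k (Suc n)" for x n
    using tr[of n] that ret[of n] DsSuc(2)[of n] by (auto simp: ptrace_def)
  \<comment> \<open>Up to \<open>k (Suc n)\<close> the trace gives the positions of level
    \<open>n\<close>, and below \<open>k n\<close> the induction hypothesis gives the pattern of
    \<open>D0\<close> inside a block of that level; together they give \<open>D0\<close> up to
    \<open>k (Suc n)\<close>.\<close>
  have agree: "x \<in> D0 \<longleftrightarrow> x \<in> Es 0" if "x \<le> k n" for x n
    using that
  proof (induction n arbitrary: x)
    case 0
    then show ?case using level[of x 0] k[of 0] by (simp add: Ds0)
  next
    case (Suc n)
    have half: "x \<in> E"
      if D: "D = {d + i | d i. d \<in> D' \<and> i \<in> D \<and> i < k n}"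
        and E: "E = {d + i | d i. d \<in> E' \<and> i \<in> E \<and> i < k n}"
        and D': "\<And>x. x \<le> k (Suc n) \<Longrightarrow> x \<in> D' \<Longrightarrow> x \<in> E'"
        and IH: "\<And>x. x \<le> k n \<Longrightarrow> x \<in> D \<Longrightarrow> x \<in> E" and x: "x \<in> D"
      for D D' E E' :: "nat set"
    proof -
      have "x \<in> {d + i | d i. d \<in> D' \<and> i \<in> D \<and> i < k n}" using x D by blast
      then obtain d i where di: "x = d + i" "d \<in> D'" "i \<in> D" "i < k n" by blast
      then have "d \<in> E'" "i \<in> E" using D'[of d] IH[of i] Suc.prems by auto
      then have "x \<in> {d + i | d i. d \<in> E' \<and> i \<in> E \<and> i < k n}" using di by blast
      then show ?thesis using E by blast
    qed
    have eqD: "D0 = {d + i | d i. d \<in> Ds n \<and> i \<in> D0 \<and> i < k n}"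
      using subparse_decompose_nxt[OF D0(1) Ds Ds_sub] by (simp add: k_def)
    have eqE: "Es 0 = {d + i | d i. d \<in> Es n \<and> i \<in> Es 0 \<and> i < k n}"
      using subparse_decompose_nxt[OF Es Es Es_sub] by (simp add: kE)
    show ?case
    proof
      assume "x \<in> D0"
      then show "x \<in> Es 0"
        using level Suc.IH by (intro half[OF eqD eqE]) simp_all
    next
      assume "x \<in> Es 0"
      then show "x \<in> D0"
        using level Suc.IH by (intro half[OF eqE eqD]) simp_all
    qed
  qed
  have "D0 = Es 0"
    using agree[OF strict_mono_imp_increasing[OF smk]] by blast
  then show ?thesis using D0 Es by (auto simp: common_parse_def)
qed

section \<open>Topology and measurability\<close>

lemma \<R>D: "V \<in> \<R> \<Longrightarrow> rank1 V" "V \<in> \<R> \<Longrightarrow> \<not> degenerate V"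
  by (auto simp: \<R>_def)

lemma parse_zeros_unbounded:
  assumes "parse V v D"
  obtains n where "m < n" "\<not> V n" "n \<in> D"
  using parse_first[OF assms] parseD(2)[OF assms] infinite_nat_iff_unbounded by metis

text \<open>The parses of the approximations cohere, because membership of \<open>n\<close> depends
  on the letters up to \<open>n\<close> only. The zeros make the limit set infinite; without them
  finitely many copies followed by ones could arise as a limit.\<close>

lemma parse_limit:
  assumes v: "v \<in> \<F>" and zeros: "\<And>m. \<exists>n>m. \<not> V n"
    and approx: "\<And>N. \<exists>V' D'. parse V' v D' \<and> (\<forall>i<N. V' i = V i)"
  shows "\<exists>D. parse V v D"
proof -
  obtain V' D' where p: "\<And>N. parse (V' N) v (D' N)" and agree: "\<And>N i. i < N \<Longrightarrow> V' N i = V i"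
    using approx by metis
  have coh: "n \<in> D' N \<longleftrightarrow> n \<in> D' (Suc n)" if "n < N" for n N
    using parse_deterministic[OF p[of N] p[of "Suc n"] parseD(3)[OF p] parseD(3)[OF p], of "Suc n" n]
      agree that by auto
  define D where "D = {n. n \<in> D' (Suc n)}"
  have D: "n \<in> D \<longleftrightarrow> n \<in> D' N" if "n < N" for n N
    using coh[OF that] by (simp add: D_def)
  have cover: "\<exists>d\<in>D. d \<le> n \<and> n < d + length v" if "\<not> V n" for n
    using parseD(6)[OF p[of "Suc n"], of n] agree[of n "Suc n"] that D[of _ "Suc n"] by (metis le_imp_less_Suc lessI)
  have "parse V v D"
    unfolding parse_def
  proof (intro conjI ballI allI impI)
    show "v \<in> \<F>" by (rule v)
    show "0 \<in> D" using parseD(3)[OF p] by (simp add: D_def)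
    show "infinite D"
      unfolding infinite_nat_iff_unbounded
    proof
      fix m
      obtain n where n: "m + length v < n" "\<not> V n" using zeros by blast
      then obtain d where "d \<in> D" "n < d + length v" using cover by blast
      then show "\<exists>n>m. n \<in> D" using n by (intro exI[of _ d]) simp
    qed
    show "V (d + i) = v ! i" if "d \<in> D" "i < length v" for d i
      using parseD(4)[OF p[of "Suc (d + i)"], of d i] that D[of d "Suc (d + i)"] agree[of "d + i" "Suc (d + i)"] by simp
    show "d + length v \<le> e" if "d \<in> D" "e \<in> D" "d < e" for d e
      using parseD(5)[OF p[of "Suc e"], of d e] that D[of _ "Suc e"] by simp
  qed (use cover in blast)
  then show ?thesis by blast
qed

text \<open>The set \<open>dset V v\<close> is empty if \<open>V\<close> is not built from \<open>v\<close>.\<close>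

definition dset :: "bool word \<Rightarrow> bool list \<Rightarrow> nat set"
  where "dset V v = {n. \<exists>D. parse V v D \<and> n \<in> D}"

lemma dset_eq: "parse V v D \<Longrightarrow> dset V v = D"
  using parse_unique by (auto simp: dset_def)

lemma zero_in_dset: "0 \<in> dset V v \<longleftrightarrow> (\<exists>D. parse V v D)"
  using parseD(3) by (auto simp: dset_def)

lemma parse_iff_dset: "parse V v D \<longleftrightarrow> 0 \<in> dset V v \<and> D = dset V v"
  using zero_in_dset dset_eq by metis

lemma parses_eq_dset: "parses V = {dset V v | v. 0 \<in> dset V v}"
  unfolding parses_def using parse_iff_dset by blast

text \<open>Single generators of the topology serve as neighbourhoods, since one long enough word
  decides any finite amount of information on \<open>V\<close>.\<close>

definition locally_constant :: "(bool word \<Rightarrow> bool) \<Rightarrow> bool"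
  where "locally_constant P \<longleftrightarrow>
    (\<forall>V\<in>\<R>. \<exists>u\<in>\<F>. built_from V u \<and> (\<forall>V'\<in>\<R>. built_from V' u \<longrightarrow> P V' = P V))"

lemma openin_\<R>_topologyI:
  assumes "S \<subseteq> \<R>" and "\<And>V. V \<in> S \<Longrightarrow> \<exists>u\<in>\<F>. built_from V u \<and> (\<forall>V'\<in>\<R>. built_from V' u \<longrightarrow> V' \<in> S)"
  shows "openin \<R>_topology S"
proof (subst openin_subopen, intro ballI)
  fix V assume V: "V \<in> S"
  then obtain u where u: "u \<in> \<F>" "built_from V u" "\<forall>V'\<in>\<R>. built_from V' u \<longrightarrow> V' \<in> S"
    using assms by blast
  have "openin \<R>_topology {V \<in> \<R>. built_from V u}"
    unfolding \<R>_topology_def using u(1) by (intro topology_generated_by_Basis) blast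
  then show "\<exists>T. openin \<R>_topology T \<and> V \<in> T \<and> T \<subseteq> S"
    using u V assms(1) by (intro exI[of _ "{V \<in> \<R>. built_from V u}"]) auto
qed

lemma locally_constant_clopen:
  assumes "locally_constant P"
  shows "openin \<R>_topology {V \<in> \<R>. P V}" "closedin \<R>_topology {V \<in> \<R>. P V}"
proof -
  have *: "\<exists>u\<in>\<F>. built_from V u \<and> (\<forall>V'\<in>\<R>. built_from V' u \<longrightarrow> V' \<in> {V \<in> \<R>. P V \<longleftrightarrow> b})"
    if "V \<in> {V \<in> \<R>. P V \<longleftrightarrow> b}" for V b
    using assms that unfolding locally_constant_def by fast
  show "openin \<R>_topology {V \<in> \<R>. P V}"
    using openin_\<R>_topologyI[OF _ *[where b = True]] by simp
  have "openin \<R>_topology {V \<in> \<R>. \<not> P V}"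
    using openin_\<R>_topologyI[OF _ *[where b = False]] by simp
  moreover have "\<R> - {V \<in> \<R>. P V} = {V \<in> \<R>. \<not> P V}" by blast
  ultimately show "closedin \<R>_topology {V \<in> \<R>. P V}"
    by (auto simp: closedin_def topspace_\<R>_topology)
qed

lemma long_built_from:
  assumes "V \<in> \<R>"
  obtains u where "u \<in> \<F>" "built_from V u" "\<And>V' i. built_from V' u \<Longrightarrow> i < n \<Longrightarrow> V' i = V i"
proof -
  obtain u D where u: "parse V u D" "n \<le> length u" using long_parse_exists[OF \<R>D(1)[OF assms]] .
  show thesis
  proof (rule that[OF parseD(1)[OF u(1)] parse_imp_built_from[OF u(1)]])
    fix V' i assume V': "built_from V' u" and i: "i < n"
    obtain D' where "parse V' u D'" using V' built_from_imp_parse[OF parseD(1)[OF u(1)]] by blast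
    then show "V' i = V i" using parse_prefix[of V' u D' i] parse_prefix[OF u(1), of i] i u(2) by simp
  qed
qed

text \<open>If \<open>u\<close> is long, its parse lies in \<open>D\<close> and \<open>u\<close>
  itself decomposes into copies of \<open>v\<close>; hence every word built from \<open>u\<close> is
  built from \<open>v\<close>, with the same positions inside the common prefix.\<close>

lemma long_built_from_built_from:
  assumes "V \<in> \<R>" and D: "parse V v D"
  obtains u where "u \<in> \<F>" "built_from V u" "n \<le> length u"
    "\<And>V'. built_from V' u \<Longrightarrow> \<exists>D'. parse V' v D' \<and> (\<forall>i<n. i \<in> D' \<longleftrightarrow> i \<in> D)"
proof -
  obtain m where m: "\<And>v' D'. parse V v' D' \<Longrightarrow> m \<le> length v' \<Longrightarrow> D' \<subseteq> D"
    using long_parse_refines[OF \<R>D(2)[OF assms(1)] D] by metis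
  obtain u E where u: "parse V u E" "max m n \<le> length u" using long_parse_exists[OF \<R>D(1)[OF assms(1)]] .
  have sub: "E \<subseteq> D" using m[OF u(1)] u(2) by simp
  show thesis
  proof (rule that[OF parseD(1)[OF u(1)] parse_imp_built_from[OF u(1)]])
    show "n \<le> length u" using u(2) by simp
    fix V' assume V': "built_from V' u"
    then obtain E' where E': "parse V' u E'" using built_from_imp_parse[OF parseD(1)[OF u(1)]] by blast
    obtain D' where D': "parse V' v D'" using parse_refine[OF E' fparse_subparse[OF D u(1) sub]] by blast
    have "i \<in> D' \<longleftrightarrow> i \<in> D" if "i < n" for i
      using parse_deterministic[OF D' D parseD(3)[OF D'] parseD(3)[OF D], of n i] that
        parse_prefix[OF E'] parse_prefix[OF u(1)] u(2) by simp
    then show "\<exists>D'. parse V' v D' \<and> (\<forall>i<n. i \<in> D' \<longleftrightarrow> i \<in> D)" using D' by blast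
  qed
qed

text \<open>For \<open>n = 0\<close> and \<open>v \<in> \<F>\<close> this makes the generators of
  the topology clopen, which is the source of closedness and measurability of conditions on
  \<open>V\<close>.\<close>

lemma locally_constant_dset: "locally_constant (\<lambda>V. n \<in> dset V v)"
  unfolding locally_constant_def
proof
  fix V assume V: "V \<in> \<R>"
  show "\<exists>u\<in>\<F>. built_from V u \<and> (\<forall>V'\<in>\<R>. built_from V' u \<longrightarrow> (n \<in> dset V' v) = (n \<in> dset V v))"
  proof (cases "\<exists>D. parse V v D")
    case True
    then obtain D where D: "parse V v D" by blast
    obtain u where u: "u \<in> \<F>" "built_from V u"
      "\<And>V'. built_from V' u \<Longrightarrow> \<exists>D'. parse V' v D' \<and> (\<forall>i<Suc n. i \<in> D' \<longleftrightarrow> i \<in> D)"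
      using long_built_from_built_from[OF V D] by metis
    then have "n \<in> dset V' v \<longleftrightarrow> n \<in> dset V v" if "built_from V' u" for V'
      using u(3)[OF that] dset_eq[OF D] dset_eq by (metis lessI)
    then show ?thesis using u by blast
  next
    case False
    \<comment> \<open>If \<open>V\<close> is not built from \<open>v\<close>, some prefix of
      \<open>V\<close> already excludes it; otherwise the parses of approximating words would
      converge to a parse of \<open>V\<close>.\<close>
    obtain N where N: "\<And>V' D'. parse V' v D' \<Longrightarrow> \<exists>i<N. V' i \<noteq> V i"
    proof (cases "v \<in> \<F>")
      case True
      obtain w E where "parse V w E" using long_parse_exists[OF \<R>D(1)[OF V]] by metis
      then have "\<exists>n>m. \<not> V n" for m using parse_zeros_unbounded by metis
      then show thesis using parse_limit[OF True, of V] False that by blast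
    next
      case False
      then show thesis using that parseD(1) by metis
    qed
    obtain u where u: "u \<in> \<F>" "built_from V u" "\<And>V' i. built_from V' u \<Longrightarrow> i < N \<Longrightarrow> V' i = V i"
      using long_built_from[OF V] by metis
    have "dset V' v = {}" if "built_from V' u" for V'
      using u(3)[OF that] N by (auto simp: dset_def)
    then show ?thesis using u by blast
  qed
qed

section \<open>Cylinder sets and Borel measurability\<close>

lemma open_cylinder:
  fixes x :: "'i \<Rightarrow> bool"
  assumes "finite S"
  shows "open {y. \<forall>i\<in>S. y i = x i}"
proof -
  have "open ((\<lambda>y. y i) -` {x i})" for i
    by (intro open_vimage continuous_on_product_coordinates open_discrete)
  then have "open (\<Inter>i\<in>S. (\<lambda>y. y i) -` {x i})"
    using assms by (intro open_INT) auto
  moreover have "(\<Inter>i\<in>S. (\<lambda>y. y i) -` {x i}) = {y. \<forall>i\<in>S. y i = x i}" by auto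
  ultimately show ?thesis by simp
qed

lemma open_contains_cylinder:
  fixes x :: "'i \<Rightarrow> bool"
  assumes "open U" "x \<in> U"
  obtains S where "finite S" "\<And>y. (\<And>i. i \<in> S \<Longrightarrow> y i = x i) \<Longrightarrow> y \<in> U"
proof -
  have "openin (product_topology (\<lambda>i::'i. euclidean :: bool topology) UNIV) U"
    using assms(1) by (simp add: open_fun_def)
  from product_topology_open_contains_basis[OF this assms(2)] obtain X :: "'i \<Rightarrow> bool set"
    where X: "x \<in> Pi\<^sub>E UNIV X" "finite {i. X i \<noteq> UNIV}" "Pi\<^sub>E UNIV X \<subseteq> U" by auto
  have "y \<in> U" if "\<And>i. i \<in> {i. X i \<noteq> UNIV} \<Longrightarrow> y i = x i" for y
  proof -
    have "y i \<in> X i" for i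
      using that[of i] X(1) by (cases "X i = UNIV") auto
    then show ?thesis using X(3) by auto
  qed
  then show thesis using that X(2) by blast
qed

lemma borel_measurable_nat_bool:
  fixes f :: "'a \<Rightarrow> nat \<Rightarrow> bool"
  assumes [measurable]: "\<And>n. Measurable.pred M (\<lambda>x. f x n)"
  shows "f \<in> borel_measurable M"
proof (rule borel_measurableI)
  fix U :: "(nat \<Rightarrow> bool) set" assume U: "open U"
  define C :: "bool list \<Rightarrow> (nat \<Rightarrow> bool) set" where "C b = {y. \<forall>i<length b. y i = b ! i}" for b
  have "U \<subseteq> (\<Union>b\<in>{b. C b \<subseteq> U}. C b)"
  proof
    fix x assume "x \<in> U"
    then obtain S where S: "finite S" "\<And>y. (\<And>i. i \<in> S \<Longrightarrow> y i = x i) \<Longrightarrow> y \<in> U"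
      using open_contains_cylinder[OF U] by metis
    then obtain n where n: "S \<subseteq> {..<n}" by (metis finite_nat_iff_bounded)
    have "C (prefix n x) \<subseteq> U"
    proof
      fix y assume "y \<in> C (prefix n x)"
      then have "y i = x i" if "i < n" for i using that by (simp add: C_def)
      then show "y \<in> U" using S(2) n by blast
    qed
    moreover have "x \<in> C (prefix n x)" by (simp add: C_def)
    ultimately show "x \<in> (\<Union>b\<in>{b. C b \<subseteq> U}. C b)" by blast
  qed
  then have "U = (\<Union>b\<in>{b. C b \<subseteq> U}. C b)" by blast
  then have "f -` U \<inter> space M = (\<Union>b\<in>{b. C b \<subseteq> U}. f -` C b \<inter> space M)" by blast
  also have "\<dots> = (\<Union>b\<in>{b. C b \<subseteq> U}. {x \<in> space M. \<forall>i<length b. f x i = b ! i})"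
    by (rule SUP_cong) (auto simp: C_def)
  also have "\<dots> \<in> sets M" by measurable
  finally show "f -` U \<inter> space M \<in> sets M" .
qed

lemma borel_of_euclidean: "borel_of euclidean = borel"
  by (simp add: borel_of_def borel_def)

lemma space_borel_of: "space (borel_of X) = topspace X"
  by (simp add: borel_of_def space_measure_of_conv)

lemma openin_borel_of: "openin X U \<Longrightarrow> U \<in> sets (borel_of X)"
  unfolding borel_of_def by (subst sets_measure_of) (auto dest: openin_subset)

lemma pred_dset [measurable]: "Measurable.pred (borel_of \<R>_topology) (\<lambda>V. n \<in> dset V v)"
proof -
  have "{V \<in> space (borel_of \<R>_topology). n \<in> dset V v} = {V \<in> \<R>. n \<in> dset V v}"
    by (simp add: space_borel_of topspace_\<R>_topology)
  then have "{V \<in> space (borel_of \<R>_topology). n \<in> dset V v} \<in> sets (borel_of \<R>_topology)"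
    using openin_borel_of locally_constant_clopen(1)[OF locally_constant_dset] by metis
  then show ?thesis by (simp add: pred_def)
qed

text \<open>Traces are finite, so they are numbered by \<open>set_decode\<close>, and a family of
  traces becomes a point of Cantor space.\<close>

definition trace_code :: "bool word \<Rightarrow> nat \<Rightarrow> bool"
  where "trace_code V n \<longleftrightarrow> set_decode n \<in> ptraces V"

lemma nxt_eq_iff:
  assumes "infinite D"
  shows "nxt D 0 = k \<longleftrightarrow> k \<in> D \<and> 0 < k \<and> (\<forall>j<k. 0 < j \<longrightarrow> j \<notin> D)"
  using nxt[OF assms, of 0] nxt_le[of _ D 0] by (metis leD linorder_neqE_nat)

lemma trace_code_measurable: "trace_code \<in> borel_of \<R>_topology \<rightarrow>\<^sub>M borel_of euclidean"
proof -
  let ?M = "borel_of \<R>_topology"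
  \<comment> \<open>Quantifiers over parses range over an uncountable type. They are rewritten as
    quantifiers over words and numbers, which leaves countable combinations of the conditions
    \<open>n \<in> dset V v\<close>.\<close>
  have ret: "next_return V D = (LEAST k. \<exists>v'. 0 \<in> dset V v' \<and> (\<forall>n. n \<in> dset V v' \<longrightarrow> n \<in> D) \<and>
      (\<exists>n. n \<in> D \<and> n \<notin> dset V v') \<and> k \<in> dset V v' \<and> 0 < k \<and> (\<forall>j. j < k \<and> 0 < j \<longrightarrow> j \<notin> dset V v'))" for V D
  proof -
    have *: "dset V v' \<subset> D \<longleftrightarrow> (\<forall>n. n \<in> dset V v' \<longrightarrow> n \<in> D) \<and> (\<exists>n. n \<in> D \<and> n \<notin> dset V v')" for v'
      by (auto simp: psubset_eq)
    have **: "nxt (dset V v') 0 = k \<longleftrightarrow> k \<in> dset V v' \<and> 0 < k \<and> (\<forall>j. j < k \<and> 0 < j \<longrightarrow> j \<notin> dset V v')"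
      if "0 \<in> dset V v'" for v' k
    proof -
      have "dset V v' \<in> parses V" using that parses_eq_dset by auto
      then show ?thesis using nxt_eq_iff[OF parsesD(1)] by blast
    qed
    have "(\<exists>D'\<in>parses V. D' \<subset> D \<and> nxt D' 0 = k) \<longleftrightarrow>
      (\<exists>v'. 0 \<in> dset V v' \<and> dset V v' \<subset> D \<and> nxt (dset V v') 0 = k)" for k
      by (auto simp: parses_eq_dset)
    then show ?thesis
      unfolding next_return_def * using ** by (simp cong: conj_cong)
  qed
  have [measurable]: "(\<lambda>V. next_return V (dset V v)) \<in> ?M \<rightarrow>\<^sub>M count_space UNIV" for v
    unfolding ret by measurable
  have code: "trace_code V n \<longleftrightarrow> (\<exists>v. 0 \<in> dset V v \<and>
      (\<forall>d. d \<in> set_decode n \<longleftrightarrow> d \<in> dset V v \<and> d \<le> next_return V (dset V v)))" for V n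
    unfolding trace_code_def ptraces_def parses_eq_dset ptrace_def by blast
  have "Measurable.pred ?M (\<lambda>V. trace_code V n)" for n
    unfolding code by measurable
  then show ?thesis
    unfolding borel_of_euclidean by (rule borel_measurable_nat_bool)
qed

lemma E\<^sub>0_iff_finite: "E\<^sub>0 x y \<longleftrightarrow> finite {n. x n \<noteq> y n}"
proof -
  have "(\<forall>m>n. x m = y m) \<longleftrightarrow> {n. x n \<noteq> y n} \<subseteq> {..n}" for n
    unfolding subset_iff mem_Collect_eq atMost_iff by (meson leD leI)
  then show ?thesis
    unfolding E\<^sub>0_def finite_nat_iff_bounded_le by simp
qed

lemma E\<^sub>0_trace_code:
  assumes V: "V \<in> \<R>" and W: "W \<in> \<R>"
  shows "E\<^sub>0 (trace_code V) (trace_code W) \<longleftrightarrow> common_parse V W"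
proof -
  have fin: "A \<in> set_decode ` UNIV" if "A \<in> ptraces V \<or> A \<in> ptraces W" for A
  proof -
    have "finite A" using that finite_ptrace by (auto simp: ptraces_def)
    then show ?thesis by (metis rangeI set_encode_inverse)
  qed
  have "set_decode ` {n. trace_code V n \<noteq> trace_code W n} = (ptraces V - ptraces W) \<union> (ptraces W - ptraces V)"
    unfolding trace_code_def using fin by (auto simp: image_iff)
  moreover have "inj_on set_decode S" for S
    by (metis inj_on_inverseI set_decode_inverse)
  ultimately have *: "E\<^sub>0 (trace_code V) (trace_code W) \<longleftrightarrow>
      finite (ptraces V - ptraces W) \<and> finite (ptraces W - ptraces V)"
    unfolding E\<^sub>0_iff_finite by (metis (no_types, lifting) finite_Un finite_image_iff)
  show ?thesis
  proof
    assume "E\<^sub>0 (trace_code V) (trace_code W)"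
    then show "common_parse V W"
      using * common_parse_if_ptraces \<R>D V W by blast
  next
    assume "common_parse V W"
    then show "E\<^sub>0 (trace_code V) (trace_code W)"
      using * finite_ptraces_diff common_parse_sym \<R>D V W by blast
  qed
qed

lemma common_parse_reducible: "borel_reducible \<R>_topology common_parse (euclidean :: (nat \<Rightarrow> bool) topology) E\<^sub>0"
  unfolding borel_reducible_def topspace_\<R>_topology
  using trace_code_measurable E\<^sub>0_trace_code by blast

text \<open>There are countably many pairs \<open>(v, w)\<close>. For each of them the equality of
  the two parses is an intersection over \<open>n\<close> of closed conditions, each a union of two
  rectangles with clopen sides.\<close>

lemma common_parse_fsigma:
  "fsigma_in (prod_topology \<R>_topology \<R>_topology) {(V, W). V \<in> \<R> \<and> W \<in> \<R> \<and> common_parse V W}"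
proof -
  let ?T = "prod_topology \<R>_topology \<R>_topology"
  define C where "C v w = {(V, W). V \<in> \<R> \<and> W \<in> \<R> \<and> 0 \<in> dset V v \<and> 0 \<in> dset W w \<and> dset V v = dset W w}" for v w
  have cl: "closedin ?T ({V \<in> \<R>. n \<in> dset V v} \<times> {W \<in> \<R>. n \<in> dset W w} \<union> {V \<in> \<R>. n \<notin> dset V v} \<times> {W \<in> \<R>. n \<notin> dset W w})" for v w n
  proof -
    have "locally_constant (\<lambda>V. n \<notin> dset V v)" for v
      using locally_constant_dset[of n v] by (auto simp: locally_constant_def)
    then show ?thesis
      using locally_constant_clopen(2) locally_constant_dset
      by (intro closedin_Un) (simp_all add: closedin_prod_Times_iff)
  qed
  have cl0: "closedin ?T ({V \<in> \<R>. 0 \<in> dset V v} \<times> {W \<in> \<R>. 0 \<in> dset W w})" for v w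
    using locally_constant_clopen(2)[OF locally_constant_dset] by (simp add: closedin_prod_Times_iff)
  have "C v w = ({V \<in> \<R>. 0 \<in> dset V v} \<times> {W \<in> \<R>. 0 \<in> dset W w}) \<inter>
     (\<Inter>n. {V \<in> \<R>. n \<in> dset V v} \<times> {W \<in> \<R>. n \<in> dset W w} \<union> {V \<in> \<R>. n \<notin> dset V v} \<times> {W \<in> \<R>. n \<notin> dset W w})" for v w
    unfolding C_def by (auto simp: set_eq_iff)
  then have "closedin ?T (C v w)" for v w
    using cl cl0 by (auto intro!: closedin_Int closedin_INT)
  then have "fsigma_in ?T (\<Union>(v, w)\<in>UNIV. C v w)"
    by (intro fsigma_in_Union) (auto intro: closed_imp_fsigma_in)
  moreover have "{(V, W). V \<in> \<R> \<and> W \<in> \<R> \<and> common_parse V W} = (\<Union>(v, w)\<in>UNIV. C v w)"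
    unfolding common_parse_def parses_eq_dset C_def by auto
  ultimately show ?thesis by simp
qed

section \<open>Words coding binary sequences\<close>

text \<open>Both options use three copies and a single one, so they have the same length and the
  same two spacers. Copies with and without a one between them occur at each level, and only their
  order records \<open>x n\<close>.\<close>

fun block :: "(nat \<Rightarrow> bool) \<Rightarrow> nat \<Rightarrow> bool list"
  where
    "block x 0 = [False]"
  | "block x (Suc n) =
      (if x n then block x n @ [True] @ block x n @ block x n
       else block x n @ block x n @ [True] @ block x n)"

primrec block_length :: "nat \<Rightarrow> nat"
  where
    "block_length 0 = 1"
  | "block_length (Suc n) = 3 * block_length n + 1"

lemma length_block [simp]: "length (block x n) = block_length n"
  by (induction n) auto

lemma block_length_gt: "n < block_length n"
  by (induction n) auto

lemma block_length_mono: "m \<le> n \<Longrightarrow> block_length m \<le> block_length n"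
  by (rule lift_Suc_mono_le) auto

lemma block_nonempty [simp]: "block x n \<noteq> []"
  by (induction n) auto

lemma block_\<F>: "block x n \<in> \<F>"
proof -
  have "hd (block x n) = False \<and> last (block x n) = False"
    by (induction n) auto
  then show ?thesis by (simp add: \<F>_def)
qed

text \<open>Ones come singly; this bounds from below the length of any word whose copies stand at
  the positions of a level.\<close>

lemma block_no_adjacent_ones: "successively (\<lambda>a b. \<not> (a \<and> b)) (block x n)"
proof (induction n)
  case (Suc n)
  moreover have "hd (block x n) = False" "last (block x n) = False"
    using block_\<F>[of x n] by (auto simp: \<F>_def)
  ultimately show ?case by (auto simp: successively_append_iff successively_Cons)
qed simp

lemma block_cong: "(\<And>i. i < n \<Longrightarrow> x i = y i) \<Longrightarrow> block x n = block y n"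
  by (induction n) auto

lemma block_nth_Suc: "k < block_length n \<Longrightarrow> block x (Suc n) ! k = block x n ! k"
  by (simp add: nth_append)

lemma block_nth: "n \<le> m \<Longrightarrow> k < block_length n \<Longrightarrow> block x m ! k = block x n ! k"
proof (induction m rule: dec_induct)
  case (step m)
  have "k < block_length m" using block_length_mono[OF step.hyps(1)] step.prems by simp
  then show ?case using block_nth_Suc[of k m x] step by simp
qed simp

definition limit_word :: "(nat \<Rightarrow> bool) \<Rightarrow> bool word"
  where "limit_word x k = block x k ! k"

lemma limit_word_nth:
  assumes "k < block_length n"
  shows "limit_word x k = block x n ! k"
proof (cases "n \<le> k")
  case True
  then show ?thesis using block_nth[of n k k x] assms by (simp add: limit_word_def)
next
  case False
  then show ?thesis using block_nth[of k n k x] block_length_gt[of k] by (simp add: limit_word_def)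
qed

definition block_starts :: "(nat \<Rightarrow> bool) \<Rightarrow> nat \<Rightarrow> nat set"
  where "block_starts x n = {0, block_length n + (if x n then 1 else 0), 2 * block_length n + 1}"

lemma fparse_block: "fparse (block x (Suc n)) (block x n) (block_starts x n)"
proof -
  let ?L = "block_length n" and ?b = "block x n"
  have cover: "\<exists>q\<in>block_starts x n. q \<le> k \<and> k < q + ?L" if "k < 3 * ?L + 1" "\<not> block x (Suc n) ! k" for k
  proof (cases "x n")
    case True
    then have "k \<noteq> ?L" using that(2) by (auto simp: nth_append)
    then show ?thesis using that(1) True by (auto simp: block_starts_def)
  next
    case False
    then have "k \<noteq> 2 * ?L" using that(2) by (auto simp: nth_append)
    then show ?thesis using that(1) False by (auto simp: block_starts_def)
  qed
  have copy: "block x (Suc n) ! (q + i) = ?b ! i" if "q \<in> block_starts x n" "i < ?L" for q i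
  proof (cases "x n")
    case True
    have eq: "block x (Suc n) = (?b @ [True]) @ ?b @ ?b" using True by simp
    have "(?b @ [True] @ ?b @ ?b) ! i = ?b ! i" using that(2) by (simp add: nth_append)
    moreover have "((?b @ [True]) @ ?b @ ?b) ! (length (?b @ [True]) + i) = ?b ! i"
      by (subst nth_append_length_plus) (use that(2) in \<open>simp add: nth_append\<close>)
    moreover have "((?b @ [True] @ ?b) @ ?b) ! (length (?b @ [True] @ ?b) + i) = ?b ! i"
      by (subst nth_append_length_plus) simp
    ultimately show ?thesis using True that(1) by (auto simp: block_starts_def simp del: nth_append_length_plus) (simp_all add: mult_2 add.assoc)
  next
    case False
    have "(?b @ ?b @ [True] @ ?b) ! i = ?b ! i" using that(2) by (simp add: nth_append)
    moreover have "(?b @ ?b @ [True] @ ?b) ! (length ?b + i) = ?b ! i"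
      by (subst nth_append_length_plus) (use that(2) in \<open>simp add: nth_append\<close>)
    moreover have "((?b @ ?b @ [True]) @ ?b) ! (length (?b @ ?b @ [True]) + i) = ?b ! i"
      by (subst nth_append_length_plus) simp
    ultimately show ?thesis using False that(1) by (auto simp: block_starts_def simp del: nth_append_length_plus) (simp_all add: mult_2 add.assoc)
  qed
  show ?thesis
    unfolding fparse_def
    using cover copy block_\<F> by (auto simp: block_starts_def simp del: block.simps split: if_splits)
qed

lemma parse_block_lower:
  assumes "parse V (block x m) D" "n \<le> m"
  shows "\<exists>D. parse V (block x n) D"
  using assms(2)
proof (induction n rule: inc_induct)
  case base
  then show ?case using assms(1) by blast
next
  case (step n)
  then show ?case using parse_refine[OF _ fparse_block] by blast
qed

lemma parse_iter:
  assumes "v \<in> \<F>"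
  shows "parse (v\<^sup>\<omega>) v (range (\<lambda>k. k * length v))"
proof -
  have l: "0 < length v" using \<F>D[OF assms] by simp
  have "\<exists>k. k * length v \<le> n \<and> n < k * length v + length v" for n
    using dividend_less_div_times[OF l, of n] by (intro exI[of _ "n div length v"]) (simp add: add.commute)
  moreover have "inj (\<lambda>k. k * length v)" using l by (auto simp: inj_def)
  moreover have "j * length v + length v \<le> k * length v" if "j * length v < k * length v" for j k
  proof -
    have "Suc j * length v \<le> k * length v" using that by (intro mult_le_mono1) simp
    then show ?thesis by simp
  qed
  ultimately show ?thesis
    unfolding parse_def using assms l by (auto simp: range_inj_infinite image_iff)
qed

lemma limit_word_zeros: "\<exists>n>m. \<not> limit_word x n"
proof -
  have "block_length (Suc m) - 1 < block_length (Suc m)" using block_length_gt[of "Suc m"] by simp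
  then have "\<not> limit_word x (block_length (Suc m) - 1)"
    using limit_word_nth[of _ "Suc m" x] \<F>D(3)[OF block_\<F>, of x "Suc m"]
    by (simp del: block.simps)
  moreover have "m < block_length (Suc m) - 1" using block_length_gt[of m] by simp
  ultimately show ?thesis by blast
qed

text \<open>The periodic repetitions of the blocks are built from all lower blocks and converge to
  the limit word, so \<open>parse_limit\<close> applies.\<close>

lemma parse_limit_word_exists: "\<exists>D. parse (limit_word x) (block x n) D"
proof (rule parse_limit[OF block_\<F> limit_word_zeros])
  fix N
  define m where "m = max n N"
  have "\<exists>D. parse ((block x m)\<^sup>\<omega>) (block x n) D"
    by (rule parse_block_lower[OF parse_iter[OF block_\<F>]]) (simp add: m_def)
  moreover have "(block x m)\<^sup>\<omega> i = limit_word x i" if "i < N" for i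
  proof -
    have "i < block_length m" using that block_length_gt[of m] by (simp add: m_def)
    then show ?thesis using limit_word_nth[of i m x] by simp
  qed
  ultimately show "\<exists>V' D'. parse V' (block x n) D' \<and> (\<forall>i<N. V' i = limit_word x i)" by blast
qed

definition level :: "(nat \<Rightarrow> bool) \<Rightarrow> nat \<Rightarrow> nat set"
  where "level x n = dset (limit_word x) (block x n)"

lemma parse_level: "parse (limit_word x) (block x n) (level x n)"
  using parse_limit_word_exists dset_eq unfolding level_def by metis

lemma level_Suc: "level x n = {d + i | d i. d \<in> level x (Suc n) \<and> i \<in> block_starts x n}"
  using parse_unique[OF parse_level parse_refine[OF parse_level fparse_block]] .

lemma level_ge: "d \<in> level x n \<Longrightarrow> 0 < d \<Longrightarrow> block_length n \<le> d"
  using parseD(5)[OF parse_level parseD(3)[OF parse_level], of d x n] by simp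

lemma nxt_level:
  "nxt (level x n) 0 = block_length n + (if x n then 1 else 0)"
  "nxt (level x n) (block_length n + (if x n then 1 else 0)) = 2 * block_length n + 1"
proof -
  have mem: "i \<in> level x n" if "i \<in> block_starts x n" for i
    using parseD(3)[OF parse_level, of x "Suc n"] that level_Suc[of x n] by force
  have low: "d \<in> block_starts x n \<or> 3 * block_length n + 1 \<le> d" if d: "d \<in> level x n" for d
  proof -
    obtain e i where e: "d = e + i" "e \<in> level x (Suc n)" "i \<in> block_starts x n"
      using d level_Suc[of x n] by blast
    then show ?thesis using level_ge[OF e(2)] by (cases "e = 0") auto
  qed
  have pos: "0 < block_length n" using block_length_gt[of n] by simp
  show "nxt (level x n) 0 = block_length n + (if x n then 1 else 0)"
    using low pos by (intro nxt_eqI mem) (force simp: block_starts_def)+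
  show "nxt (level x n) (block_length n + (if x n then 1 else 0)) = 2 * block_length n + 1"
    using low pos by (intro nxt_eqI mem) (force simp: block_starts_def)+
qed

text \<open>A period \<open>p\<close> would make position \<open>p\<close> an occurrence of a prefix
  with two different gaps of level \<open>p\<close>, hence a member of level \<open>p\<close>. But
  the positive members of that level are at least \<open>block_length p\<close>, which exceeds
  \<open>p\<close>.\<close>

lemma limit_word_nondegenerate: "\<not> degenerate (limit_word x)"
proof
  assume "degenerate (limit_word x)"
  then obtain u where u: "u \<noteq> []" "limit_word x = u\<^sup>\<omega>" unfolding degenerate_def by blast
  define p where "p = length u"
  have per: "limit_word x (p + i) = limit_word x (0 + i)" for i
    using u by (simp add: p_def)
  let ?s = "block_length p + (if x p then 1 else 0)"
  have s: "?s \<in> level x p" using nxt_mem[OF parseD(2)[OF parse_level], of x p 0] by (simp add: nxt_level)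
  have "p \<in> level x p"
    by (rule parse_recognition[OF parse_level parseD(3)[OF parse_level] parseD(3)[OF parse_level] le0 _ s le0 order.refl _ per])
      (auto simp: nxt_level)
  then show False using level_ge[of p x p] block_length_gt[of p] u(1) by (simp add: p_def)
qed

lemma limit_word_\<R>: "limit_word x \<in> \<R>"
proof -
  have "inj (block x)"
  proof (rule injI)
    fix m n assume "block x m = block x n"
    then have "block_length m = block_length n" by (metis length_block)
    moreover have "strict_mono block_length" by (simp add: strict_mono_Suc_iff)
    ultimately show "m = n" by (simp add: strict_mono_eq)
  qed
  then have "infinite (range (block x))" by (rule range_inj_infinite)
  moreover have "range (block x) \<subseteq> {v \<in> \<F>. built_from (limit_word x) v}"
    using block_\<F> parse_imp_built_from[OF parse_level] by auto
  ultimately have "rank1 (limit_word x)" unfolding rank1_def using finite_subset by blast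
  then show ?thesis using limit_word_nondegenerate by (simp add: \<R>_def)
qed

lemma limit_word_no_adjacent_ones: "\<not> (limit_word x i \<and> limit_word x (Suc i))"
proof -
  have len: "Suc i < block_length (Suc i)" by (rule block_length_gt)
  then have "\<not> (block x (Suc i) ! i \<and> block x (Suc i) ! Suc i)"
    using block_no_adjacent_ones[of x "Suc i"] unfolding successively_conv_nth
    by (metis length_block)
  then show ?thesis using limit_word_nth[of i "Suc i" x] limit_word_nth[of "Suc i" "Suc i" x] len by simp
qed

text \<open>Level \<open>n\<close> has gaps of size \<open>L\<close> and \<open>L + 1\<close> for
  the block length \<open>L\<close>. The smaller one bounds the length of \<open>w\<close> by
  \<open>L\<close>, and a shorter \<open>w\<close> would leave two adjacent ones in the larger one.
  So \<open>w\<close> is the block of \<open>y\<close>, and the first return shows the choice made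
  at \<open>n\<close>.\<close>

lemma level_parse_other:
  assumes w: "parse (limit_word y) w (level x n)"
  shows "x n = y n"
proof -
  let ?L = "block_length n" and ?D = "level x n"
  define s where "s = ?L + (if x n then 1 else 0)"
  have s: "s \<in> ?D" "nxt ?D 0 = s" "nxt ?D s = 2 * ?L + 1"
    using nxt_mem[OF parseD(2)[OF parse_level], of x n 0] by (simp_all add: nxt_level s_def)
  obtain d where d: "d \<in> ?D" "nxt ?D d = d + ?L + 1"
  proof (cases "x n")
    case True then show thesis using that[of 0] s parseD(3)[OF w] by (simp add: s_def)
  next
    case False then show thesis using that[of s] s by (simp add: s_def)
  qed
  obtain e where e: "e \<in> ?D" "nxt ?D e = e + ?L"
  proof (cases "x n")
    case True then show thesis using that[of s] s by (simp add: s_def)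
  next
    case False then show thesis using that[of 0] s parseD(3)[OF w] by (simp add: s_def)
  qed
  have le: "length w \<le> ?L" using parse_nxt[OF w e(1)] e by simp
  have "\<not> length w < ?L"
  proof
    assume l: "length w < ?L"
    have "limit_word y (d + length w)" "limit_word y (d + length w + 1)"
      using l d by (auto intro!: parse_ones[OF w d(1)])
    then show False using limit_word_no_adjacent_ones by simp
  qed
  then have len: "length w = ?L" using le by simp
  have "w = block y n"
    using parse_prefix[OF w] parse_prefix[OF parse_level, of _ y n] len by (auto intro!: nth_equalityI)
  then have "level y n = level x n" using w parse_level parse_unique by blast
  then show ?thesis using nxt_level(1)[of x n] nxt_level(1)[of y n] by (auto split: if_splits)
qed

lemma level_inj: "inj (level x)"
proof (rule injI)
  have "nxt (level x n) 0 < nxt (level x (Suc n)) 0" for n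
    using block_length_gt[of n] by (simp add: nxt_level)
  then have "strict_mono (\<lambda>n. nxt (level x n) 0)" by (simp add: strict_mono_Suc_iff)
  then show "m = n" if "level x m = level x n" for m n
    using that strict_mono_eq by metis
qed

text \<open>Levels beyond the last disagreement coincide, although the blocks themselves differ.
  Conversely, all but finitely many levels of \<open>x\<close> are parses of the word of
  \<open>y\<close>, and each of these reveals one value of \<open>y\<close>.\<close>

lemma E\<^sub>0_iff_limit_word: "E\<^sub>0 x y \<longleftrightarrow> common_parse (limit_word x) (limit_word y)"
proof
  assume "E\<^sub>0 x y"
  then obtain n where n: "\<And>m. n < m \<Longrightarrow> x m = y m" unfolding E\<^sub>0_def by blast
  \<comment> \<open>Downward induction from level \<open>m\<close>, which has the single member
    \<open>0\<close> below \<open>block_length m\<close>.\<close>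
  have agree: "j \<in> level x k \<longleftrightarrow> j \<in> level y k"
    if "k \<le> m" "n < k" "j < block_length m" for j k m
    using that
  proof (induction k arbitrary: j rule: inc_induct)
    case base
    then have "j \<in> level z m \<longleftrightarrow> j = 0" for z
      using level_ge[of j z m] parseD(3)[OF parse_level, of z m] by auto
    then show ?case by simp
  next
    case (step k)
    have Q: "block_starts x k = block_starts y k" using n[OF step.prems(1)] by (simp add: block_starts_def)
    have IH: "d \<in> level x (Suc k) \<longleftrightarrow> d \<in> level y (Suc k)" if "d \<le> j" for d
      using step.IH[of d] step.prems that by simp
    have mem: "j \<in> level z k \<longleftrightarrow> (\<exists>d i. j = d + i \<and> d \<in> level z (Suc k) \<and> i \<in> block_starts z k)" for z
      by (subst level_Suc) simp
    show ?case unfolding mem Q using IH by (metis le_add1)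
  qed
  have "j \<in> level x (Suc n) \<longleftrightarrow> j \<in> level y (Suc n)" for j
    using agree[of "Suc n" "max (Suc n) j" j] block_length_gt[of "max (Suc n) j"] by simp
  then have "level x (Suc n) = level y (Suc n)" by blast
  then show "common_parse (limit_word x) (limit_word y)"
    unfolding common_parse_def using parsesI[OF parse_level[of x "Suc n"]] parsesI[OF parse_level[of y "Suc n"]] by auto
next
  assume "common_parse (limit_word x) (limit_word y)"
  then have "finite (parses (limit_word x) - parses (limit_word y))"
    using finite_parses_diff[OF limit_word_nondegenerate] by blast
  then have "finite (level x -` (parses (limit_word x) - parses (limit_word y)))"
    by (rule finite_vimageI[OF _ level_inj])
  moreover have "n \<in> level x -` (parses (limit_word x) - parses (limit_word y))" if "x n \<noteq> y n" for n
    using that level_parse_other[of y _ x n] parsesI[OF parse_level[of x n]] by (auto simp: parses_def)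
  ultimately show "E\<^sub>0 x y"
    unfolding E\<^sub>0_iff_finite by (auto elim: finite_subset[rotated])
qed

text \<open>Being built from \<open>v\<close> is witnessed inside a block of sufficiently high level
  \<open>m\<close>, which depends on the first \<open>m\<close> values of \<open>x\<close>
  only.\<close>

lemma limit_word_continuous: "continuous_map euclidean \<R>_topology limit_word"
  unfolding \<R>_topology_def
proof (rule continuous_on_generated_topo)
  show "limit_word ` topspace euclidean \<subseteq> \<Union> {{V \<in> \<R>. built_from V v} | v. v \<in> \<F>}"
    using limit_word_\<R> block_\<F> parse_imp_built_from[OF parse_level] by blast
  fix U assume "U \<in> {{V \<in> \<R>. built_from V v} | v. v \<in> \<F>}"
  then obtain v where v: "v \<in> \<F>" "U = {V \<in> \<R>. built_from V v}" by blast
  have "open {x. built_from (limit_word x) v}"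
  proof (subst open_subopen, intro ballI)
    fix x assume "x \<in> {x. built_from (limit_word x) v}"
    then obtain D where D: "parse (limit_word x) v D" using built_from_imp_parse[OF v(1)] by blast
    obtain m where m: "\<And>v' D'. parse (limit_word x) v' D' \<Longrightarrow> m \<le> length v' \<Longrightarrow> D' \<subseteq> D"
      using long_parse_refines[OF limit_word_nondegenerate D] by metis
    have sub: "level x m \<subseteq> D" using m[OF parse_level] block_length_gt[of m] by simp
    have "built_from (limit_word y) v" if "\<forall>i\<in>{..<m}. y i = x i" for y
    proof -
      have "block y m = block x m" using that by (intro block_cong) simp
      then have "parse (limit_word y) (block x m) (level y m)" using parse_level[of y m] by simp
      then show ?thesis
        using parse_refine[OF _ fparse_subparse[OF D parse_level sub]] parse_imp_built_from by blast
    qed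
    then show "\<exists>T. open T \<and> x \<in> T \<and> T \<subseteq> {x. built_from (limit_word x) v}"
      using open_cylinder[of "{..<m}" x] by (intro exI[of _ "{y. \<forall>i\<in>{..<m}. y i = x i}"]) auto
  qed
  then show "openin euclidean (limit_word -` U \<inter> topspace euclidean)"
    using limit_word_\<R> by (simp add: v(2) vimage_def)
qed

lemma limit_word_measurable: "limit_word \<in> borel_of euclidean \<rightarrow>\<^sub>M borel_of \<R>_topology"
  unfolding borel_of_euclidean
  unfolding borel_of_def
proof (rule measurable_measure_of)
  show "limit_word -` U \<inter> space borel \<in> sets borel" if "U \<in> {U. openin \<R>_topology U}" for U
    using openin_continuous_map_preimage[OF limit_word_continuous, of U] that by (simp add: vimage_def)
qed (use openin_subset[of \<R>_topology] limit_word_\<R> in \<open>auto simp: topspace_\<R>_topology\<close>)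

lemma E\<^sub>0_reducible: "borel_reducible (euclidean :: (nat \<Rightarrow> bool) topology) E\<^sub>0 \<R>_topology common_parse"
  unfolding borel_reducible_def using limit_word_measurable E\<^sub>0_iff_limit_word by blast

section \<open>Substitution maps\<close>

lemma abs_le_atLeastAtMost: "(\<forall>i. \<bar>i\<bar> \<le> int R \<longrightarrow> P i) \<longleftrightarrow> (\<forall>i\<in>{- int R..int R}. P i)"
  by (auto simp: abs_le_iff)

lemma open_centered_cylinder: "open {y. \<forall>i. \<bar>i\<bar> \<le> int R \<longrightarrow> y i = (x :: int \<Rightarrow> bool) i}"
  unfolding abs_le_atLeastAtMost by (rule open_cylinder) simp

lemma open_contains_centered_cylinder:
  fixes x :: "int \<Rightarrow> bool"
  assumes "open U" "x \<in> U"
  obtains R where "\<And>y. (\<And>i. \<bar>i\<bar> \<le> int R \<Longrightarrow> y i = x i) \<Longrightarrow> y \<in> U"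
proof -
  obtain S where S: "finite S" "\<And>y. (\<And>i. i \<in> S \<Longrightarrow> y i = x i) \<Longrightarrow> y \<in> U"
    using open_contains_cylinder[OF assms] by metis
  obtain R where "\<forall>m\<in>(\<lambda>i. nat \<bar>i\<bar>) ` S. m \<le> R"
    using finite_imageI[OF S(1), of "\<lambda>i. nat \<bar>i\<bar>"] unfolding finite_nat_set_iff_bounded_le by blast
  then have "\<bar>i\<bar> \<le> int R" if "i \<in> S" for i using that by fastforce
  then show thesis using that[of R] S(2) by blast
qed

lemma compact_UNIV_int_bool: "compact (UNIV :: (int \<Rightarrow> bool) set)"
proof -
  have "compact (UNIV :: bool set)" by (rule finite_imp_compact) simp
  then have "compact_space (euclidean :: bool topology)" by (simp add: compact_space_def)
  then have "compact_space (product_topology (\<lambda>i::int. euclidean :: bool topology) UNIV)"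
    by (simp add: compact_space_product_topology)
  then show ?thesis by (simp add: euclidean_product_topology compact_space_def)
qed

lemma cluster_point:
  fixes g :: "nat \<Rightarrow> int \<Rightarrow> bool"
  obtains h where "\<And>R N. \<exists>n\<ge>N. \<forall>i. \<bar>i\<bar> \<le> int R \<longrightarrow> g n i = h i"
proof (rule ccontr)
  assume no: "\<not> thesis"
  note witness = that
  define \<U> where "\<U> = {U. open U \<and> (\<forall>\<^sub>F n in sequentially. g n \<notin> U)}"
  have "h \<in> \<Union>\<U>" for h
  proof -
    obtain R N where "\<not> (\<exists>n\<ge>N. \<forall>i. \<bar>i\<bar> \<le> int R \<longrightarrow> g n i = h i)"
      using no witness[of h] by blast
    then have "{y. \<forall>i. \<bar>i\<bar> \<le> int R \<longrightarrow> y i = h i} \<in> \<U>"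
      using open_centered_cylinder[of R h] by (auto simp: \<U>_def eventually_sequentially)
    then show ?thesis by (rule UnionI) simp
  qed
  then have cover: "UNIV \<subseteq> \<Union>\<U>" by blast
  have "open U" if "U \<in> \<U>" for U using that by (simp add: \<U>_def)
  then obtain C where C: "C \<subseteq> \<U>" "finite C" "UNIV \<subseteq> \<Union>C"
    by (rule compactE[OF compact_UNIV_int_bool cover])
  have "\<forall>\<^sub>F n in sequentially. \<forall>U\<in>C. g n \<notin> U"
    by (rule eventually_ball_finite[OF C(2)]) (use C(1) in \<open>auto simp: \<U>_def\<close>)
  then obtain n where "\<forall>U\<in>C. g n \<notin> U" unfolding eventually_sequentially by blast
  then show False using C(3) by blast
qed

lemma rank1_system_window:
  "x \<in> rank1_system V \<longleftrightarrow> (\<forall>i n. \<exists>j. \<forall>k<n. x (i + int k) = V (j + k))"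
proof -
  have "map (\<lambda>k. x (i + int k)) [0..<n] = V [j \<rightarrow> j + n] \<longleftrightarrow> (\<forall>k<n. x (i + int k) = V (j + k))" for i n j
    by (simp add: list_eq_iff_nth_eq)
  then show ?thesis by (simp add: rank1_system_def)
qed

text \<open>Windows around the origin suffice. The bound \<open>R \<le> j\<close> keeps
  \<open>int j + i\<close> nonnegative, so that \<open>nat\<close> does not truncate.\<close>

lemma rank1_system_centered:
  "x \<in> rank1_system V \<longleftrightarrow> (\<forall>R. \<exists>j\<ge>R. \<forall>i. \<bar>i\<bar> \<le> int R \<longrightarrow> x i = V (nat (int j + i)))"
proof (intro iffI allI)
  fix R assume "x \<in> rank1_system V"
  then obtain j where j: "\<And>k. k < 2 * R + 1 \<Longrightarrow> x (- int R + int k) = V (j + k)"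
    unfolding rank1_system_window by blast
  have "x i = V (nat (int (j + R) + i))" if "\<bar>i\<bar> \<le> int R" for i
  proof -
    have "- int R + int (nat (int R + i)) = i" "j + nat (int R + i) = nat (int (j + R) + i)"
      using that by auto
    moreover have "nat (int R + i) < 2 * R + 1" using that by auto
    ultimately show ?thesis using j[of "nat (int R + i)"] by simp
  qed
  then show "\<exists>j\<ge>R. \<forall>i. \<bar>i\<bar> \<le> int R \<longrightarrow> x i = V (nat (int j + i))"
    by (intro exI[of _ "j + R"]) simp
next
  assume a: "\<forall>R. \<exists>j\<ge>R. \<forall>i. \<bar>i\<bar> \<le> int R \<longrightarrow> x i = V (nat (int j + i))"
  show "x \<in> rank1_system V"
    unfolding rank1_system_window
  proof (intro allI)
    fix i :: int and n :: nat
    obtain j where j: "nat \<bar>i\<bar> + n \<le> j" "\<And>k. \<bar>k\<bar> \<le> int (nat \<bar>i\<bar> + n) \<Longrightarrow> x k = V (nat (int j + k))"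
      using a by metis
    have "x (i + int k) = V (nat (int j + i) + k)" if "k < n" for k
    proof -
      have "nat (int j + (i + int k)) = nat (int j + i) + k" using j(1) by linarith
      then show ?thesis using j(2)[of "i + int k"] that by simp
    qed
    then show "\<exists>j. \<forall>k<n. x (i + int k) = V (j + k)" by blast
  qed
qed

lemma rank1_system_limit:
  assumes "\<And>n. \<exists>j\<ge>n. \<forall>i. \<bar>i\<bar> \<le> int n \<longrightarrow> g n i = V (nat (int j + i))"
  obtains x where "x \<in> rank1_system V" "\<And>R N. \<exists>n\<ge>N. \<forall>i. \<bar>i\<bar> \<le> int R \<longrightarrow> g n i = x i"
proof -
  obtain x where x: "\<And>R N. \<exists>n\<ge>N. \<forall>i. \<bar>i\<bar> \<le> int R \<longrightarrow> g n i = x i"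
    using cluster_point by blast
  have "\<exists>j\<ge>R. \<forall>i. \<bar>i\<bar> \<le> int R \<longrightarrow> x i = V (nat (int j + i))" for R
  proof -
    obtain n where n: "R \<le> n" "\<And>i. \<bar>i\<bar> \<le> int R \<Longrightarrow> g n i = x i" using x by metis
    obtain j where j: "n \<le> j" "\<And>i. \<bar>i\<bar> \<le> int n \<Longrightarrow> g n i = V (nat (int j + i))" using assms by metis
    have "x i = V (nat (int j + i))" if "\<bar>i\<bar> \<le> int R" for i
      using n(2)[OF that] j(2)[of i] that n(1) by simp
    then show ?thesis using n(1) j(1) by (intro exI[of _ j]) simp
  qed
  then have "x \<in> rank1_system V" by (simp add: rank1_system_centered)
  then show thesis using that x by blast
qed

lemma closed_rank1_system: "closed (rank1_system V)"
  unfolding closed_def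
proof (subst open_subopen, intro ballI)
  fix x assume "x \<in> - rank1_system V"
  then obtain R where R: "\<And>j. R \<le> j \<Longrightarrow> \<exists>i. \<bar>i\<bar> \<le> int R \<and> x i \<noteq> V (nat (int j + i))"
    by (auto simp: rank1_system_centered)
  have "y \<in> - rank1_system V" if "\<And>i. \<bar>i\<bar> \<le> int R \<Longrightarrow> y i = x i" for y
  proof
    assume "y \<in> rank1_system V"
    then obtain j where "R \<le> j" "\<And>i. \<bar>i\<bar> \<le> int R \<Longrightarrow> y i = V (nat (int j + i))"
      unfolding rank1_system_centered by metis
    then show False using R[of j] that by metis
  qed
  then show "\<exists>T. open T \<and> x \<in> T \<and> T \<subseteq> - rank1_system V"
    using open_centered_cylinder[of R x]
    by (intro exI[of _ "{y. \<forall>i. \<bar>i\<bar> \<le> int R \<longrightarrow> y i = x i}"]) auto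
qed

lemma compact_rank1_system: "compact (rank1_system V)"
  using closed_Int_compact[OF closed_rank1_system compact_UNIV_int_bool] by simp

definition shift_by :: "int \<Rightarrow> (int \<Rightarrow> bool) \<Rightarrow> (int \<Rightarrow> bool)"
  where "shift_by k x = (\<lambda>i. x (i + k))"

lemma shift_eq_shift_by: "shift = shift_by 1"
  by (auto simp: shift_def shift_by_def)

lemma shift_by_mem: "x \<in> rank1_system V \<Longrightarrow> shift_by k x \<in> rank1_system V"
  unfolding rank1_system_window shift_by_def by (metis (no_types, opaque_lifting) add.assoc add.commute)

lemma shift_mem: "x \<in> rank1_system V \<Longrightarrow> shift x \<in> rank1_system V"
  by (simp add: shift_eq_shift_by shift_by_mem)

lemma isomorphic_sym:
  assumes "isomorphic V W"
  shows "isomorphic W V"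
proof -
  obtain f where f: "homeomorphic_map (top_of_set (rank1_system V)) (top_of_set (rank1_system W)) f"
    and com: "\<And>x. x \<in> rank1_system V \<Longrightarrow> f (shift x) = shift (f x)"
    using assms unfolding isomorphic_def by blast
  then obtain g where g: "homeomorphic_maps (top_of_set (rank1_system V)) (top_of_set (rank1_system W)) f g"
    using homeomorphic_map_maps by blast
  have "g (shift y) = shift (g y)" if "y \<in> rank1_system W" for y
  proof -
    have "g y \<in> rank1_system V" "f (g y) = y"
      using g that by (auto simp: homeomorphic_maps_def continuous_map_def Pi_iff)
    then have "shift y = f (shift (g y))" using com by simp
    moreover have "g (f (shift (g y))) = shift (g y)"
      using g shift_mem[OF \<open>g y \<in> rank1_system V\<close>] by (simp add: homeomorphic_maps_def)
    ultimately show ?thesis by simp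
  qed
  then show ?thesis
    unfolding isomorphic_def using g homeomorphic_maps_map by metis
qed

lemma isomorphic_trans:
  assumes "isomorphic U V" "isomorphic V W"
  shows "isomorphic U W"
proof -
  obtain f where f: "homeomorphic_map (top_of_set (rank1_system U)) (top_of_set (rank1_system V)) f"
    and fc: "\<And>x. x \<in> rank1_system U \<Longrightarrow> f (shift x) = shift (f x)"
    using assms unfolding isomorphic_def by blast
  obtain g where g: "homeomorphic_map (top_of_set (rank1_system V)) (top_of_set (rank1_system W)) g"
    and gc: "\<And>x. x \<in> rank1_system V \<Longrightarrow> g (shift x) = shift (g x)"
    using assms unfolding isomorphic_def by blast
  have "f x \<in> rank1_system V" if "x \<in> rank1_system U" for x
    using homeomorphic_imp_surjective_map[OF f] that by auto
  then have "(g \<circ> f) (shift x) = shift ((g \<circ> f) x)" if "x \<in> rank1_system U" for x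
    using that fc gc by simp
  then show ?thesis
    unfolding isomorphic_def using homeomorphic_map_compose[OF f g] by blast
qed

text \<open>Membership in \<open>D\<close> is decided by a window of radius \<open>R\<close>, the
  length of a word \<open>v'\<close> whose copies begin with two different gaps of \<open>D\<close>.
  The copy of \<open>v'\<close> around the position starts inside the window, its start is
  recognized there, and reading on from it decides the position.\<close>

lemma parse_recognition_radius:
  assumes "V \<in> \<R>" and D: "parse V v D"
  obtains R where "\<And>a b. a + R \<in> D \<Longrightarrow> (\<And>i. i \<le> 2 * R \<Longrightarrow> V (a + i) = V (b + i)) \<Longrightarrow> b + R \<in> D"
proof -
  obtain d where d: "d \<in> D" "nxt D d - d \<noteq> nxt D 0" using parse_gaps_differ[OF \<R>D(2)[OF assms(1)] D] .
  define r where "r = max (nxt D d) (nxt D 0)"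
  obtain v' D' where D': "parse V v' D'" "Suc r \<le> length v'" using long_parse_exists[OF \<R>D(1)[OF assms(1)]] .
  define R where "R = length v'"
  have "b + R \<in> D" if a: "a + R \<in> D" and agree: "\<And>i. i \<le> 2 * R \<Longrightarrow> V (a + i) = V (b + i)" for a b
  proof -
    obtain e where e: "e \<in> D'" "e \<le> a + R" "a + R < e + length v'"
      using parseD(6)[OF D'(1) parse_first[OF D a]] by blast
    define c where "c = e - a"
    have c: "e = a + c" "c \<le> R" using e by (auto simp: c_def R_def)
    have occ: "q \<in> D" if "\<And>i. i \<le> r \<Longrightarrow> V (q + i) = V (0 + i)" for q
      by (rule parse_recognition[OF D parseD(3)[OF D] d(1) le0 _ parseD(3)[OF D] le0 _ _ that])
        (use d in \<open>auto simp: r_def\<close>)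
    have copy: "V (a + c + i) = V (0 + i)" if "i < length v'" for i
      using parseD(4)[OF D'(1) e(1) that] parse_prefix[OF D'(1) that] c by simp
    have eD: "a + c \<in> D" by (rule occ) (use copy D'(2) in simp)
    have qD: "b + c \<in> D"
    proof (rule occ)
      fix i assume "i \<le> r"
      then show "V (b + c + i) = V (0 + i)"
        using copy[of i] agree[of "c + i"] c D'(2) by (simp add: R_def add.assoc)
    qed
    have "V (a + c + i) = V (b + c + i)" if "i < Suc (R - c)" for i
      using agree[of "c + i"] that c by (simp add: add.assoc)
    then have "a + c + (R - c) \<in> D \<longleftrightarrow> b + c + (R - c) \<in> D"
      by (rule parse_deterministic[OF D D eD qD]) auto
    then show ?thesis using a c by simp
  qed
  then show thesis using that by blast
qed

text \<open>The copies of \<open>v\<close> at the members of \<open>E\<close> are legible only if they do not overlap.\<close>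

definition substitute :: "bool list \<Rightarrow> (int \<Rightarrow> bool) \<Rightarrow> (int \<Rightarrow> bool)"
  where "substitute v E = (\<lambda>i. \<not> (\<exists>k<length v. \<not> v ! k \<and> E (i - int k)))"

lemma substitute_parse:
  assumes D: "parse V v D" and "length v \<le> n"
    and E: "\<And>k. k < length v \<Longrightarrow> E (i - int k) \<longleftrightarrow> n - k \<in> D"
  shows "substitute v E i = V n"
proof -
  have "V n \<longleftrightarrow> \<not> (\<exists>k<length v. \<not> v ! k \<and> n - k \<in> D)"
  proof
    assume "V n"
    show "\<not> (\<exists>k<length v. \<not> v ! k \<and> n - k \<in> D)"
    proof
      assume "\<exists>k<length v. \<not> v ! k \<and> n - k \<in> D"
      then obtain k where k: "k < length v" "\<not> v ! k" "n - k \<in> D" by blast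
      then show False using parseD(4)[OF D k(3,1)] \<open>V n\<close> assms(2) by simp
    qed
  next
    assume a: "\<not> (\<exists>k<length v. \<not> v ! k \<and> n - k \<in> D)"
    show "V n"
    proof (rule ccontr)
      assume "\<not> V n"
      then obtain d where d: "d \<in> D" "d \<le> n" "n < d + length v" using parseD(6)[OF D] by blast
      then have "\<not> v ! (n - d)" using parseD(4)[OF D d(1), of "n - d"] \<open>\<not> V n\<close> by simp
      moreover have "n - d < length v" "n - (n - d) \<in> D" using d by auto
      ultimately show False using a by blast
    qed
  qed
  then show ?thesis using E unfolding substitute_def by blast
qed

lemma continuous_on_substitute: "continuous_on S (substitute v)"
proof (rule continuous_on_subset[OF _ subset_UNIV], rule continuous_on_coordinatewise_then_product)
  fix i
  show "continuous_on UNIV (\<lambda>E. substitute v E i)"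
    unfolding continuous_on_open_vimage[OF open_UNIV] Int_UNIV_right
  proof (intro allI impI)
    fix B :: "bool set"
    show "open ((\<lambda>E. substitute v E i) -` B)"
    proof (subst open_subopen, intro ballI)
      fix E assume E: "E \<in> (\<lambda>E. substitute v E i) -` B"
      let ?S = "(\<lambda>k. i - int k) ` {..<length v}"
      have same: "substitute v F i = substitute v E i" if "\<forall>j\<in>?S. F j = E j" for F
      proof -
        have "F (i - int k) = E (i - int k)" if "k < length v" for k
          using \<open>\<forall>j\<in>?S. F j = E j\<close> that by blast
        then show ?thesis by (simp add: substitute_def cong: conj_cong)
      qed
      have "{F. \<forall>j\<in>?S. F j = E j} \<subseteq> (\<lambda>E. substitute v E i) -` B"
      proof
        fix F assume "F \<in> {F. \<forall>j\<in>?S. F j = E j}"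
        then have "\<forall>j\<in>?S. F j = E j" by (rule CollectD)
        from same[OF this] show "F \<in> (\<lambda>E. substitute v E i) -` B" using E by (simp only: vimage_eq)
      qed
      moreover have "open {F. \<forall>j\<in>?S. F j = E j}" by (rule open_cylinder) simp
      ultimately show "\<exists>T. open T \<and> E \<in> T \<and> T \<subseteq> (\<lambda>E. substitute v E i) -` B"
        by (intro exI[of _ "{F. \<forall>j\<in>?S. F j = E j}"]) simp
    qed
  qed
qed

text \<open>The indicator word of \<open>D\<close> generates a system that depends on positions
  only, and writing \<open>v\<close> at each position is a conjugacy: injective by the recognition
  radius, surjective by compactness, and hence a homeomorphism.\<close>

lemma isomorphic_parse:
  assumes V: "V \<in> \<R>" and D: "parse V v D"
  shows "isomorphic (\<lambda>n. n \<in> D) V"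
proof -
  let ?K = "rank1_system (\<lambda>n. n \<in> D)" and ?X = "rank1_system V" and ?f = "substitute v"
  have window: "\<exists>j\<ge>R. (\<forall>i. \<bar>i\<bar> \<le> int R \<longrightarrow> E i = (nat (int j + i) \<in> D)) \<and>
      (\<forall>i. \<bar>i\<bar> \<le> int R \<longrightarrow> ?f E i = V (nat (int j + i)))" if E: "E \<in> ?K" for E R
  proof -
    obtain j where j: "R + length v \<le> j"
      "\<And>i. \<bar>i\<bar> \<le> int (R + length v) \<Longrightarrow> E i = (nat (int j + i) \<in> D)"
      using E unfolding rank1_system_centered by metis
    have "?f E i = V (nat (int j + i))" if "\<bar>i\<bar> \<le> int R" for i
    proof (rule substitute_parse[OF D])
      show "length v \<le> nat (int j + i)" using that j(1) by linarith
      show "E (i - int k) = (nat (int j + i) - k \<in> D)" if "k < length v" for k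
      proof -
        have "nat (int j + (i - int k)) = nat (int j + i) - k" by linarith
        then show ?thesis using j(2)[of "i - int k"] that \<open>\<bar>i\<bar> \<le> int R\<close> by simp
      qed
    qed
    then show ?thesis using j by (intro exI[of _ j]) auto
  qed
  have mem: "?f E \<in> ?X" if "E \<in> ?K" for E
    unfolding rank1_system_centered using window[OF that] by blast
  have surj: "\<exists>E\<in>?K. ?f E = x" if x: "x \<in> ?X" for x
  proof -
    obtain j where j: "\<And>n. n \<le> j n" "\<And>n i. \<bar>i\<bar> \<le> int n \<Longrightarrow> x i = V (nat (int (j n) + i))"
      using x unfolding rank1_system_centered by metis
    \<comment> \<open>The parse of \<open>V\<close> is read around the places where windows of
      \<open>x\<close> occur; a cluster point of these readings is the preimage of
      \<open>x\<close>.\<close>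
    define g where "g n i = (nat (int (j n) + i) \<in> D)" for n i
    have "\<exists>k\<ge>n. \<forall>i. \<bar>i\<bar> \<le> int n \<longrightarrow> g n i = (nat (int k + i) \<in> D)" for n
      using j(1) by (auto simp: g_def)
    then obtain E where E: "E \<in> ?K" "\<And>R N. \<exists>n\<ge>N. \<forall>i. \<bar>i\<bar> \<le> int R \<longrightarrow> g n i = E i"
      using rank1_system_limit[of g "\<lambda>n. n \<in> D"] by metis
    have "?f E i = x i" for i
    proof -
      obtain n where n: "nat \<bar>i\<bar> + length v \<le> n" "\<And>k. \<bar>k\<bar> \<le> int (nat \<bar>i\<bar> + length v) \<Longrightarrow> g n k = E k"
        using E(2) by metis
      have "?f E i = V (nat (int (j n) + i))"
      proof (rule substitute_parse[OF D])
        show "length v \<le> nat (int (j n) + i)" using n(1) j(1)[of n] by linarith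
        show "E (i - int k) = (nat (int (j n) + i) - k \<in> D)" if "k < length v" for k
        proof -
          have "nat (int (j n) + (i - int k)) = nat (int (j n) + i) - k" by linarith
          then show ?thesis using n(2)[of "i - int k"] that by (simp add: g_def)
        qed
      qed
      then show ?thesis using j(2)[of i n] n(1) by simp
    qed
    then show ?thesis using E(1) by blast
  qed
  obtain R where R: "\<And>a b. a + R \<in> D \<Longrightarrow> (\<And>i. i \<le> 2 * R \<Longrightarrow> V (a + i) = V (b + i)) \<Longrightarrow> b + R \<in> D"
    using parse_recognition_radius[OF V D] by metis
  have half: "F p" if E: "E \<in> ?K" and F: "F \<in> ?K" and eq: "?f E = ?f F" and p: "E p" for E F p
  proof -
    define N where "N = nat \<bar>p\<bar> + R"
    obtain j where j: "N \<le> j" "\<And>i. \<bar>i\<bar> \<le> int N \<Longrightarrow> E i = (nat (int j + i) \<in> D)"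
      "\<And>i. \<bar>i\<bar> \<le> int N \<Longrightarrow> ?f E i = V (nat (int j + i))"
      using window[OF E] by metis
    obtain k where k: "N \<le> k" "\<And>i. \<bar>i\<bar> \<le> int N \<Longrightarrow> F i = (nat (int k + i) \<in> D)"
      "\<And>i. \<bar>i\<bar> \<le> int N \<Longrightarrow> ?f F i = V (nat (int k + i))"
      using window[OF F] by metis
    define a b where "a = nat (int j + p - int R)" and "b = nat (int k + p - int R)"
    have ab: "int a = int j + p - int R" "int b = int k + p - int R"
      using j(1) k(1) by (auto simp: a_def b_def N_def)
    have "b + R \<in> D"
    proof (rule R)
      have "a + R = nat (int j + p)" using ab by linarith
      then show "a + R \<in> D" using j(2)[of p] p by (simp add: N_def)
      fix i assume i: "i \<le> 2 * R"
      let ?i = "p - int R + int i"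
      have "\<bar>?i\<bar> \<le> int N" using i by (simp add: N_def)
      moreover have "nat (int j + ?i) = a + i" "nat (int k + ?i) = b + i" using ab by linarith+
      ultimately show "V (a + i) = V (b + i)" using j(3)[of ?i] k(3)[of ?i] eq by simp
    qed
    moreover have "b + R = nat (int k + p)" using ab by linarith
    ultimately show ?thesis using k(2)[of p] by (simp add: N_def)
  qed
  have inj: "inj_on ?f ?K"
  proof (rule inj_onI)
    show "E = F" if "E \<in> ?K" "F \<in> ?K" "?f E = ?f F" for E F
      using half[OF that] half[OF that(2,1) that(3)[symmetric]] by blast
  qed
  have "homeomorphic_map (top_of_set ?K) (top_of_set ?X) ?f"
  proof (rule continuous_imp_homeomorphic_map)
    show "compact_space (top_of_set ?K)" using compact_rank1_system by (simp add: compact_space_subtopology)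
    have "Hausdorff_space (euclidean :: bool topology)"
      unfolding Hausdorff_space_def disjnt_def open_openin[symmetric]
      by (intro allI impI hausdorff) (elim conjE)
    then have "Hausdorff_space (product_topology (\<lambda>i::int. euclidean :: bool topology) UNIV)"
      by (simp add: Hausdorff_space_product_topology)
    then have "Hausdorff_space (euclidean :: (int \<Rightarrow> bool) topology)"
      by (simp add: euclidean_product_topology)
    then show "Hausdorff_space (top_of_set ?X)" by (rule Hausdorff_space_subtopology)
    show "continuous_map (top_of_set ?K) (top_of_set ?X) ?f"
      using mem continuous_on_substitute by (auto simp: continuous_map_in_subtopology)
    show "?f ` topspace (top_of_set ?K) = topspace (top_of_set ?X)"
      using mem surj by (auto simp: image_iff)
    show "inj_on ?f (topspace (top_of_set ?K))" using inj by simp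
  qed
  moreover have "?f (shift E) = shift (?f E)" for E
    by (simp add: substitute_def shift_def fun_eq_iff algebra_simps)
  ultimately show ?thesis unfolding isomorphic_def by blast
qed

lemma common_parse_imp_isomorphic:
  assumes "V \<in> \<R>" "W \<in> \<R>" "common_parse V W"
  shows "isomorphic V W"
proof -
  obtain D where "D \<in> parses V" "D \<in> parses W" using assms(3) by (auto simp: common_parse_def)
  then obtain v w where "parse V v D" "parse W w D" by (auto simp: parses_def)
  then show ?thesis using isomorphic_parse assms isomorphic_sym isomorphic_trans by blast
qed

section \<open>Block codes between rank-1 words\<close>

text \<open>A sliding block code of radius \<open>M\<close> computes \<open>W\<close> from
  \<open>V\<close> at the positions from \<open>M\<close> on; only its existence is
  recorded.\<close>

definition coded_by :: "nat \<Rightarrow> bool word \<Rightarrow> bool word \<Rightarrow> bool"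
  where "coded_by M V W \<longleftrightarrow> (\<forall>a b. (\<forall>i\<le>2 * M. V (a + i) = V (b + i)) \<longrightarrow> W (a + M) = W (b + M))"

text \<open>Two different gaps within a prefix recur in every copy of a longer word, and such copies
  occur arbitrarily far out.\<close>

lemma gaps_differ_beyond:
  assumes V: "V \<in> \<R>" and D: "parse V v D"
  obtains d e where "d \<in> D" "e \<in> D" "m \<le> d" "m \<le> e" "nxt D d - d < nxt D e - e"
proof -
  obtain d0 where d0: "d0 \<in> D" "nxt D d0 - d0 \<noteq> nxt D 0" using parse_gaps_differ[OF \<R>D(2)[OF V] D] .
  obtain n where n: "\<And>v' D'. parse V v' D' \<Longrightarrow> n \<le> length v' \<Longrightarrow> D' \<subseteq> D"
    using long_parse_refines[OF \<R>D(2)[OF V] D] by metis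
  obtain v' D' where D': "parse V v' D'" "max n (Suc (max (nxt D d0) (nxt D 0))) \<le> length v'"
    using long_parse_exists[OF \<R>D(1)[OF V]] .
  have sub: "D' \<subseteq> D" using n D' by simp
  obtain c where c: "c \<in> D'" "m \<le> c"
    using parseD(2)[OF D'(1)] unfolding infinite_nat_iff_unbounded_le by blast
  have shifted: "c + d \<in> D \<and> nxt D (c + d) = c + nxt D d" if d: "d \<in> D" "nxt D d < length v'" for d
  proof
    have less: "d < nxt D d" using nxt_gt[OF parseD(2)[OF D]] .
    show "c + d \<in> D" using subparse_deterministic[OF D D'(1) sub c(1), of d] d less by simp
    show "nxt D (c + d) = c + nxt D d"
    proof (rule nxt_eqI)
      show "c + nxt D d \<in> D"
        using subparse_deterministic[OF D D'(1) sub c(1) d(2)] nxt_mem[OF parseD(2)[OF D]] by blast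
      show "c + d < c + nxt D d" using less by simp
      fix x assume x: "x \<in> D" "c + d < x"
      show "c + nxt D d \<le> x"
      proof (rule ccontr)
        assume "\<not> ?thesis"
        then have l: "x - c < length v'" "x - c < nxt D d" using d(2) x(2) by auto
        have "x - c \<in> D" using subparse_deterministic[OF D D'(1) sub c(1) l(1)] x by simp
        then show False using nxt_le[of "x - c" D d] x(2) l(2) by linarith
      qed
    qed
  qed
  have "c + d0 \<in> D" "nxt D (c + d0) - (c + d0) = nxt D d0 - d0" "c + 0 \<in> D" "nxt D (c + 0) - (c + 0) = nxt D 0 - 0"
    using shifted[OF d0(1)] shifted[OF parseD(3)[OF D]] D'(2) by auto
  then show thesis
    using that[of "c + d0" "c + 0"] that[of "c + 0" "c + d0"] d0(2) c(2)
    by (metis diff_zero linorder_neqE_nat trans_le_add1)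
qed

text \<open>Copies of a long \<open>v\<close> are equal stretches of \<open>V\<close>, which the
  code turns into equal stretches of \<open>W\<close> except for the first and the last
  \<open>M\<close> letters. The first block of \<open>w\<close> may thus be partly invisible, so
  recognition is applied after it, and the start is recovered by going back one block.\<close>

lemma coded_starts_subset:
  assumes code: "coded_by M V W" and W: "W \<in> \<R>" and Dw: "parse W w Dw" and len: "M < length w"
  obtains L where "\<And>v Dv. parse V v Dv \<Longrightarrow> L \<le> length v \<Longrightarrow> Dv \<subseteq> Dw"
proof -
  define d1 where "d1 = nxt Dw 0"
  \<comment> \<open>Both gaps are taken beyond the first block, hence beyond the \<open>M\<close>
    letters that the code does not control.\<close>
  obtain d e where de: "d \<in> Dw" "e \<in> Dw" "d1 \<le> d" "d1 \<le> e" "nxt Dw d - d < nxt Dw e - e"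
    using gaps_differ_beyond[OF W Dw] .
  define r where "r = max (nxt Dw d) (nxt Dw e)"
  have d1: "d1 \<in> Dw" "length w \<le> d1"
    using nxt_mem[OF parseD(2)[OF Dw]] parse_nxt[OF Dw parseD(3)[OF Dw]] by (auto simp: d1_def)
  have "Dv \<subseteq> Dw" if Dv: "parse V v Dv" and L: "r + M + 1 \<le> length v" for v Dv
  proof
    fix k assume k: "k \<in> Dv"
    have agree: "W (k + i) = W i" if i: "M \<le> i" "i + M < length v" for i
    proof -
      have "V (k + (i - M) + j) = V (i - M + j)" if "j \<le> 2 * M" for j
        using parseD(4)[OF Dv k, of "i - M + j"] parse_prefix[OF Dv, of "i - M + j"] i that
        by (simp add: add.assoc)
      then have "W (k + (i - M) + M) = W (i - M + M)" using code unfolding coded_by_def by blast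
      then show ?thesis using i by simp
    qed
    have "r \<ge> d1" using de nxt_gt[OF parseD(2)[OF Dw], of d] by (auto simp: r_def)
    have kd: "k + d1 \<in> Dw"
    proof (rule parse_recognition[OF Dw d1(1), of d r e])
      fix i assume "i \<le> r - d1"
      then show "W (k + d1 + i) = W (d1 + i)"
        using agree[of "d1 + i"] d1 len L \<open>r \<ge> d1\<close> by (simp add: add.assoc)
    qed (use de in \<open>auto simp: r_def\<close>)
    obtain p where p: "p \<in> Dw" "p < k + d1" "nxt Dw p = k + d1"
      using predecessor[OF parseD(3)[OF Dw] kd] d1 len by auto
    \<comment> \<open>Since \<open>M < length w\<close>, the final zero of the first block is
      visible after \<open>k\<close>. It has to lie in the block at \<open>p\<close>, which excludes
      \<open>p < k\<close>.\<close>
    have z: "\<not> W (k + (length w - 1))"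
      using agree[of "length w - 1"] parse_last[OF Dw parseD(3)[OF Dw]] len L d1 \<open>r \<ge> d1\<close> by simp
    have "k + (length w - 1) < k + d1" using d1 len by linarith
    \<comment> \<open>A block starting after \<open>k\<close> would end with a zero among the ones
      that follow the first block.\<close>
    have "p \<le> k"
    proof (rule ccontr)
      assume c: "\<not> p \<le> k"
      define i where "i = p + length w - 1 - k"
      have i: "k + i = p + length w - 1" "length w \<le> i" "i < d1"
        using c len parse_nxt[OF Dw p(1)] p by (auto simp: i_def)
      have "W i" using i by (intro parse_ones[OF Dw parseD(3)[OF Dw]]) (auto simp: d1_def)
      then have "W (k + i)" using agree[of i] i len L \<open>r \<ge> d1\<close> by simp
      then show False using i(1) parse_last[OF Dw p(1)] by simp
    qed
    moreover have "k \<le> p"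
    proof (rule ccontr)
      assume "\<not> k \<le> p"
      then have "k + (length w - 1) < p + length w"
        using parse_zero_in[OF Dw p(1) z] p(3) d1 len by simp
      then show False using \<open>\<not> k \<le> p\<close> len by linarith
    qed
    ultimately show "k \<in> Dw" using p by simp
  qed
  then show thesis using that by blast
qed

text \<open>\<open>D0\<close> and \<open>D\<close> are parses of \<open>W\<close>, \<open>D1\<close>
  is a parse of \<open>V\<close>, and \<open>D \<subseteq> D1 \<subseteq> D0\<close>. The blocks of
  \<open>D1\<close> after a member of \<open>D\<close> are determined up to \<open>M\<close> letters
  before the end of the copy of \<open>w\<close>, and the length of the blocks of \<open>D0\<close>
  leaves no room for later ones. So \<open>D\<close> coarsens \<open>D1\<close> with a constant
  pattern.\<close>

lemma coded_imp_common_parse: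
  assumes V: "V \<in> \<R>" and W: "W \<in> \<R>" and VW: "coded_by M V W" and WV: "coded_by M W V"
  shows "common_parse V W"
proof -
  obtain w0 D0 where D0: "parse W w0 D0" "Suc M \<le> length w0" using long_parse_exists[OF \<R>D(1)[OF W]] .
  obtain L0 where L0: "\<And>v D. parse V v D \<Longrightarrow> L0 \<le> length v \<Longrightarrow> D \<subseteq> D0"
    using coded_starts_subset[OF VW W D0(1)] D0(2) by (metis Suc_le_lessD)
  obtain v1 D1 where D1: "parse V v1 D1" "max L0 (Suc M) \<le> length v1" using long_parse_exists[OF \<R>D(1)[OF V]] .
  obtain L1 where L1: "\<And>w D. parse W w D \<Longrightarrow> L1 \<le> length w \<Longrightarrow> D \<subseteq> D1"
    using coded_starts_subset[OF WV V D1(1)] D1(2) by (metis Suc_le_lessD max.bounded_iff)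
  obtain w D where D: "parse W w D" "L1 \<le> length w" using long_parse_exists[OF \<R>D(1)[OF W]] .
  have sub0: "D1 \<subseteq> D0" using L0[OF D1(1)] D1(2) by simp
  have sub1: "D \<subseteq> D1" using L1[OF D] .
  define n where "n = length w - M"
  have det: "j + i \<in> D1 \<longleftrightarrow> i \<in> D1" if j: "j \<in> D" and i: "i < n" for i j
  proof -
    \<comment> \<open>The first \<open>M\<close> letters are out of reach of the code; they belong
      to a copy of \<open>v1\<close>, which starts at \<open>j\<close> because \<open>D\<close> is
      contained in \<open>D1\<close>.\<close>
    have agree: "V (j + i) = V (0 + i)" if i: "i < n" for i
    proof (cases "i < length v1")
      case True
      then show ?thesis using parseD(4)[OF D1(1), of j i] parse_prefix[OF D1(1)] sub1 j by auto
    next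
      case False
      then have M: "M \<le> i" using D1(2) by simp
      have "W (j + (i - M) + k) = W (i - M + k)" if "k \<le> 2 * M" for k
        using parseD(4)[OF D(1) j, of "i - M + k"] parse_prefix[OF D(1), of "i - M + k"] i M that
        by (simp add: n_def add.assoc)
      then have "V (j + (i - M) + M) = V (i - M + M)" using WV unfolding coded_by_def by blast
      then show ?thesis using M by simp
    qed
    have jD: "j \<in> D1" using j sub1 by blast
    show ?thesis using parse_deterministic[OF D1(1) D1(1) jD parseD(3)[OF D1(1)] agree i] by simp
  qed
  have "D \<in> parses V"
  proof (rule parse_coarsen[OF D1(1) sub1 parseD(2,3)[OF D(1)], where Q = "{i \<in> D1. i < n}"])
    fix j i assume j: "j \<in> D"
    have nj: "nxt D j \<in> D0" using nxt_mem[OF parseD(2)[OF D(1)]] sub0 sub1 by blast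
    show "j + i \<in> D1 \<and> j + i < nxt D j \<longleftrightarrow> i \<in> {i \<in> D1. i < n}"
    proof
      assume a: "j + i \<in> D1 \<and> j + i < nxt D j"
      then have m: "j + i \<in> D0" using sub0 by blast
      \<comment> \<open>The block of \<open>D0\<close> at \<open>j + i\<close> is longer than
        \<open>M\<close> and ends with a zero, so it ends inside the copy of
        \<open>w\<close>.\<close>
      have "j + i + length w0 \<le> nxt D j" using parseD(5)[OF D0(1) m nj] a by simp
      then have "j + i + length w0 - 1 < j + length w"
        using parse_last[OF D0(1) m] D0(2) by (intro parse_zero_in[OF D(1) j]) linarith+
      then have "i < n" using D0(2) by (simp add: n_def)
      then show "i \<in> {i \<in> D1. i < n}" using det[OF j] a by simp
    next
      assume a: "i \<in> {i \<in> D1. i < n}"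
      then show "j + i \<in> D1 \<and> j + i < nxt D j"
        using det[OF j, of i] parse_nxt[OF D(1) j] by (auto simp: n_def)
    qed
  qed
  then show ?thesis using parsesI[OF D(1)] by (auto simp: common_parse_def)
qed

section \<open>Points which contain the whole word\<close>

text \<open>The Curtis-Hedlund-Lyndon argument: if no radius worked, pairs of points agreeing on
  growing windows with different images would accumulate at one point, against continuity
  there.\<close>

lemma continuous_imp_block_code:
  assumes cont: "continuous_map (top_of_set (rank1_system V)) (top_of_set (rank1_system W)) \<phi>"
  obtains M where "\<And>x x'. x \<in> rank1_system V \<Longrightarrow> x' \<in> rank1_system V \<Longrightarrow>
    (\<And>i. \<bar>i\<bar> \<le> int M \<Longrightarrow> x i = x' i) \<Longrightarrow> \<phi> x 0 = \<phi> x' 0"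
proof (rule ccontr)
  assume no: "\<not> thesis"
  note witness = that
  have "\<exists>x x'. x \<in> rank1_system V \<and> x' \<in> rank1_system V \<and> (\<forall>i. \<bar>i\<bar> \<le> int M \<longrightarrow> x i = x' i) \<and> \<phi> x 0 \<noteq> \<phi> x' 0" for M
    using no witness[of M] by blast
  then obtain f g where fg: "\<And>M. f M \<in> rank1_system V" "\<And>M. g M \<in> rank1_system V"
    "\<And>M i. \<bar>i\<bar> \<le> int M \<Longrightarrow> f M i = g M i" "\<And>M. \<phi> (f M) 0 \<noteq> \<phi> (g M) 0"
    by metis
  have "\<exists>j\<ge>n. \<forall>i. \<bar>i\<bar> \<le> int n \<longrightarrow> f n i = V (nat (int j + i))" for n
    using fg(1) unfolding rank1_system_centered by blast
  then obtain z where z: "z \<in> rank1_system V" "\<And>R N. \<exists>n\<ge>N. \<forall>i. \<bar>i\<bar> \<le> int R \<longrightarrow> f n i = z i"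
    using rank1_system_limit[of f V] by metis
  have "open {y. \<forall>i\<in>{0}. y i = \<phi> z i}" by (rule open_cylinder) simp
  then have "openin (top_of_set (rank1_system V)) {x \<in> rank1_system V. \<phi> x 0 = \<phi> z 0}"
    using openin_continuous_map_preimage[OF cont, of "rank1_system W \<inter> {y. \<forall>i\<in>{0}. y i = \<phi> z i}"]
      continuous_map_image_subset_topspace[OF cont]
    by (auto simp: openin_open image_subset_iff cong: conj_cong)
  then obtain T where T: "open T" "{x \<in> rank1_system V. \<phi> x 0 = \<phi> z 0} = rank1_system V \<inter> T"
    by (auto simp: openin_open)
  have "z \<in> T" using T(2) z(1) by blast
  then obtain R where R: "\<And>y. (\<And>i. \<bar>i\<bar> \<le> int R \<Longrightarrow> y i = z i) \<Longrightarrow> y \<in> T"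
    using open_contains_centered_cylinder[OF T(1)] by metis
  obtain n where n: "R \<le> n" "\<And>i. \<bar>i\<bar> \<le> int R \<Longrightarrow> f n i = z i" using z(2) by metis
  have "f n \<in> T" using R n(2) by blast
  moreover have "g n \<in> T" using R n fg(3)[of _ n] by force
  ultimately have "\<phi> (f n) 0 = \<phi> z 0" "\<phi> (g n) 0 = \<phi> z 0" using T(2) fg(1,2) by blast+
  then show False using fg(4) by simp
qed

lemma commutes_shift_by:
  assumes com: "\<And>x. x \<in> rank1_system V \<Longrightarrow> \<phi> (shift x) = shift (\<phi> x)" and x: "x \<in> rank1_system V"
  shows "\<phi> (shift_by k x) = shift_by k (\<phi> x)"
proof -
  have nat: "\<phi> (shift_by (int n) x) = shift_by (int n) (\<phi> x)" if "x \<in> rank1_system V" for n x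
  proof (induction n)
    case (Suc n)
    have "shift_by (int (Suc n)) y = shift (shift_by (int n) y)" for y
      by (simp add: shift_def shift_by_def fun_eq_iff algebra_simps)
    then show ?case using Suc com[OF shift_by_mem[OF that]] by simp
  qed (simp add: shift_by_def)
  have inv: "shift_by (- k) (shift_by k y) = y" "shift_by k (shift_by (- k) y) = y" for k y
    by (simp_all add: shift_by_def)
  show ?thesis
  proof (cases "0 \<le> k")
    case True
    then show ?thesis using nat[OF x, of "nat k"] by simp
  next
    case False
    then have "\<phi> (shift_by (- k) (shift_by k x)) = shift_by (- k) (\<phi> (shift_by k x))"
      using nat[OF shift_by_mem[OF x], of "nat (- k)"] by simp
    then show ?thesis using inv by metis
  qed
qed

lemma block_code_at:
  assumes com: "\<And>x. x \<in> rank1_system V \<Longrightarrow> \<phi> (shift x) = shift (\<phi> x)"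
    and code: "\<And>x x'. x \<in> rank1_system V \<Longrightarrow> x' \<in> rank1_system V \<Longrightarrow>
      (\<And>i. \<bar>i\<bar> \<le> int M \<Longrightarrow> x i = x' i) \<Longrightarrow> \<phi> x 0 = \<phi> x' 0"
    and x: "x \<in> rank1_system V" "x' \<in> rank1_system V" and agree: "\<And>i. \<bar>i\<bar> \<le> int M \<Longrightarrow> x (p + i) = x' (q + i)"
  shows "\<phi> x p = \<phi> x' q"
proof -
  have "\<phi> (shift_by p x) 0 = \<phi> (shift_by q x') 0"
    using agree by (intro code shift_by_mem x) (simp add: shift_by_def add.commute)
  then show ?thesis
    using commutes_shift_by[where \<phi> = \<phi>, OF com x(1), of p] commutes_shift_by[where \<phi> = \<phi>, OF com x(2), of q]
    by (simp add: shift_by_def)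
qed

section \<open>Locating the word inside a point of its system\<close>

lemma eq_word_if_parse_prefixes:
  assumes "W \<in> \<R>" "\<And>w D n. parse W w D \<Longrightarrow> n < length w \<Longrightarrow> y (t + int n) = w ! n"
  shows "y (t + int n) = W n"
proof -
  obtain w D where w: "parse W w D" "Suc n \<le> length w" using long_parse_exists[OF \<R>D(1)[OF assms(1)]] .
  then show ?thesis using assms(2)[OF w(1), of n] parse_prefix[OF w(1), of n] by simp
qed

text \<open>Points that differ at \<open>c\<close> cannot both have a copy of the same word covering
  \<open>c\<close> at the same place. So for each \<open>w\<close> the first common start of a copy
  after \<open>c\<close> is preceded by ones only, back to \<open>c\<close>, and is therefore the
  first zero after \<open>c\<close>. This place is the same for all \<open>w\<close>, hence the
  whole of \<open>W\<close> starts there.\<close>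

lemma right_special:
  assumes W: "W \<in> \<R>" and y: "y \<in> rank1_system W" "y' \<in> rank1_system W"
    and differ: "y c \<noteq> y' c" and agree: "\<And>i. c < i \<Longrightarrow> y i = y' i"
    and zeros: "\<And>i. \<exists>j>i. \<not> y j"
  obtains t where "\<And>n. y (t + int n) = W n"
proof -
  obtain s where s: "\<not> y (c + 1 + int s)" "\<And>i. i < s \<Longrightarrow> y (c + 1 + int i)"
  proof -
    obtain j where "c < j" "\<not> y j" using zeros by blast
    then have ex: "\<not> y (c + 1 + int (nat (j - c - 1)))" by simp
    show thesis
      using that[of "LEAST s. \<not> y (c + 1 + int s)"] LeastI[of "\<lambda>s. \<not> y (c + 1 + int s)", OF ex]
        not_less_Least[of _ "\<lambda>s. \<not> y (c + 1 + int s)"] by blast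
  qed
  define t where "t = Suc s"
  have t: "\<not> y (c + int t)" "\<And>i. 0 < i \<Longrightarrow> i < t \<Longrightarrow> y (c + int i)"
  proof -
    show "\<not> y (c + int t)" using s(1) by (simp add: t_def add.assoc)
    show "y (c + int i)" if "0 < i" "i < t" for i
      using s(2)[of "i - 1"] that by (simp add: t_def of_nat_diff algebra_simps)
  qed
  have "y (c + int t + int n) = w ! n" if Dw: "parse W w Dw" and n: "n < length w" for w Dw n
  proof -
    obtain d where d: "d \<in> Dw" "nxt Dw d - d \<noteq> nxt Dw 0" using parse_gaps_differ[OF \<R>D(2)[OF W] Dw] .
    define r where "r = max (nxt Dw d) (nxt Dw 0)"
    have occ: "q \<in> Dw" if "\<And>i. i \<le> r \<Longrightarrow> W (q + i) = W (0 + i)" for q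
      by (rule parse_recognition[OF Dw parseD(3)[OF Dw] d(1) le0 _ parseD(3)[OF Dw] le0 _ _ that])
        (use d in \<open>auto simp: r_def\<close>)
    obtain u E where u: "parse W u E" "Suc r \<le> length u" using long_parse_exists[OF \<R>D(1)[OF W]] .
    \<comment> \<open>Three zeros give room: the copy of \<open>u\<close> that covers
      \<open>z2\<close> starts after \<open>c\<close> and ends within the window.\<close>
    obtain z1 z2 z3 where z: "c < z1" "\<not> y z1" "z1 + int (length u) < z2" "\<not> y z2"
      "z2 + int (length u) < z3" "\<not> y z3"
      using zeros by metis
    define N where "N = nat (z3 - c) + t + length w"
    obtain j where j: "\<And>i. i < Suc N \<Longrightarrow> y (c + int i) = W (j + i)"
      using y(1) unfolding rank1_system_window by metis
    obtain j' where j': "\<And>i. i < Suc N \<Longrightarrow> y' (c + int i) = W (j' + i)"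
      using y(2) unfolding rank1_system_window by metis
    have WW: "W (j + i) = W (j' + i)" if "0 < i" "i < Suc N" for i
      using j[OF that(2)] j'[OF that(2)] agree[of "c + int i"] that(1) by simp
    have W0: "W j \<noteq> W j'" using j[of 0] j'[of 0] differ by simp
    define k1 k2 k3 where "k1 = nat (z1 - c)" and "k2 = nat (z2 - c)" and "k3 = nat (z3 - c)"
    have k: "0 < k1" "k1 + length u < k2" "k2 + length u < k3" "k3 < Suc N"
      using z by (auto simp: k1_def k2_def k3_def N_def)
    have kz: "\<not> W (j + k2)"
      using z k j[of k2] by (simp add: k2_def)
    obtain e where e: "e \<in> E" "e \<le> j + k2" "j + k2 < e + length u"
      using parseD(6)[OF u(1) kz] by blast
    define m where "m = e - j"
    have m: "e = j + m" "0 < m" "m + length u < Suc N"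
      using e k by (auto simp: m_def)
    have copy: "W (j + m + i) = W (0 + i)" if "i \<le> r" for i
      using parseD(4)[OF u(1) e(1), of i] parse_prefix[OF u(1), of i] u(2) that m(1) by simp
    have mD: "j + m \<in> Dw" by (rule occ) (rule copy)
    have mD': "j' + m \<in> Dw"
    proof (rule occ)
      show "W (j' + m + i) = W (0 + i)" if "i \<le> r" for i
        using copy[OF that] WW[of "m + i"] m that u(2) by (simp add: add.assoc)
    qed
    define a where "a = (LEAST a. 0 < a \<and> j + a \<in> Dw \<and> j' + a \<in> Dw)"
    have a: "0 < a" "j + a \<in> Dw" "j' + a \<in> Dw"
      using LeastI[of "\<lambda>a. 0 < a \<and> j + a \<in> Dw \<and> j' + a \<in> Dw" m] m(2) mD mD' by (auto simp: a_def)
    have am: "a \<le> m" unfolding a_def by (rule Least_le) (use m(2) mD mD' in simp)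
    have amin: "a \<le> b" if "0 < b" "j + b \<in> Dw" "j' + b \<in> Dw" for b
      unfolding a_def by (rule Least_le) (use that in simp)
    have none: "W (j + b)" if b: "0 < b" "b < a" for b
    proof (rule ccontr)
      assume "\<not> W (j + b)"
      \<comment> \<open>The last zero before the common start \<open>a\<close> ends a copy of
        \<open>w\<close> in both points. Such a copy starts either after \<open>c\<close>, against
        the minimality of \<open>a\<close>, or at or before \<open>c\<close>, which makes the
        letters at \<open>c\<close> agree.\<close>
      define B where "B = {b. b < a \<and> \<not> W (j + b)}"
      define x where "x = Max B"
      have fin: "finite B" by (simp add: B_def)
      have bB: "b \<in> B" using b(2) \<open>\<not> W (j + b)\<close> by (simp add: B_def)
      then have "x \<in> B" unfolding x_def using Max_in[OF fin] by blast
      then have x: "x < a" "\<not> W (j + x)" by (auto simp: B_def)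
      have bx: "b \<le> x" unfolding x_def using Max_ge[OF fin bB] .
      have xmax: "W (j + i)" if "x < i" "i < a" for i
      proof (rule ccontr)
        assume "\<not> W (j + i)"
        then have "i \<in> B" using that(2) by (simp add: B_def)
        then have "i \<le> x" unfolding x_def by (rule Max_ge[OF fin])
        then show False using that(1) by simp
      qed
      have x0: "0 < x" "x < Suc N" using bx b(1) x(1) am m(3) by auto
      have x': "\<not> W (j' + x)" using WW[OF x0] x(2) by simp
      have start: "\<exists>f\<in>Dw. f \<le> h + x \<and> f + length w = h + x + 1"
        if h: "\<not> W (h + x)" "h + a \<in> Dw" "\<And>i. x < i \<Longrightarrow> i < a \<Longrightarrow> W (h + i)" for h
      proof -
        obtain f where f: "f \<in> Dw" "f \<le> h + x" "h + x < f + length w"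
          using parseD(6)[OF Dw h(1)] by blast
        have fa: "f + length w \<le> h + a" using parseD(5)[OF Dw f(1) h(2)] f x(1) by simp
        have "f + length w = h + x + 1"
        proof (rule ccontr)
          assume ne: "f + length w \<noteq> h + x + 1"
          define i where "i = f + length w - 1 - h"
          have i: "h + i = f + length w - 1" "x < i" "i < a" using ne f fa by (auto simp: i_def)
          then show False using h(3)[OF i(2,3)] parse_last[OF Dw f(1)] by simp
        qed
        then show ?thesis using f by blast
      qed
      obtain f where f: "f \<in> Dw" "f \<le> j + x" "f + length w = j + x + 1"
        using start[of j] x(2) a(2) xmax by blast
      have "W (j' + i)" if "x < i" "i < a" for i
        using WW[of i] xmax[OF that] that am m(3) by simp
      then obtain f' where f': "f' \<in> Dw" "f' \<le> j' + x" "f' + length w = j' + x + 1"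
        using start[of j'] x' a(3) by blast
      show False
      proof (cases "j < f")
        case True
        then have "f = j + (f - j)" "f' = j' + (f - j)" using f f' by auto
        then have "a \<le> f - j" using True f(1) f'(1) amin[of "f - j"] by simp
        then show False using x(1) f(2) by simp
      next
        case False
        define i where "i = j - f"
        have "j = f + i" "j' = f' + i" "i < length w" using False f f' x0 by (auto simp: i_def)
        then show False using parseD(4)[OF Dw f(1)] parseD(4)[OF Dw f'(1)] W0 by simp
      qed
    qed
    have "t = a"
    proof (rule linorder_cases)
      assume l: "t < a"
      have "W (j + t)" by (rule none) (use l in \<open>simp_all add: t_def\<close>)
      then show ?thesis using j[of t] t(1) by (simp add: N_def)
    next
      assume l: "a < t"
      have "y (c + int a)" by (rule t(2)) (use a(1) l in simp_all)
      then show ?thesis using j[of a] l parse_first[OF Dw a(2)] by (simp add: N_def)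
    qed simp
    then have "W (j + t + n) = w ! n" using parseD(4)[OF Dw a(2) n] by simp
    moreover have "y (c + int (t + n)) = W (j + (t + n))" using n by (intro j) (simp add: N_def)
    ultimately show ?thesis by (simp add: add.assoc)
  qed
  then show thesis using that[of "c + int t"] eq_word_if_parse_prefixes[OF W] by blast
qed

text \<open>Each copy starts with a zero, so for every word \<open>w\<close> the copy covering the
  first zero must start there.\<close>

lemma left_constant:
  assumes W: "W \<in> \<R>" and y: "y \<in> rank1_system W" and ones: "\<And>i. i < c \<Longrightarrow> y i" and zero: "\<not> y z"
  obtains t where "\<And>n. y (t + int n) = W n"
proof -
  have "\<not> z < c" using ones zero by blast
  then have ex: "\<not> y (c + int (nat (z - c)))" using zero by simp
  define s where "s = (LEAST s. \<not> y (c + int s))"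
  have s: "\<not> y (c + int s)" unfolding s_def by (rule LeastI) (rule ex)
  have low: "y i" if "i < c + int s" for i
  proof (cases "i < c")
    case False
    then show ?thesis
      using not_less_Least[of "nat (i - c)" "\<lambda>s. \<not> y (c + int s)"] that by (auto simp: s_def)
  qed (rule ones)
  define t where "t = c + int s"
  have "y (t + int n) = w ! n" if Dw: "parse W w Dw" and n: "n < length w" for w Dw n
  proof -
    obtain j where j: "\<And>k. k < 2 * length w \<Longrightarrow> y (t - int (length w) + int k) = W (j + k)"
      using y unfolding rank1_system_window by metis
    have "length w < 2 * length w" using n by linarith
    from j[OF this] have z: "\<not> W (j + length w)" using s by (simp add: t_def)
    then obtain d where d: "d \<in> Dw" "d \<le> j + length w" "j + length w < d + length w"
      using parseD(6)[OF Dw] by blast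
    have "d = j + length w"
    proof (rule ccontr)
      assume "d \<noteq> j + length w"
      then have k: "d - j < length w" "j + (d - j) = d" using d by auto
      have "y (t - int (length w) + int (d - j))" using k(1) by (intro low) (simp add: t_def)
      then have "W d" using j[of "d - j"] k by simp
      then show False using parse_first[OF Dw d(1)] by simp
    qed
    then have "W (j + length w + n) = w ! n" using parseD(4)[OF Dw d(1) n] by simp
    then show ?thesis using j[of "length w + n"] n by (simp add: add.assoc)
  qed
  then show thesis using that[of t] eq_word_if_parse_prefixes[OF W] by blast
qed

lemma recurrent:
  assumes "V \<in> \<R>"
  obtains k' where "N \<le> k'" "\<And>i. i < l \<Longrightarrow> V (k' + i) = V (k + i)"
proof -
  obtain v D where D: "parse V v D" "k + l \<le> length v" using long_parse_exists[OF \<R>D(1)[OF assms]] .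
  obtain d where d: "N \<le> d" "d \<in> D" using parseD(2)[OF D(1)] unfolding infinite_nat_iff_unbounded_le by blast
  have "V (d + k + i) = V (k + i)" if "i < l" for i
    using parseD(4)[OF D(1) d(2), of "k + i"] parse_prefix[OF D(1), of "k + i"] D(2) that by (simp add: add.assoc)
  then show thesis using that[of "d + k"] d(1) by simp
qed

text \<open>The point is a limit of occurrences of \<open>u\<close> followed by longer and longer
  prefixes of \<open>V\<close>; recurrence moves them far enough to the right to leave room on the
  left.\<close>

lemma left_extension:
  assumes V: "V \<in> \<R>"
    and occ: "\<And>L. \<exists>k. (\<forall>i<length u. V (k + i) = u ! i) \<and> (\<forall>i<L. V (k + length u + i) = V i)"
  obtains x where "x \<in> rank1_system V" "\<And>i. i < length u \<Longrightarrow> x (int i - int (length u)) = u ! i"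
    "\<And>n. x (int n) = V n"
proof -
  have "\<exists>k\<ge>n. (\<forall>i<length u. V (k + i) = u ! i) \<and> (\<forall>i<Suc n. V (k + length u + i) = V i)" for n
  proof -
    obtain k where k: "\<And>i. i < length u \<Longrightarrow> V (k + i) = u ! i" "\<And>i. i < Suc n \<Longrightarrow> V (k + length u + i) = V i"
      using occ by metis
    obtain k' where k': "n \<le> k'" "\<And>i. i < length u + Suc n \<Longrightarrow> V (k' + i) = V (k + i)"
      by (rule recurrent[OF V, where N = n and l = "length u + Suc n" and k = k]) blast
    have "V (k' + length u + i) = V i" if "i < Suc n" for i
      using k'(2)[of "length u + i"] k(2)[OF that] that by (simp add: add.assoc)
    then show ?thesis using k' k(1) by (intro exI[of _ k']) simp
  qed
  then obtain k where k: "\<And>n. n \<le> k n" "\<And>n i. i < length u \<Longrightarrow> V (k n + i) = u ! i"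
    "\<And>n i. i < Suc n \<Longrightarrow> V (k n + length u + i) = V i" by metis
  define g where "g n i = V (nat (int (k n + length u) + i))" for n i
  have "\<exists>j\<ge>n. \<forall>i. \<bar>i\<bar> \<le> int n \<longrightarrow> g n i = V (nat (int j + i))" for n
    using k(1)[of n] unfolding g_def by (intro exI[of _ "k n + length u"]) simp
  then obtain x where x: "x \<in> rank1_system V" "\<And>R N. \<exists>n\<ge>N. \<forall>i. \<bar>i\<bar> \<le> int R \<longrightarrow> g n i = x i"
    using rank1_system_limit[of g V] by metis
  have "x (int i - int (length u)) = u ! i" if "i < length u" for i
  proof -
    obtain n where n: "\<And>i. \<bar>i\<bar> \<le> int (length u) \<Longrightarrow> g n i = x i" using x(2) by metis
    have "nat (int (k n + length u) + (int i - int (length u))) = k n + i" by linarith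
    then show ?thesis using n[of "int i - int (length u)"] k(2)[OF that, of n] that by (simp add: g_def)
  qed
  moreover have "x (int m) = V m" for m
  proof -
    obtain n where n: "m \<le> n" "\<And>i. \<bar>i\<bar> \<le> int m \<Longrightarrow> g n i = x i" using x(2) by metis
    have "nat (int (k n + length u) + int m) = k n + length u + m" by linarith
    then show ?thesis using n(2)[of "int m"] k(3)[of m n] n(1) by (simp add: g_def)
  qed
  ultimately show thesis using that x(1) by blast
qed

lemma ones_unbounded:
  assumes "V \<in> \<R>"
  obtains n where "m \<le> n" "V n"
proof -
  obtain v D where D: "parse V v D" using long_parse_exists[OF \<R>D(1)[OF assms]] by metis
  obtain d e where de: "d \<in> D" "e \<in> D" "m \<le> e" "nxt D d - d < nxt D e - e"
    using gaps_differ_beyond[OF assms D] by metis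
  have "V (e + length v)"
    using parse_nxt[OF D de(1)] de(4) by (intro parse_ones[OF D de(2)]) auto
  then show thesis using that de(3) by (meson trans_le_add1)
qed

lemma zeros_unbounded:
  assumes "V \<in> \<R>"
  obtains n where "m < n" "\<not> V n"
  using long_parse_exists[OF \<R>D(1)[OF assms]] parse_zeros_unbounded by metis

text \<open>A long \<open>w\<close> contains a one. Within zeros consecutive copies of
  \<open>w\<close> would touch, and a window of three lengths of \<open>w\<close> reaches a one of
  the second copy.\<close>

lemma zero_word_not_mem:
  assumes W: "W \<in> \<R>"
  shows "(\<lambda>_. False) \<notin> rank1_system W"
proof
  assume "(\<lambda>_. False) \<in> rank1_system W"
  obtain n where n: "W n" using ones_unbounded[OF W] by metis
  obtain w D where D: "parse W w D" "Suc n \<le> length w" using long_parse_exists[OF \<R>D(1)[OF W]] .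
  obtain j where j: "\<And>k. k < 3 * length w \<Longrightarrow> \<not> W (j + k)"
    using \<open>(\<lambda>_. False) \<in> rank1_system W\<close> unfolding rank1_system_window by metis
  have "\<not> W j" using j[of 0] D(2) by (cases w) auto
  then obtain d where d: "d \<in> D" "d \<le> j" "j < d + length w" using parseD(6)[OF D(1)] by blast
  have "\<not> W (d + length w)" using j[of "d + length w - j"] d by simp
  then have "nxt D d \<le> d + length w"
    using parse_ones[OF D(1) d(1), of "d + length w"] by (metis leI order.refl)
  then have "W (nxt D d + n) \<longleftrightarrow> w ! n" "nxt D d = d + length w"
    using parseD(4)[OF D(1) nxt_mem[OF parseD(2)[OF D(1)]], of n d] D(2) parse_nxt[OF D(1) d(1)] by auto
  then have "W (d + length w + n)" using n parse_prefix[OF D(1), of n] D(2) by simp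
  moreover have "d + length w + n - j < 3 * length w" using d D(2) by linarith
  ultimately show False using j[of "d + length w + n - j"] d by simp
qed

text \<open>The image of a fixed point of the shift is again fixed, hence constant, and the zero
  sequence is excluded.\<close>

lemma constant_image:
  assumes W: "W \<in> \<R>"
    and com: "\<And>x. x \<in> rank1_system V \<Longrightarrow> \<phi> (shift x) = shift (\<phi> x)"
    and mem: "\<And>x. x \<in> rank1_system V \<Longrightarrow> \<phi> x \<in> rank1_system W"
    and ones: "(\<lambda>_. True) \<in> rank1_system V"
  shows "\<phi> (\<lambda>_. True) = (\<lambda>_. True)"
proof -
  have fixed: "shift_by k (\<lambda>_. True) = (\<lambda>_. True)" for k by (simp add: shift_by_def)
  have "\<phi> (\<lambda>_. True) = shift_by k (\<phi> (\<lambda>_. True))" for k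
    using commutes_shift_by[where \<phi> = \<phi>, OF com ones, of k] by (simp add: fixed)
  then have "\<phi> (\<lambda>_. True) 0 = \<phi> (\<lambda>_. True) k" for k
    unfolding shift_by_def by (metis add_0)
  then have "\<phi> (\<lambda>_. True) = (\<lambda>_. \<phi> (\<lambda>_. True) 0)" by auto
  then show ?thesis
    using zero_word_not_mem[OF W] mem[OF ones] by (cases "\<phi> (\<lambda>_. True) 0") auto
qed

text \<open>The points extend \<open>0 1\<^sup>a V\<close> and \<open>1\<^sup>a\<^sup>+\<^sup>1 V\<close> to the left.\<close>

lemma asymptotic_pair:
  assumes V: "V \<in> \<R>"
    and bounded: "\<And>k. \<not> ((\<forall>i<r0. V (k + i)) \<and> (\<forall>i<L0. V (k + r0 + i) = V i))"
  obtains x x' c where "x \<in> rank1_system V" "x' \<in> rank1_system V" "\<And>n. x (int n) = V n"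
    "x c \<noteq> x' c" "\<And>i. c < i \<Longrightarrow> x i = x' i" "c < 0"
proof -
  define P where "P a L \<longleftrightarrow> (\<exists>k. \<not> V k \<and> (\<forall>i<a. V (k + 1 + i)) \<and> (\<forall>i<L. V (k + 1 + a + i) = V i)) \<and>
    (\<exists>k. (\<forall>i<a + 1. V (k + i)) \<and> (\<forall>i<L. V (k + (a + 1) + i) = V i))" for a L
  \<comment> \<open>Here \<open>a\<close> counts the ones in the smaller of two different gaps; the
    larger gap provides \<open>a + 1\<close> ones before the same prefix of \<open>V\<close>. It is
    below \<open>r0\<close> since \<open>r0\<close> ones are never followed by the first
    \<open>L0\<close> letters of \<open>V\<close>.\<close>
  have ex: "\<exists>a<r0. P a L" for L
  proof -
    obtain v D where D: "parse V v D" "max L L0 \<le> length v" using long_parse_exists[OF \<R>D(1)[OF V]] .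
    obtain d e where de: "d \<in> D" "e \<in> D" "nxt D d - d < nxt D e - e"
      using gaps_differ_beyond[OF V D(1), of 0] by metis
    define a where "a = nxt D d - d - length v"
    have lv: "0 < length v" using \<F>D[OF parseD(1)[OF D(1)]] by simp
    have d: "nxt D d = d + length v + a" using parse_nxt[OF D(1) de(1)] by (simp add: a_def)
    have e: "e + length v + a + 1 \<le> nxt D e" using de(3) d by simp
    have start: "V (nxt D c + i) = V i" if "i < length v" for c i
      using parseD(4)[OF D(1) nxt_mem[OF parseD(2)[OF D(1)]] that] parse_prefix[OF D(1) that] by simp
    have onesd: "V (d + length v + i)" if "i < a" for i
      using that d by (intro parse_ones[OF D(1) de(1)]) auto
    have "\<not> V (d + length v - 1)" using parse_last[OF D(1) de(1)] .
    moreover have "V (d + length v - 1 + 1 + i)" if "i < a" for i using onesd[OF that] lv by simp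
    moreover have "V (d + length v - 1 + 1 + a + i) = V i" if "i < L" for i
      using start[of i d] d lv that D(2) by simp
    moreover have "V (nxt D e - (a + 1) + i)" if "i < a + 1" for i
      using that e by (intro parse_ones[OF D(1) de(2)]) auto
    moreover have "V (nxt D e - (a + 1) + (a + 1) + i) = V i" if "i < L" for i
      using start[of i e] e that D(2) by simp
    ultimately have "P a L" unfolding P_def by blast
    moreover have "a < r0"
    proof (rule ccontr)
      assume "\<not> a < r0"
      then have r: "nxt D d - r0 = d + length v + (a - r0)" "nxt D d - r0 + r0 = nxt D d"
        using d by auto
      have "V (nxt D d - r0 + i)" if "i < r0" for i
        using onesd[of "a - r0 + i"] that \<open>\<not> a < r0\<close> r(1) by (simp add: add.assoc)
      moreover have "V (nxt D d - r0 + r0 + i) = V i" if "i < L0" for i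
        using start[of i d] that D(2) r(2) by simp
      ultimately show False using bounded by blast
    qed
    ultimately show ?thesis by blast
  qed
  have mono: "P a L" if "P a L'" "L \<le> L'" for a L L'
    using that unfolding P_def by (meson order.strict_trans2)
  \<comment> \<open>Pigeonhole: \<open>a\<close> takes finitely many values and \<open>P a L\<close>
    is inherited by smaller \<open>L\<close>, so one \<open>a\<close> serves all
    \<open>L\<close>.\<close>
  have "\<exists>a. \<forall>L. P a L"
  proof (rule ccontr)
    assume "\<nexists>a. \<forall>L. P a L"
    then obtain f where f: "\<And>a. \<not> P a (f a)" by metis
    obtain a where a: "a < r0" "P a (Max (f ` {..<r0}))" using ex by blast
    have "f a \<le> Max (f ` {..<r0})" using a(1) by (intro Max_ge) auto
    then show False using mono[OF a(2)] f by blast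
  qed
  then obtain a where a: "\<And>L. P a L" by blast
  obtain x where x: "x \<in> rank1_system V" "\<And>i. i < a + 1 \<Longrightarrow> x (int i - int (a + 1)) = (False # replicate a True) ! i"
    "\<And>n. x (int n) = V n"
  proof (rule left_extension[OF V, of "False # replicate a True"])
    fix L
    obtain k where k: "\<not> V k" "\<forall>i<a. V (k + 1 + i)" "\<forall>i<L. V (k + 1 + a + i) = V i"
      using a[of L] unfolding P_def by blast
    have "V (k + i) = (False # replicate a True) ! i" if "i < a + 1" for i
      using k(1,2) that by (cases i) auto
    then show "\<exists>k. (\<forall>i<length (False # replicate a True). V (k + i) = (False # replicate a True) ! i) \<and>
        (\<forall>i<L. V (k + length (False # replicate a True) + i) = V i)"
      using k(3) by (intro exI[of _ k]) simp
  qed auto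
  obtain x' where x': "x' \<in> rank1_system V" "\<And>i. i < a + 1 \<Longrightarrow> x' (int i - int (a + 1)) = replicate (a + 1) True ! i"
    "\<And>n. x' (int n) = V n"
  proof (rule left_extension[OF V, of "replicate (a + 1) True"])
    fix L
    obtain k where k: "\<forall>i<a + 1. V (k + i)" "\<forall>i<L. V (k + (a + 1) + i) = V i"
      using a[of L] unfolding P_def by blast
    then show "\<exists>k. (\<forall>i<length (replicate (a + 1) True). V (k + i) = replicate (a + 1) True ! i) \<and>
        (\<forall>i<L. V (k + length (replicate (a + 1) True) + i) = V i)"
      by (intro exI[of _ k]) (simp del: replicate.simps)
  qed (auto simp del: replicate.simps)
  show thesis
  proof (rule that[OF x(1) x'(1) x(3), of "- int (a + 1)"])
    show "x (- int (a + 1)) \<noteq> x' (- int (a + 1))"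
      using x(2)[of 0] x'(2)[of 0] by simp
    fix i assume i: "- int (a + 1) < i"
    show "x i = x' i"
    proof (cases "0 \<le> i")
      case True
      then show ?thesis using x(3)[of "nat i"] x'(3)[of "nat i"] by simp
    next
      case False
      define n where "n = nat (i + int (a + 1))"
      have n: "i = int n - int (a + 1)" "0 < n" "n < a + 1" using False i by (auto simp: n_def)
      then show ?thesis using x(2)[OF n(3)] x'(2)[OF n(3)] by (simp add: nth_Cons')
    qed
  qed simp
qed

text \<open>The case distinction is whether arbitrarily long prefixes of \<open>V\<close> occur
  after arbitrarily long runs of ones. In either case a feature to the left of the origin, constancy
  or branching, survives the block code and marks the start of \<open>W\<close> in the
  image.\<close>

lemma anchored_point:
  assumes V: "V \<in> \<R>" and W: "W \<in> \<R>"
    and maps: "homeomorphic_maps (top_of_set (rank1_system V)) (top_of_set (rank1_system W)) \<phi> \<psi>"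
    and com: "\<And>x. x \<in> rank1_system V \<Longrightarrow> \<phi> (shift x) = shift (\<phi> x)"
    and com': "\<And>y. y \<in> rank1_system W \<Longrightarrow> \<psi> (shift y) = shift (\<psi> y)"
    and code: "\<And>x x'. x \<in> rank1_system V \<Longrightarrow> x' \<in> rank1_system V \<Longrightarrow>
      (\<And>i. \<bar>i\<bar> \<le> int M \<Longrightarrow> x i = x' i) \<Longrightarrow> \<phi> x 0 = \<phi> x' 0"
    and code': "\<And>x x'. x \<in> rank1_system W \<Longrightarrow> x' \<in> rank1_system W \<Longrightarrow>
      (\<And>i. \<bar>i\<bar> \<le> int M \<Longrightarrow> x i = x' i) \<Longrightarrow> \<psi> x 0 = \<psi> x' 0"
  obtains x m where "x \<in> rank1_system V" "\<And>n. x (int n) = V n" "\<And>n. \<phi> x (m + int n) = W n"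
proof -
  have mem: "\<phi> x \<in> rank1_system W" "\<psi> (\<phi> x) = x" if "x \<in> rank1_system V" for x
    using maps that by (auto simp: homeomorphic_maps_def continuous_map_def Pi_iff)
  show thesis
  proof (cases "\<forall>r L. \<exists>k. (\<forall>i<r. V (k + i)) \<and> (\<forall>i<L. V (k + r + i) = V i)")
    case True
    define x where "x i = (if i < 0 then True else V (nat i))" for i
    have x: "x \<in> rank1_system V"
      unfolding rank1_system_window
    proof (intro allI)
      fix i :: int and n :: nat
      obtain k where k: "\<forall>j<nat \<bar>i\<bar>. V (k + j)" "\<forall>j<n + nat \<bar>i\<bar>. V (k + nat \<bar>i\<bar> + j) = V j"
        using True by blast
      have "x (i + int l) = V (nat (int (k + nat \<bar>i\<bar>) + i) + l)" if "l < n" for l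
      proof (cases "i + int l < 0")
        case True
        define j where "j = nat (int (nat \<bar>i\<bar>) + i) + l"
        have "j < nat \<bar>i\<bar>" "nat (int (k + nat \<bar>i\<bar>) + i) + l = k + j" using True by (auto simp: j_def)
        then show ?thesis using k(1) True by (simp add: x_def)
      next
        case False
        define j where "j = nat (i + int l)"
        have "j < n + nat \<bar>i\<bar>" "nat (int (k + nat \<bar>i\<bar>) + i) + l = k + nat \<bar>i\<bar> + j"
          using False that by (auto simp: j_def)
        then show ?thesis using k(2) False by (simp add: x_def j_def)
      qed
      then show "\<exists>j. \<forall>k<n. x (i + int k) = V (j + k)" by blast
    qed
    have ones: "(\<lambda>_. True) \<in> rank1_system V"
      unfolding rank1_system_window
    proof (intro allI)
      fix i :: int and n :: nat
      show "\<exists>j. \<forall>k<n. True = V (j + k)" using True[rule_format, of n 0] by auto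
    qed
    have one: "\<phi> (\<lambda>_. True) = (\<lambda>_. True)"
      using constant_image[where \<phi> = \<phi>, OF W com mem(1) ones] .
    have "\<phi> x i" if "i < - int M" for i
    proof -
      have "\<phi> x i = \<phi> (\<lambda>_. True) 0"
        by (rule block_code_at[where \<phi> = \<phi>, OF com code x ones]) (use that in \<open>auto simp: x_def\<close>)
      then show ?thesis by (simp add: one)
    qed
    moreover have "\<exists>z. \<not> \<phi> x z"
    proof (rule ccontr)
      assume "\<nexists>z. \<not> \<phi> x z"
      then have "\<phi> x = (\<lambda>_. True)" by auto
      then have "x = (\<lambda>_. True)" using mem(2)[OF x] mem(2)[OF ones] one by simp
      moreover have "\<not> V 0"
        using long_parse_exists[OF \<R>D(1)[OF V]] parse_first parseD(3) by metis
      ultimately show False by (auto simp: x_def fun_eq_iff split: if_splits)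
    qed
    ultimately obtain m where "\<And>n. \<phi> x (m + int n) = W n"
      using left_constant[OF W mem(1)[OF x], of "- int M"] by metis
    moreover have "x (int n) = V n" for n by (simp add: x_def)
    ultimately show thesis using that x by blast
  next
    case False
    then obtain r0 L0 where "\<And>k. \<not> ((\<forall>i<r0. V (k + i)) \<and> (\<forall>i<L0. V (k + r0 + i) = V i))" by blast
    then obtain x x' c where x: "x \<in> rank1_system V" "x' \<in> rank1_system V" "\<And>n. x (int n) = V n"
      "x c \<noteq> x' c" "\<And>i. c < i \<Longrightarrow> x i = x' i" "c < 0"
      using asymptotic_pair[OF V, of r0 L0] by metis
    have agree: "\<phi> x i = \<phi> x' i" if "int M \<le> i" for i
    proof (rule block_code_at[where \<phi> = \<phi>, OF com code x(1,2)])
      show "x (i + j) = x' (i + j)" if "\<bar>j\<bar> \<le> int M" for j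
        using that x(6) \<open>int M \<le> i\<close> by (intro x(5)) linarith
    qed
    have "\<phi> x \<noteq> \<phi> x'" using mem(2)[OF x(1)] mem(2)[OF x(2)] x(4) by metis
    then obtain z where z: "\<phi> x z \<noteq> \<phi> x' z" by auto
    then have "\<not> int M \<le> z" using agree by blast
    then have exz: "\<phi> x (int M - int (nat (int M - z))) \<noteq> \<phi> x' (int M - int (nat (int M - z)))"
      using z by simp
    define s where "s = (LEAST s. \<phi> x (int M - int s) \<noteq> \<phi> x' (int M - int s))"
    have s: "\<phi> x (int M - int s) \<noteq> \<phi> x' (int M - int s)"
      unfolding s_def by (rule LeastI) (rule exz)
    have right: "\<phi> x i = \<phi> x' i" if "int M - int s < i" for i
    proof (cases "int M \<le> i")
      case False
      define k where "k = nat (int M - i)"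
      have k: "k < s" "i = int M - int k" using False that by (auto simp: k_def)
      show ?thesis using not_less_Least[OF k(1)[unfolded s_def]] by (simp add: k(2))
    qed (rule agree)
    \<comment> \<open>If the image were eventually constant to the right, the inverse block code
      would make \<open>V\<close> eventually constant.\<close>
    have zeros: "\<exists>j>i. \<not> \<phi> x j" for i
    proof (rule ccontr)
      assume one: "\<nexists>j. i < j \<and> \<not> \<phi> x j"
      have "x p = x q" if "i + int M < p" "i + int M < q" for p q
      proof -
        have "\<psi> (\<phi> x) p = \<psi> (\<phi> x) q"
          by (rule block_code_at[where \<phi> = \<psi>, OF com' code' mem(1)[OF x(1)] mem(1)[OF x(1)]]) (use that one in auto)
        then show ?thesis using mem(2)[OF x(1)] by simp
      qed
      then have const: "V p = V q" if "nat \<bar>i + int M\<bar> < p" "nat \<bar>i + int M\<bar> < q" for p q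
      proof -
        have "i + int M < int p" "i + int M < int q" using that by linarith+
        then show ?thesis using \<open>\<And>p q. i + int M < p \<Longrightarrow> i + int M < q \<Longrightarrow> x p = x q\<close> x(3) by metis
      qed
      obtain p where "Suc (nat \<bar>i + int M\<bar>) \<le> p" "V p" using ones_unbounded[OF V] .
      moreover obtain q where "nat \<bar>i + int M\<bar> < q" "\<not> V q" using zeros_unbounded[OF V] .
      ultimately show False using const[of p q] by simp
    qed
    obtain m where "\<And>n. \<phi> x (m + int n) = W n"
      using right_special[OF W mem(1)[OF x(1)] mem(1)[OF x(2)] s right zeros] by metis
    then show thesis using that x(1,3) by blast
  qed
qed

lemma isomorphic_imp_common_parse:
  assumes V: "V \<in> \<R>" and W: "W \<in> \<R>" and iso: "isomorphic V W"
  shows "common_parse V W"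
proof -
  let ?X = "rank1_system V" and ?Y = "rank1_system W"
  obtain \<phi> where \<phi>: "homeomorphic_map (top_of_set ?X) (top_of_set ?Y) \<phi>"
    and com: "\<And>x. x \<in> ?X \<Longrightarrow> \<phi> (shift x) = shift (\<phi> x)"
    using iso unfolding isomorphic_def by blast
  obtain \<psi> where maps: "homeomorphic_maps (top_of_set ?X) (top_of_set ?Y) \<phi> \<psi>"
    using \<phi> homeomorphic_map_maps by blast
  have mem: "\<phi> x \<in> ?Y" "\<psi> (\<phi> x) = x" if "x \<in> ?X" for x
    using maps that by (auto simp: homeomorphic_maps_def continuous_map_def Pi_iff)
  have mem': "\<psi> y \<in> ?X" "\<phi> (\<psi> y) = y" if "y \<in> ?Y" for y
    using maps that by (auto simp: homeomorphic_maps_def continuous_map_def Pi_iff)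
  have com': "\<psi> (shift y) = shift (\<psi> y)" if "y \<in> ?Y" for y
    using com[OF mem'(1)[OF that]] mem'(2)[OF that] mem(2)[OF shift_mem[OF mem'(1)[OF that]]] by simp
  obtain M1 where M1: "\<And>x x'. x \<in> ?X \<Longrightarrow> x' \<in> ?X \<Longrightarrow> (\<And>i. \<bar>i\<bar> \<le> int M1 \<Longrightarrow> x i = x' i) \<Longrightarrow> \<phi> x 0 = \<phi> x' 0"
    using continuous_imp_block_code[of V W \<phi>] maps unfolding homeomorphic_maps_def by blast
  obtain M2 where M2: "\<And>x x'. x \<in> ?Y \<Longrightarrow> x' \<in> ?Y \<Longrightarrow> (\<And>i. \<bar>i\<bar> \<le> int M2 \<Longrightarrow> x i = x' i) \<Longrightarrow> \<psi> x 0 = \<psi> x' 0"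
    using continuous_imp_block_code[of W V \<psi>] maps unfolding homeomorphic_maps_def by blast
  define M where "M = max M1 M2"
  have code: "\<phi> x 0 = \<phi> x' 0" if "x \<in> ?X" "x' \<in> ?X" "\<And>i. \<bar>i\<bar> \<le> int M \<Longrightarrow> x i = x' i" for x x'
    using M1[OF that(1,2)] that(3) by (simp add: M_def)
  have code': "\<psi> x 0 = \<psi> x' 0" if "x \<in> ?Y" "x' \<in> ?Y" "\<And>i. \<bar>i\<bar> \<le> int M \<Longrightarrow> x i = x' i" for x x'
    using M2[OF that(1,2)] that(3) by (simp add: M_def)
  have "\<exists>x m. x \<in> ?X \<and> (\<forall>n. x (int n) = V n) \<and> (\<forall>n. \<phi> x (m + int n) = W n)"
  proof (rule anchored_point[where \<phi> = \<phi> and \<psi> = \<psi> and M = M, OF V W maps])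
    show "\<phi> (shift x) = shift (\<phi> x)" if "x \<in> ?X" for x using com[OF that] .
    show "\<psi> (shift y) = shift (\<psi> y)" if "y \<in> ?Y" for y using com'[OF that] .
    show "\<phi> x 0 = \<phi> x' 0" if "x \<in> ?X" "x' \<in> ?X" "\<And>i. \<bar>i\<bar> \<le> int M \<Longrightarrow> x i = x' i" for x x'
      using code[OF that] .
    show "\<psi> y 0 = \<psi> y' 0" if "y \<in> ?Y" "y' \<in> ?Y" "\<And>i. \<bar>i\<bar> \<le> int M \<Longrightarrow> y i = y' i" for y y'
      using code'[OF that] .
    show "\<exists>x m. x \<in> ?X \<and> (\<forall>n. x (int n) = V n) \<and> (\<forall>n. \<phi> x (m + int n) = W n)"
      if "x \<in> ?X" "\<And>n. x (int n) = V n" "\<And>n. \<phi> x (m + int n) = W n" for x m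
      using that by blast
  qed
  then obtain x m where x: "x \<in> ?X" "\<And>n. x (int n) = V n" "\<And>n. \<phi> x (m + int n) = W n"
    by blast
  \<comment> \<open>The image shows \<open>W\<close> from place \<open>m\<close> on, not from
    \<open>0\<close>; enlarging the radius by the absolute value of \<open>m\<close> absorbs this
    displacement in both directions.\<close>
  define K where "K = M + nat \<bar>m\<bar>"
  have "coded_by K V W"
    unfolding coded_by_def
  proof (intro allI impI)
    fix a b assume agree: "\<forall>i\<le>2 * K. V (a + i) = V (b + i)"
    have "\<phi> x (m + int (a + K)) = \<phi> x (m + int (b + K))"
    proof (rule block_code_at[where \<phi> = \<phi>, OF com code x(1) x(1)])
      fix i assume i: "\<bar>i\<bar> \<le> int M"
      define l where "l = nat (m + int K + i)"
      have l: "m + int (a + K) + i = int (a + l)" "m + int (b + K) + i = int (b + l)" "l \<le> 2 * K"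
        using i by (auto simp: l_def K_def)
      show "x (m + int (a + K) + i) = x (m + int (b + K) + i)"
        unfolding l x(2) using agree l(3) by blast
    qed
    then show "W (a + K) = W (b + K)" unfolding x(3) .
  qed
  moreover have "coded_by K W V"
    unfolding coded_by_def
  proof (intro allI impI)
    fix a b assume agree: "\<forall>i\<le>2 * K. W (a + i) = W (b + i)"
    have "\<psi> (\<phi> x) (int (a + K)) = \<psi> (\<phi> x) (int (b + K))"
    proof (rule block_code_at[where \<phi> = \<psi>, OF com' code' mem(1)[OF x(1)] mem(1)[OF x(1)]])
      fix i assume i: "\<bar>i\<bar> \<le> int M"
      define l where "l = nat (int K + i - m)"
      have l: "int (a + K) + i = m + int (a + l)" "int (b + K) + i = m + int (b + l)" "l \<le> 2 * K"
        using i by (auto simp: l_def K_def)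
      show "\<phi> x (int (a + K) + i) = \<phi> x (int (b + K) + i)"
        unfolding l x(3) using agree l(3) by blast
    qed
    then show "V (a + K) = V (b + K)" unfolding mem(2)[OF x(1)] x(2) .
  qed
  ultimately show ?thesis using coded_imp_common_parse[OF V W] by blast
qed

theorem theorem1p3:
  shows "borel_reducible \<R>_topology isomorphic (euclidean :: (nat \<Rightarrow> bool) topology) E\<^sub>0 \<and>
         borel_reducible (euclidean :: (nat \<Rightarrow> bool) topology) E\<^sub>0 \<R>_topology isomorphic \<and>
         fsigma_in (prod_topology \<R>_topology \<R>_topology)
           {(V, W). V \<in> \<R> \<and> W \<in> \<R> \<and> isomorphic V W}"
proof (intro conjI)
  have iso: "isomorphic V W \<longleftrightarrow> common_parse V W" if "V \<in> \<R>" "W \<in> \<R>" for V W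
    using that common_parse_imp_isomorphic isomorphic_imp_common_parse by blast
  show "borel_reducible \<R>_topology isomorphic (euclidean :: (nat \<Rightarrow> bool) topology) E\<^sub>0"
    using common_parse_reducible iso unfolding borel_reducible_def topspace_\<R>_topology by metis
  show "borel_reducible (euclidean :: (nat \<Rightarrow> bool) topology) E\<^sub>0 \<R>_topology isomorphic"
    unfolding borel_reducible_def
    using limit_word_measurable E\<^sub>0_iff_limit_word iso limit_word_\<R> by blast
  have "{(V, W). V \<in> \<R> \<and> W \<in> \<R> \<and> isomorphic V W} = {(V, W). V \<in> \<R> \<and> W \<in> \<R> \<and> common_parse V W}"
    using iso by auto
  then show "fsigma_in (prod_topology \<R>_topology \<R>_topology) {(V, W). V \<in> \<R> \<and> W \<in> \<R> \<and> isomorphic V W}"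
    using common_parse_fsigma by simp
qed

end
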